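(* Let $M$ be a finite von Neumann algebra acting on a separable complex Hilbert space, $\tau$ a faithful normal trace on $M$, and $p$ a gauge. Let $\Phi=(\phi_n)_{n\ge1}$ be a sequence in $\widehat B_\tau(M)$ dominated by $p$ and such that $\widehat\Phi_\tau=((\widehat{\phi_n})_\tau)_{n\ge1}$ is also dominated by $p$. Then: (i) For any Banach limit $L$, the operator $E_{\Phi,L}$ belongs to $\widehat B_\tau(M)$ and $(\widehat{E_{\Phi,L}})_\tau=E_{\widehat\Phi_\tau,L}$. (ii) If $\Phi$ is abelian (i.e. $\phi_n\phi_m=\phi_m\phi_n$ for all $m,n$), then $E_{\Phi,L_1}$ and $E_{\Phi,L_2}$ commute for any pair $(L_1,L_2)$ of Banach limits. (iii) Assume that $\psi\in\widehat B_\tau(M)$ and that the sequences $\phi_n=\psi^n$ and $(\widehat{\phi_n})_\tau=(\widehat\psi_\tau)^n$ ($n\ge1$) are dominated by the gauge $p$; put $\Phi=(\psi^n)_{n\ge1}$. Then $$E_{\Phi,L_2}\circ E_{\Phi,L_1}=E_{\Phi,L_1}\circ E_{\Phi,L_2}=\gamma_{L_1}(p)E_{\Phi,L_2}=\gamma_{L_2}(p)E_{\Phi,L_1}$$ for any Banach limits $L_1$ and $L_2$. In particular, if $c_p^n/p(n)$ almost converges to a nonzero limit, then $(p(n)^{-1}\phi_n)_{n\ge1}$ weakly almost converges to an operator $\phi$ belonging to $\widehat B_\tau(M)$.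
   Context: A von Neumann algebra $M$ is finite if it admits a faithful normal trace, i.e. an ultra-weakly continuous linear functional $\tau:M\to\mathbf C$ with $\tau(AB)=\tau(BA)$ for all $A,B\in M$, and $\tau(A)\ge0$ for positive $A$, with $\tau(A)=0$ only if $A=0$. $M_*$ is the predual of $M$ and $[l,X]$ ($l\in M_*$, $X\in M$) denotes the duality pairing. $B(M)$ is the algebra of bounded linear operators on the Banach space $M$, and $B_w(M)\subset B(M)$ is the subalgebra of weak*-continuous ones; each $\phi\in B_w(M)$ is the adjoint of a unique bounded operator $\phi_*$ on $M_*$. For $X\in M$ let $l_X\in M_*$, $l_X(Y)=\tau(XY)$; the map $\Psi_\tau:X\mapsto l_X$ is injective with dense range $\widehat M_\tau=\Psi_\tau(M)\subset M_*$. Set $\widehat B_\tau(M)=\{\phi\in B_w(M):\phi_*(\widehat M_\tau)\subset\widehat M_\tau\}$. For $\phi\in\widehat B_\tau(M)$, $\widehat\phi_\tau=\Psi_\tau^{-1}\phi_*\Psi_\tau\in B(M)$; equivalently $\tau(X\phi(Y))=\tau(\widehat\phi_\tau(X)Y)$ for all $X,Y\in M$. A Banach limit is a linear functional $L$ on $\ell^\infty$ (bounded complex sequences) with $\|L\|=L(\mathbf 1)=1$ and $L((u_{n+1}))=L((u_n))$. A bounded sequence $(u_n)_{n\ge1}$ is almost convergent to $c$ if $\lim_{n\to\infty}\sup_{k}\left|\frac1{n+1}\sum_{i=k}^{k+n}u_i-c\right|=0$, and strongly almost convergent to $c$ if $(|u_n-c|)$ is almost convergent to $0$. A sequence $(\phi_n)$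 in $B_w(M)$ is weakly almost convergent to $\phi\in B_w(M)$ if $[l,\phi_n(X)-\phi(X)]$ almost converges to $0$ for every $(l,X)\in M_*\times M$. A gauge is a mapping $p:\mathbf N\to(0,\infty)$ for which there is $c_p>0$ such that the sequence $p(n+1)/p(n)$ is strongly almost convergent to $c_p$. A sequence $(T_n)_{n\ge1}$ of bounded operators on a Banach space is dominated by $p$ if $\|T_n\|\le p(n)$ for every positive integer $n$. For a sequence $\Phi=(\phi_n)_{n\ge1}$ in $B(M)$ dominated by a gauge $p$ and a Banach limit $L$, $E_{\Phi,L}\in B(M)$ is defined by $[l,E_{\Phi,L}(X)]=L(\{[l,\phi_n(X)]p(n)^{-1}\}_{n\ge1})$ for all $(l,X)\in M_*\times M$. Finally $\gamma_L(p)=L(\{c_p^np(n)^{-1}\}_{n\ge1})$. *)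

theory Defs
  imports "HOL-Analysis.Analysis"
begin

section \<open>Complex Hilbert spaces and their bounded operators\<close>

text \<open>The norm, the metric, the topology and completeness come from the class \<open>banach\<close>; the last
  axiom says that the norm is the one given by the inner product, which is linear in its first
  argument. Separability is the additional sort \<open>second_countable_topology\<close>.\<close>

class complex_hilbert = banach +
  fixes scaleC :: "complex \<Rightarrow> 'a \<Rightarrow> 'a" (infixr \<open>*\<^sub>C\<close> 75)
    and cinner :: "'a \<Rightarrow> 'a \<Rightarrow> complex"
  assumes scaleC_add_right: "c *\<^sub>C (x + y) = c *\<^sub>C x + c *\<^sub>C y"
    and scaleC_add_left: "(c + d) *\<^sub>C x = c *\<^sub>C x + d *\<^sub>C x"
    and scaleC_scaleC: "c *\<^sub>C (d *\<^sub>C x) = (c * d) *\<^sub>C x"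
    and scaleR_scaleC: "r *\<^sub>R x = complex_of_real r *\<^sub>C x"
    and cinner_commute: "cinner x y = cnj (cinner y x)"
    and cinner_add_left: "cinner (x + y) z = cinner x z + cinner y z"
    and cinner_scaleC_left: "cinner (c *\<^sub>C x) y = c * cinner x y"
    and cinner_self: "cinner x x = complex_of_real ((norm x)\<^sup>2)"

instantiation complex :: complex_hilbert
begin

definition scaleC_complex :: "complex \<Rightarrow> complex \<Rightarrow> complex" where
  "scaleC_complex c x = c * x"

definition cinner_complex :: "complex \<Rightarrow> complex \<Rightarrow> complex" where
  "cinner_complex x y = x * cnj y"

instance
proof
  show "cinner x x = complex_of_real ((norm x)\<^sup>2)" for x :: complex
    by (simp only: cinner_complex_def complex_norm_square)
qed (simp_all add: scaleC_complex_def cinner_complex_def scaleR_conv_of_real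
      distrib_left distrib_right mult.assoc mult.commute)

end

text \<open>The library type \<open>'h \<Rightarrow>\<^sub>L 'h\<close> consists of the bounded real-linear maps; \<open>bounded_ops\<close> is \<open>B(H)\<close>.\<close>

definition bounded_ops :: "('h::complex_hilbert \<Rightarrow>\<^sub>L 'h) set" where
  "bounded_ops = {A. \<forall>c x. blinfun_apply A (c *\<^sub>C x) = c *\<^sub>C blinfun_apply A x}"

definition op_scale :: "complex \<Rightarrow> ('h::complex_hilbert \<Rightarrow>\<^sub>L 'h) \<Rightarrow> ('h \<Rightarrow>\<^sub>L 'h)" (infixr \<open>\<cdot>\<^sub>C\<close> 75) where
  "c \<cdot>\<^sub>C A = Blinfun (\<lambda>x. c *\<^sub>C blinfun_apply A x)"

definition is_adjoint :: "('h::complex_hilbert \<Rightarrow>\<^sub>L 'h) \<Rightarrow> ('h \<Rightarrow>\<^sub>L 'h) \<Rightarrow> bool" where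
  "is_adjoint A B \<longleftrightarrow> (\<forall>x y. cinner (blinfun_apply A x) y = cinner x (blinfun_apply B y))"

definition positive_op :: "('h::complex_hilbert \<Rightarrow>\<^sub>L 'h) \<Rightarrow> bool" where
  "positive_op A \<longleftrightarrow> (\<forall>x. cinner (blinfun_apply A x) x \<in> \<real>\<^sub>\<ge>\<^sub>0)"

definition commutant :: "('h::complex_hilbert \<Rightarrow>\<^sub>L 'h) set \<Rightarrow> ('h \<Rightarrow>\<^sub>L 'h) set" where
  "commutant S = {B \<in> bounded_ops. \<forall>A\<in>S. A o\<^sub>L B = B o\<^sub>L A}"

definition star_subalgebra :: "('h::complex_hilbert \<Rightarrow>\<^sub>L 'h) set \<Rightarrow> bool" where
  "star_subalgebra M \<longleftrightarrow>
     M \<subseteq> bounded_ops \<and> id_blinfun \<in> M \<and>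
     (\<forall>A\<in>M. \<forall>B\<in>M. A + B \<in> M \<and> A o\<^sub>L B \<in> M) \<and>
     (\<forall>c. \<forall>A\<in>M. c \<cdot>\<^sub>C A \<in> M) \<and>
     (\<forall>A\<in>M. \<exists>B\<in>M. is_adjoint A B)"

definition von_neumann_algebra :: "('h::complex_hilbert \<Rightarrow>\<^sub>L 'h) set \<Rightarrow> bool" where
  "von_neumann_algebra M \<longleftrightarrow> star_subalgebra M \<and> commutant (commutant M) = M"


section \<open>Predual, traces, operators on a von Neumann algebra\<close>

text \<open>The ultra-weak topology on \<open>B(H)\<close> is the coarsest one making continuous all functionals
  \<open>A \<mapsto> \<Sum>n. \<langle>A x\<^sub>n, y\<^sub>n\<rangle>\<close> with \<open>(x\<^sub>n)\<close> and \<open>(y\<^sub>n)\<close> square-summable.\<close>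

definition ultraweak_topology :: "('h::complex_hilbert \<Rightarrow>\<^sub>L 'h) topology" where
  "ultraweak_topology = topology_generated_by
     {{A \<in> bounded_ops. (\<Sum>n. cinner (blinfun_apply A (x n)) (y n)) \<in> U} | x y U.
        summable (\<lambda>n. (norm (x n :: 'h))\<^sup>2) \<and> summable (\<lambda>n. (norm (y n :: 'h))\<^sup>2) \<and> open U}"

text \<open>A functional on \<open>M\<close>, or an operator \<open>M \<rightarrow> M\<close>, is represented by a function that takes the value
  \<open>undefined\<close> outside \<open>M\<close> (\<open>extensional M\<close>), so that equality of functions is equality on \<open>M\<close>.
  Accordingly the composition of operators on \<open>M\<close> is \<open>compose M\<close>.\<close>

definition predual :: "('h::complex_hilbert \<Rightarrow>\<^sub>L 'h) set \<Rightarrow> (('h \<Rightarrow>\<^sub>L 'h) \<Rightarrow> complex) set" where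
  "predual M = {l \<in> extensional M.
     (\<forall>A\<in>M. \<forall>B\<in>M. l (A + B) = l A + l B) \<and>
     (\<forall>c. \<forall>A\<in>M. l (c \<cdot>\<^sub>C A) = c * l A) \<and>
     continuous_map (subtopology ultraweak_topology M) euclidean l}"

definition weak_star_topology ::
  "('h::complex_hilbert \<Rightarrow>\<^sub>L 'h) set \<Rightarrow> ('h \<Rightarrow>\<^sub>L 'h) topology" where
  "weak_star_topology M = topology_generated_by
     {{X \<in> M. l X \<in> U} | l U. l \<in> predual M \<and> open U}"

definition faithful_normal_trace ::
  "('h::complex_hilbert \<Rightarrow>\<^sub>L 'h) set \<Rightarrow> (('h \<Rightarrow>\<^sub>L 'h) \<Rightarrow> complex) \<Rightarrow> bool" where
  "faithful_normal_trace M \<tau> \<longleftrightarrow>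
     \<tau> \<in> predual M \<and>
     (\<forall>A\<in>M. \<forall>B\<in>M. \<tau> (A o\<^sub>L B) = \<tau> (B o\<^sub>L A)) \<and>
     (\<forall>A\<in>M. positive_op A \<longrightarrow> \<tau> A \<in> \<real>\<^sub>\<ge>\<^sub>0 \<and> (\<tau> A = 0 \<longrightarrow> A = 0))"

definition finite_von_neumann_algebra :: "('h::complex_hilbert \<Rightarrow>\<^sub>L 'h) set \<Rightarrow> bool" where
  "finite_von_neumann_algebra M \<longleftrightarrow>
     von_neumann_algebra M \<and> (\<exists>\<tau>. faithful_normal_trace M \<tau>)"

text \<open>\<open>B(M)\<close>, with its operator norm, and \<open>B\<^sub>w(M)\<close>.\<close>

definition BM ::
  "('h::complex_hilbert \<Rightarrow>\<^sub>L 'h) set \<Rightarrow> (('h \<Rightarrow>\<^sub>L 'h) \<Rightarrow> ('h \<Rightarrow>\<^sub>L 'h)) set" where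
  "BM M = {\<phi> \<in> extensional M.
     \<phi> \<in> M \<rightarrow> M \<and>
     (\<forall>A\<in>M. \<forall>B\<in>M. \<phi> (A + B) = \<phi> A + \<phi> B) \<and>
     (\<forall>c. \<forall>A\<in>M. \<phi> (c \<cdot>\<^sub>C A) = c \<cdot>\<^sub>C \<phi> A) \<and>
     (\<exists>K. \<forall>A\<in>M. norm (\<phi> A) \<le> K * norm A)}"

definition BM_norm ::
  "('h::complex_hilbert \<Rightarrow>\<^sub>L 'h) set \<Rightarrow> (('h \<Rightarrow>\<^sub>L 'h) \<Rightarrow> ('h \<Rightarrow>\<^sub>L 'h)) \<Rightarrow> real" where
  "BM_norm M \<phi> = (SUP A\<in>{A \<in> M. norm A \<le> 1}. norm (\<phi> A))"

definition BwM ::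
  "('h::complex_hilbert \<Rightarrow>\<^sub>L 'h) set \<Rightarrow> (('h \<Rightarrow>\<^sub>L 'h) \<Rightarrow> ('h \<Rightarrow>\<^sub>L 'h)) set" where
  "BwM M = {\<phi> \<in> BM M. continuous_map (weak_star_topology M) (weak_star_topology M) \<phi>}"

definition BM_scale :: "('h::complex_hilbert \<Rightarrow>\<^sub>L 'h) set \<Rightarrow> complex \<Rightarrow>
    (('h \<Rightarrow>\<^sub>L 'h) \<Rightarrow> ('h \<Rightarrow>\<^sub>L 'h)) \<Rightarrow> (('h \<Rightarrow>\<^sub>L 'h) \<Rightarrow> ('h \<Rightarrow>\<^sub>L 'h))" where
  "BM_scale M c \<phi> = (\<lambda>X\<in>M. c \<cdot>\<^sub>C \<phi> X)"

definition BM_power :: "('h::complex_hilbert \<Rightarrow>\<^sub>L 'h) set \<Rightarrow>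
    (('h \<Rightarrow>\<^sub>L 'h) \<Rightarrow> ('h \<Rightarrow>\<^sub>L 'h)) \<Rightarrow> nat \<Rightarrow> (('h \<Rightarrow>\<^sub>L 'h) \<Rightarrow> ('h \<Rightarrow>\<^sub>L 'h))" where
  "BM_power M \<phi> n = (\<lambda>X\<in>M. (\<phi> ^^ n) X)"

text \<open>The pre-adjoint \<open>\<phi>\<^sub>*\<close> acts on the predual by \<open>[\<phi>\<^sub>* l, X] = [l, \<phi> X]\<close>.\<close>

definition preadjoint :: "('h::complex_hilbert \<Rightarrow>\<^sub>L 'h) set \<Rightarrow>
    (('h \<Rightarrow>\<^sub>L 'h) \<Rightarrow> ('h \<Rightarrow>\<^sub>L 'h)) \<Rightarrow> (('h \<Rightarrow>\<^sub>L 'h) \<Rightarrow> complex) \<Rightarrow> (('h \<Rightarrow>\<^sub>L 'h) \<Rightarrow> complex)" where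
  "preadjoint M \<phi> l = (\<lambda>X\<in>M. l (\<phi> X))"

definition Psi :: "('h::complex_hilbert \<Rightarrow>\<^sub>L 'h) set \<Rightarrow> (('h \<Rightarrow>\<^sub>L 'h) \<Rightarrow> complex) \<Rightarrow>
    ('h \<Rightarrow>\<^sub>L 'h) \<Rightarrow> (('h \<Rightarrow>\<^sub>L 'h) \<Rightarrow> complex)" where
  "Psi M \<tau> X = (\<lambda>Y\<in>M. \<tau> (X o\<^sub>L Y))"

definition Mhat :: "('h::complex_hilbert \<Rightarrow>\<^sub>L 'h) set \<Rightarrow> (('h \<Rightarrow>\<^sub>L 'h) \<Rightarrow> complex) \<Rightarrow>
    (('h \<Rightarrow>\<^sub>L 'h) \<Rightarrow> complex) set" where
  "Mhat M \<tau> = Psi M \<tau> ` M"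

definition Bhat :: "('h::complex_hilbert \<Rightarrow>\<^sub>L 'h) set \<Rightarrow> (('h \<Rightarrow>\<^sub>L 'h) \<Rightarrow> complex) \<Rightarrow>
    (('h \<Rightarrow>\<^sub>L 'h) \<Rightarrow> ('h \<Rightarrow>\<^sub>L 'h)) set" where
  "Bhat M \<tau> = {\<phi> \<in> BwM M. preadjoint M \<phi> ` Mhat M \<tau> \<subseteq> Mhat M \<tau>}"

definition hat :: "('h::complex_hilbert \<Rightarrow>\<^sub>L 'h) set \<Rightarrow> (('h \<Rightarrow>\<^sub>L 'h) \<Rightarrow> complex) \<Rightarrow>
    (('h \<Rightarrow>\<^sub>L 'h) \<Rightarrow> ('h \<Rightarrow>\<^sub>L 'h)) \<Rightarrow> (('h \<Rightarrow>\<^sub>L 'h) \<Rightarrow> ('h \<Rightarrow>\<^sub>L 'h))" where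
  "hat M \<tau> \<phi> = (\<lambda>X\<in>M. inv_into M (Psi M \<tau>) (preadjoint M \<phi> (Psi M \<tau> X)))"


section \<open>Banach limits, almost convergence, gauges\<close>

text \<open>A Banach limit is a function on all complex sequences of which only the values on
  \<open>\<ell>\<^sup>\<infinity>\<close> (\<open>Bseq\<close>) matter. The \<open>bdd_above\<close> conjunct makes the supremum a genuine one.\<close>

definition banach_limit :: "((nat \<Rightarrow> complex) \<Rightarrow> complex) \<Rightarrow> bool" where
  "banach_limit L \<longleftrightarrow>
     (\<forall>u v. Bseq u \<longrightarrow> Bseq v \<longrightarrow> L (\<lambda>n. u n + v n) = L u + L v) \<and>
     (\<forall>c u. Bseq u \<longrightarrow> L (\<lambda>n. c * u n) = c * L u) \<and>
     bdd_above ((\<lambda>u. cmod (L u)) ` {u. \<forall>n. cmod (u n) \<le> 1}) \<and>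
     (SUP u\<in>{u. \<forall>n. cmod (u n) \<le> 1}. cmod (L u)) = 1 \<and>
     L (\<lambda>n. 1) = 1 \<and>
     (\<forall>u. Bseq u \<longrightarrow> L (\<lambda>n. u (n + 1)) = L u)"

text \<open>Sequences are indexed by the integers \<open>n \<ge> 1\<close>, so \<open>u 0\<close> is ignored throughout;
  \<open>seq_limit L u\<close> is \<open>L({u\<^sub>n}\<^sub>n\<^sub>\<ge>\<^sub>1)\<close>.\<close>

definition seq_limit :: "((nat \<Rightarrow> complex) \<Rightarrow> complex) \<Rightarrow> (nat \<Rightarrow> complex) \<Rightarrow> complex" where
  "seq_limit L u = L (\<lambda>n. u (n + 1))"

definition almost_convergent_to :: "(nat \<Rightarrow> 'a::real_normed_field) \<Rightarrow> 'a \<Rightarrow> bool" where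
  "almost_convergent_to u c \<longleftrightarrow>
     bounded (u ` {1..}) \<and>
     (\<lambda>n. SUP k\<in>{1..}. norm ((\<Sum>i=k..k+n. u i) / of_nat (n + 1) - c)) \<longlonglongrightarrow> 0"

definition strongly_almost_convergent_to :: "(nat \<Rightarrow> 'a::real_normed_field) \<Rightarrow> 'a \<Rightarrow> bool" where
  "strongly_almost_convergent_to u c \<longleftrightarrow>
     bounded (u ` {1..}) \<and> almost_convergent_to (\<lambda>n. norm (u n - c)) 0"

definition gauge_limit :: "(nat \<Rightarrow> real) \<Rightarrow> real \<Rightarrow> bool" where
  "gauge_limit p c \<longleftrightarrow> c > 0 \<and> strongly_almost_convergent_to (\<lambda>n. p (n + 1) / p n) c"

text \<open>The name \<open>gauge\<close> is taken by the gauges of the Henstock-Kurzweil integral.\<close>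

definition growth_gauge :: "(nat \<Rightarrow> real) \<Rightarrow> bool" where
  "growth_gauge p \<longleftrightarrow> (\<forall>n\<ge>1. p n > 0) \<and> (\<exists>c. gauge_limit p c)"

definition gauge_const :: "(nat \<Rightarrow> real) \<Rightarrow> real" where
  "gauge_const p = (THE c. gauge_limit p c)"

definition gauge_gamma :: "((nat \<Rightarrow> complex) \<Rightarrow> complex) \<Rightarrow> (nat \<Rightarrow> real) \<Rightarrow> complex" where
  "gauge_gamma L p = seq_limit L (\<lambda>n. complex_of_real (gauge_const p ^ n / p n))"

definition dominated :: "('h::complex_hilbert \<Rightarrow>\<^sub>L 'h) set \<Rightarrow> (nat \<Rightarrow> real) \<Rightarrow>
    (nat \<Rightarrow> ('h \<Rightarrow>\<^sub>L 'h) \<Rightarrow> ('h \<Rightarrow>\<^sub>L 'h)) \<Rightarrow> bool" where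
  "dominated M p \<Phi> \<longleftrightarrow> (\<forall>n\<ge>1. \<Phi> n \<in> BM M \<and> BM_norm M (\<Phi> n) \<le> p n)"

definition weakly_almost_convergent_to :: "('h::complex_hilbert \<Rightarrow>\<^sub>L 'h) set \<Rightarrow>
    (nat \<Rightarrow> ('h \<Rightarrow>\<^sub>L 'h) \<Rightarrow> ('h \<Rightarrow>\<^sub>L 'h)) \<Rightarrow> (('h \<Rightarrow>\<^sub>L 'h) \<Rightarrow> ('h \<Rightarrow>\<^sub>L 'h)) \<Rightarrow> bool" where
  "weakly_almost_convergent_to M \<Phi> \<phi> \<longleftrightarrow>
     (\<forall>n\<ge>1. \<Phi> n \<in> BwM M) \<and> \<phi> \<in> BwM M \<and>
     (\<forall>l\<in>predual M. \<forall>X\<in>M. almost_convergent_to (\<lambda>n. l (\<Phi> n X - \<phi> X)) 0)"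

text \<open>\<open>Elim M p \<Phi> L\<close> is \<open>E\<^sub>\<Phi>\<^sub>,\<^sub>L\<close>: since \<open>M\<close> is the dual of its predual, \<open>E\<^sub>\<Phi>\<^sub>,\<^sub>L(X)\<close> is the unique
  element of \<open>M\<close> with the prescribed pairings.\<close>

definition Elim :: "('h::complex_hilbert \<Rightarrow>\<^sub>L 'h) set \<Rightarrow> (nat \<Rightarrow> real) \<Rightarrow>
    (nat \<Rightarrow> ('h \<Rightarrow>\<^sub>L 'h) \<Rightarrow> ('h \<Rightarrow>\<^sub>L 'h)) \<Rightarrow> ((nat \<Rightarrow> complex) \<Rightarrow> complex) \<Rightarrow>
    (('h \<Rightarrow>\<^sub>L 'h) \<Rightarrow> ('h \<Rightarrow>\<^sub>L 'h))" where
  "Elim M p \<Phi> L = (\<lambda>X\<in>M. THE Z. Z \<in> M \<and>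
     (\<forall>l\<in>predual M. l Z = seq_limit L (\<lambda>n. l (\<Phi> n X) / complex_of_real (p n))))"

end

theory Submission
  imports Defs
begin

text \<open>Everything rests on two descriptions of the predual, both obtained from the Hahn-Banach theorem:
  a linear functional on \<open>M\<close> is ultraweakly continuous iff it is a norm limit of finite sums of vector
  functionals (so the predual is norm closed), and the functionals \<open>X \<mapsto> \<tau> (A X)\<close> are norm dense in the
  predual (by faithfulness of the trace). Hence a bounded operator on \<open>M\<close> with an adjoint for the trace
  form is automatically weak*-continuous. The operator \<open>E\<close> attached to a Banach limit inherits such an
  adjoint from the \<open>\<phi>\<^sub>n\<close>, which is (i). For (ii), a weak*-continuous operator commuting with all
  \<open>\<phi>\<^sub>n\<close> commutes with \<open>E\<close>; apply this twice. For (iii), shift invariance and the gauge condition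
  give \<open>\<psi> \<circ> E = c\<^sub>p E\<close>, hence \<open>E\<^sub>1 \<circ> E\<^sub>2 = \<gamma>\<^sub>1 E\<^sub>2\<close>. If the limit of \<open>c\<^sub>p\<^sup>n / p n\<close> is nonzero, all
  Banach limits give the same \<open>E\<close>, and Lorentz's theorem turns this into almost convergence.\<close>

section \<open>The Hahn-Banach theorem and Banach limits\<close>

text \<open>The predual is given by ultraweak continuity, so a norm limit of vector functionals lies
  in it only once square-summable vectors representing it have been produced. The obstacle is size:
  a finite sum of small norm on \<open>M\<close> may be written with huge vectors, because
  cancellation in the sum is invisible in the vectors. Separation removes it. Up to a fraction of
  the norm there is a representation whose \<open>vec_weight\<close> is comparable to the norm,
  since an obstruction would be an element \<open>B\<close> of the unit ball of \<open>M\<close> at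
  which the functional exceeds its norm. Iterating on the remainder halves the error and yields
  weights in geometric progression. All separation is done over the reals, in the space of bounded
  real-linear functionals on all operators. Only real parts and one-sided inequalities come out of
  it; complex statements are recovered through multiplication by \<open>\<i>\<close>.\<close>

definition epi_cone :: "('v::real_vector \<times> real) set \<Rightarrow> bool" where
  "epi_cone E \<longleftrightarrow> (0, 0) \<in> E \<and>
     (\<forall>x s y t. (x, s) \<in> E \<and> (y, t) \<in> E \<longrightarrow> (x + y, s + t) \<in> E) \<and>
     (\<forall>x s c. (x, s) \<in> E \<and> c > 0 \<longrightarrow> (c *\<^sub>R x, c * s) \<in> E) \<and>
     (\<forall>t. (0, t) \<in> E \<longrightarrow> t \<ge> 0)"

text \<open>The new cone is \<open>E\<close> plus the ray through \<open>(- x, - a)\<close>. For the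
  sublinear functional q with epigraph \<open>E\<close> this is the passage to the infimum over r >=
  0 of q (y + r x) - r a; a linear functional below it is at least \<open>a\<close> at
  \<open>x\<close>. A point over 0 comes from some y = r x, and for r > 0 dividing by r puts (x, t1
  / r) into \<open>E\<close>, where the hypothesis applies.\<close>

lemma epi_cone_adjoin:
  fixes E :: "('v::real_vector \<times> real) set"
  assumes E: "epi_cone E" and a: "\<And>t. (x, t) \<in> E \<Longrightarrow> a \<le> t"
  obtains E' where "epi_cone E'" "E \<subseteq> E'" "(- x, - a) \<in> E'"
proof
  let ?E = "{(y - r *\<^sub>R x, t - r * a) | y t r. (y, t) \<in> E \<and> r \<ge> 0}"
  have zero: "(0, 0) \<in> E" and add: "\<And>x s y t. (x, s) \<in> E \<Longrightarrow> (y, t) \<in> E \<Longrightarrow> (x + y, s + t) \<in> E"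
    and scale: "\<And>x s c. (x, s) \<in> E \<Longrightarrow> c > 0 \<Longrightarrow> (c *\<^sub>R x, c * s) \<in> E"
    and pos: "\<And>t. (0, t) \<in> E \<Longrightarrow> t \<ge> 0"
    using E unfolding epi_cone_def by blast+
  show "E \<subseteq> ?E"
  proof
    fix z assume z: "z \<in> E"
    have "z = (fst z - 0 *\<^sub>R x, snd z - 0 * a)" by simp
    moreover have "(fst z, snd z) \<in> E" using z by simp
    ultimately show "z \<in> ?E" by blast
  qed
  then have z: "(0, 0) \<in> ?E" using zero by blast
  have mem: "(- x, - a) = (0 - 1 *\<^sub>R x, 0 - 1 * a)"
    by simp
  show "(- x, - a) \<in> ?E"
    unfolding mem using zero zero_le_one by blast
  show "epi_cone ?E"
    unfolding epi_cone_def
  proof (intro conjI allI impI z)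
    fix u s v t assume "(u, s) \<in> ?E \<and> (v, t) \<in> ?E"
    then obtain y1 t1 r1 y2 t2 r2 where *: "u = y1 - r1 *\<^sub>R x" "s = t1 - r1 * a" "(y1, t1) \<in> E" "r1 \<ge> 0"
       "v = y2 - r2 *\<^sub>R x" "t = t2 - r2 * a" "(y2, t2) \<in> E" "r2 \<ge> 0"
      by blast
    have "u + v = (y1 + y2) - (r1 + r2) *\<^sub>R x" "s + t = (t1 + t2) - (r1 + r2) * a"
      using * by (simp_all add: scaleR_add_left distrib_right)
    moreover have "(y1 + y2, t1 + t2) \<in> E" "r1 + r2 \<ge> 0" using * add by auto
    ultimately show "(u + v, s + t) \<in> ?E" by blast
  next
    fix u s and c :: real assume "(u, s) \<in> ?E \<and> c > 0"
    then obtain y1 t1 r1 where *: "u = y1 - r1 *\<^sub>R x" "s = t1 - r1 * a" "(y1, t1) \<in> E" "r1 \<ge> 0" "c > 0"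
      by blast
    have "c *\<^sub>R u = c *\<^sub>R y1 - (c * r1) *\<^sub>R x" "c * s = c * t1 - (c * r1) * a"
      using * by (simp_all add: scaleR_diff_right right_diff_distrib)
    moreover have "(c *\<^sub>R y1, c * t1) \<in> E" "c * r1 \<ge> 0" using * scale by auto
    ultimately show "(c *\<^sub>R u, c * s) \<in> ?E" by blast
  next
    fix t assume "(0, t) \<in> ?E"
    then obtain y1 t1 r1 where *: "0 = y1 - r1 *\<^sub>R x" "t = t1 - r1 * a" "(y1, t1) \<in> E" "r1 \<ge> 0"
      by blast
    show "t \<ge> 0"
    proof (cases "r1 = 0")
      case True
      then show ?thesis using * pos by simp
    next
      case False
      then have r: "r1 > 0" using * by simp
      have "(inverse r1 *\<^sub>R y1, inverse r1 * t1) \<in> E" using scale[OF *(3)] r by simp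
      moreover have "inverse r1 *\<^sub>R y1 = x" using * r by (simp add: right_minus_eq)
      ultimately have "a \<le> inverse r1 * t1" using a by metis
      then show ?thesis using r * by (simp add: field_simps)
    qed
  qed
qed

text \<open>Sublinear functionals are encoded by their epigraphs, so that Zorn's lemma applies to unions.
  Maximal epigraphs belong to minimal sublinear functionals, and these are linear.\<close>

lemma hahn_banach_epi_cone:
  fixes R :: "('v::real_vector \<times> real) set"
  assumes R: "epi_cone R" and tot: "\<And>x. \<exists>t. (x, t) \<in> R"
    and a: "\<And>t. (x0, t) \<in> R \<Longrightarrow> a \<le> t"
  obtains \<phi> where "linear \<phi>" "\<And>x t. (x, t) \<in> R \<Longrightarrow> \<phi> x \<le> t" "\<phi> x0 \<ge> a"
proof -
  \<comment> \<open>The point \<open>(- x0, - a)\<close> is adjoined before maximising, because it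
    encodes the wanted inequality \<open>\<phi> x0 \<ge> a\<close>.\<close>
  obtain R0 where R0: "epi_cone R0" "R \<subseteq> R0" "(- x0, - a) \<in> R0"
    using epi_cone_adjoin[OF R a] by blast
  have "\<exists>E\<in>{E. epi_cone E \<and> R0 \<subseteq> E}. \<forall>X\<in>{E. epi_cone E \<and> R0 \<subseteq> E}. E \<subseteq> X \<longrightarrow> X = E"
  proof (rule subset_Zorn_nonempty)
    show "{E. epi_cone E \<and> R0 \<subseteq> E} \<noteq> {}" using R0 by auto
  next
    fix \<C> assume ne: "\<C> \<noteq> {}" and "subset.chain {E. epi_cone E \<and> R0 \<subseteq> E} \<C>"
    then have sub: "\<And>E. E \<in> \<C> \<Longrightarrow> epi_cone E \<and> R0 \<subseteq> E"
      and ch: "\<And>E F. E \<in> \<C> \<Longrightarrow> F \<in> \<C> \<Longrightarrow> E \<subseteq> F \<or> F \<subseteq> E"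
      unfolding subset_chain_def by auto
    have "epi_cone (\<Union>\<C>)"
      unfolding epi_cone_def
    proof (intro conjI allI impI)
      show "(0, 0) \<in> \<Union>\<C>" using ne sub unfolding epi_cone_def by blast
    next
      fix x s y t assume "(x, s) \<in> \<Union>\<C> \<and> (y, t) \<in> \<Union>\<C>"
      then obtain E F where "E \<in> \<C>" "F \<in> \<C>" "(x, s) \<in> E" "(y, t) \<in> F" by blast
      then obtain G where "G \<in> \<C>" "(x, s) \<in> G" "(y, t) \<in> G" using ch by blast
      then have "(x + y, s + t) \<in> G" using sub unfolding epi_cone_def by blast
      then show "(x + y, s + t) \<in> \<Union>\<C>" using \<open>G \<in> \<C>\<close> by blast
    next
      fix x s and c :: real assume "(x, s) \<in> \<Union>\<C> \<and> c > 0"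
      then show "(c *\<^sub>R x, c * s) \<in> \<Union>\<C>" using sub unfolding epi_cone_def by blast
    next
      fix t assume "(0, t) \<in> \<Union>\<C>"
      then show "t \<ge> 0" using sub unfolding epi_cone_def by blast
    qed
    then show "\<Union>\<C> \<in> {E. epi_cone E \<and> R0 \<subseteq> E}" using ne sub by blast
  qed
  then obtain E where E: "epi_cone E" "R0 \<subseteq> E"
    and max: "\<And>F. epi_cone F \<Longrightarrow> E \<subseteq> F \<Longrightarrow> F = E"
    by auto
  have add: "\<And>x s y t. (x, s) \<in> E \<Longrightarrow> (y, t) \<in> E \<Longrightarrow> (x + y, s + t) \<in> E"
    and scale: "\<And>x s c. (x, s) \<in> E \<Longrightarrow> c > 0 \<Longrightarrow> (c *\<^sub>R x, c * s) \<in> E"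
    and pos: "\<And>t. (0, t) \<in> E \<Longrightarrow> t \<ge> 0"
    using E unfolding epi_cone_def by blast+
  define q where "q x = Inf {t. (x, t) \<in> E}" for x
  have totE: "\<exists>t. (x, t) \<in> E" for x using tot E R0 by blast
  have bdd: "bdd_below {t. (x, t) \<in> E}" for x
  proof -
    obtain s where "(- x, s) \<in> E" using totE by blast
    then have "- s \<le> t" if "(x, t) \<in> E" for t
      using pos[of "s + t"] add[OF _ that, of "- x" s] by simp
    then show ?thesis by (intro bdd_belowI[of _ "- s"]) auto
  qed
  have q_le: "q x \<le> t" if "(x, t) \<in> E" for x t
    unfolding q_def using bdd that by (intro cInf_lower) auto
  \<comment> \<open>By maximality the ray with value \<open>q x\<close> already belongs to
    \<open>E\<close>. This gives q (- x) <= - q x, the inequality that turns sublinear into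
    linear.\<close>
  have neg: "(- x, - q x) \<in> E" for x
  proof -
    obtain F where "epi_cone F" "E \<subseteq> F" "(- x, - q x) \<in> F"
      using epi_cone_adjoin[OF E(1), of x "q x"] q_le by blast
    then show ?thesis using max by blast
  qed
  have q_minus: "q (- x) = - q x" for x
  proof -
    have st: "- t \<le> s" if "(x, s) \<in> E" "(- x, t) \<in> E" for s t
      using pos[of "s + t"] add[OF that] by simp
    have "- t \<le> q x" if "(- x, t) \<in> E" for t
      unfolding q_def using totE[of x] st that by (intro cInf_greatest) auto
    then have "- q x \<le> q (- x)"
      unfolding q_def[of "- x"] using totE[of "- x"] by (intro cInf_greatest) (auto simp: minus_le_iff)
    then show ?thesis using q_le[OF neg, of x] by simp
  qed
  have mem: "(x, q x) \<in> E" for x using neg[of "- x"] q_minus[of x] by simp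
  have sub: "q (x + y) \<le> q x + q y" for x y using q_le add mem by blast
  have sc: "q (c *\<^sub>R x) = c * q x" if "c > 0" for c x
  proof (rule antisym)
    show "q (c *\<^sub>R x) \<le> c * q x" using q_le scale mem that by blast
    have "q (inverse c *\<^sub>R (c *\<^sub>R x)) \<le> inverse c * q (c *\<^sub>R x)"
      using that by (intro q_le scale mem) simp
    then show "c * q x \<le> q (c *\<^sub>R x)" using that by (simp add: field_simps)
  qed
  show thesis
  proof
    show "linear q"
    proof (rule linearI)
      fix x y
      have "q (- x + - y) \<le> q (- x) + q (- y)" by (rule sub)
      moreover have "q (- x + - y) = - q (x + y)" using q_minus[of "x + y"] by simp
      ultimately show "q (x + y) = q x + q y" using sub[of x y] by (simp add: q_minus)
    next
      fix c :: real and x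
      have "q (0::'v) = 0" using q_minus[of "0::'v"] by simp
      moreover have "q (c *\<^sub>R x) = c * q x" if "c < 0"
      proof -
        have "q ((- c) *\<^sub>R x) = (- c) * q x" using that by (intro sc) simp
        then show ?thesis using q_minus[of "c *\<^sub>R x"] by simp
      qed
      ultimately show "q (c *\<^sub>R x) = c *\<^sub>R q x"
        using sc[of c x] by (cases c "0::real" rule: linorder_cases) auto
    qed
    show "\<And>x t. (x, t) \<in> R \<Longrightarrow> q x \<le> t" using q_le R0 E by blast
    have "q (- x0) \<le> - a" using q_le R0 E by blast
    then show "q x0 \<ge> a" using q_minus[of x0] by simp
  qed
qed

section \<open>Rules of calculation for Banach limits\<close>

lemma banach_limit_add:
  "banach_limit L \<Longrightarrow> Bseq u \<Longrightarrow> Bseq v \<Longrightarrow> L (\<lambda>n. u n + v n) = L u + L v"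
  by (simp add: banach_limit_def)

lemma banach_limit_mult: "banach_limit L \<Longrightarrow> Bseq u \<Longrightarrow> L (\<lambda>n. c * u n) = c * L u"
  by (simp add: banach_limit_def)

lemma banach_limit_shift: "banach_limit L \<Longrightarrow> Bseq u \<Longrightarrow> L (\<lambda>n. u (Suc n)) = L u"
  by (simp add: banach_limit_def)

lemma banach_limit_const: "banach_limit L \<Longrightarrow> L (\<lambda>n. c) = c"
  using banach_limit_mult[of L "\<lambda>n. 1" c] by (simp add: banach_limit_def)

lemma banach_limit_bound:
  assumes L: "banach_limit L" and u: "\<And>n. cmod (u n) \<le> B"
  shows "cmod (L u) \<le> B"
proof (cases "B = 0")
  case True
  then have "u = (\<lambda>n. 0)" using u by auto
  then show ?thesis using banach_limit_const[OF L, of 0] True by simp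
next
  case False
  have "B \<ge> 0" using u[of 0] norm_ge_zero order_trans by blast
  then have B: "B > 0" using False by simp
  define v where "v n = u n / of_real B" for n
  have "cmod (v n) \<le> 1" for n using u[of n] B by (simp add: v_def norm_divide)
  then have v: "v \<in> {u. \<forall>n. cmod (u n) \<le> 1}" by auto
  have "cmod (L v) \<le> (SUP u\<in>{u. \<forall>n. cmod (u n) \<le> 1}. cmod (L u))"
    by (rule cSUP_upper[OF v]) (use L in \<open>simp add: banach_limit_def\<close>)
  then have "cmod (L v) \<le> 1" using L by (simp add: banach_limit_def)
  moreover have "Bseq v" using v by (auto simp: Bseq_def intro!: exI[of _ 1])
  then have "L (\<lambda>n. of_real B * v n) = of_real B * L v" by (rule banach_limit_mult[OF L])
  moreover have "(\<lambda>n. of_real B * v n) = u" using B by (auto simp: v_def)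
  ultimately show ?thesis using B by (simp add: norm_mult)
qed

lemma seq_limit_shift:
  assumes "banach_limit L" "Bseq (\<lambda>n. u (Suc n))"
  shows "seq_limit L (\<lambda>n. u (Suc n)) = seq_limit L u"
  using banach_limit_shift[OF assms] by (simp add: seq_limit_def)

lemma Bseq_bounded_from_1:
  fixes u :: "nat \<Rightarrow> 'a::real_normed_vector"
  shows "bounded (u ` {1..}) \<longleftrightarrow> Bseq (\<lambda>n. u (Suc n))"
proof -
  have "{1..} = range Suc" by (auto simp: image_iff Suc_le_eq gr0_conv_Suc)
  then have "u ` {1..} = range (\<lambda>n. u (Suc n))" by (simp add: image_image)
  then show ?thesis by (simp only: Bseq_eq_bounded)
qed

text \<open>A window sum is a sum of \<open>n + 1\<close> shifts of \<open>u\<close>, and each of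
  them has limit \<open>L u\<close>. Boundedness is carried along in the induction because
  \<open>L\<close> is additive on bounded sequences only.\<close>

lemma banach_limit_mean_shift:
  assumes L: "banach_limit L" and u: "Bseq u"
  shows "L (\<lambda>k. (\<Sum>i=k..k+n. u i) / of_nat (n + 1)) = L u"
proof -
  obtain B where B: "\<And>k. cmod (u k) \<le> B" using u by (auto simp: Bseq_def)
  have sum: "Bseq (\<lambda>k. \<Sum>i=k..k+m. u i) \<and> L (\<lambda>k. \<Sum>i=k..k+m. u i) = of_nat (m + 1) * L u" for m
  proof (induction m)
    case 0
    then show ?case using u by simp
  next
    case (Suc m)
    have Bs: "Bseq (\<lambda>k. u (k + Suc m))" using Bseq_ignore_initial_segment[OF u] .
    have sh: "L (\<lambda>k. u (k + j)) = L u" for j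
    proof (induction j)
      case (Suc j)
      have "L (\<lambda>k. u (Suc k + j)) = L (\<lambda>k. u (k + j))"
        by (rule banach_limit_shift[OF L Bseq_ignore_initial_segment[OF u]])
      then show ?case using Suc by simp
    qed simp
    have eq: "(\<Sum>i=k..k+Suc m. u i) = (\<Sum>i=k..k+m. u i) + u (k + Suc m)" for k
      by simp
    have bd: "Bseq (\<lambda>k. (\<Sum>i=k..k+m. u i) + u (k + Suc m))"
    proof (rule BseqI'[where K = "real (m + 2) * B"])
      fix k
      have "norm (\<Sum>i=k..k+Suc m. u i) \<le> real (card {k..k+Suc m}) * B"
        by (rule sum_norm_bound) (use B in auto)
      then show "norm ((\<Sum>i=k..k+m. u i) + u (k + Suc m)) \<le> real (m + 2) * B"
        using eq[of k] by (simp add: algebra_simps)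
    qed
    have "L (\<lambda>k. (\<Sum>i=k..k+m. u i) + u (k + Suc m)) = of_nat (m + 1) * L u + L u"
      using banach_limit_add[OF L _ Bs, of "\<lambda>k. \<Sum>i=k..k+m. u i"] Suc sh[of "Suc m"] by simp
    then show ?case unfolding eq using bd by (simp add: algebra_simps)
  qed
  have "L (\<lambda>k. inverse (of_nat (n + 1)) * (\<Sum>i=k..k+n. u i)) = inverse (of_nat (n + 1)) * (of_nat (n + 1) * L u)"
    using banach_limit_mult[OF L] sum[of n] by metis
  moreover have "of_nat (n + 1) \<noteq> (0::complex)" using of_nat_neq_0[of n] by simp
  ultimately show ?thesis by (simp add: divide_inverse mult.commute[of _ "inverse _"] del: of_nat_add)
qed

section \<open>Almost convergence, and the limits it forces\<close>

lemma almost_convergent_to_D: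
  fixes u :: "nat \<Rightarrow> 'a::real_normed_field"
  assumes "almost_convergent_to u c"
  obtains a where "a \<longlonglongrightarrow> (0::real)"
    "\<And>n k. k \<ge> 1 \<Longrightarrow> norm ((\<Sum>i=k..k+n. u i) / of_nat (n + 1) - c) \<le> a n"
proof
  let ?a = "\<lambda>n. SUP k\<in>{1..}. norm ((\<Sum>i=k..k+n. u i) / of_nat (n + 1) - c)"
  show "?a \<longlonglongrightarrow> 0" using assms by (simp add: almost_convergent_to_def)
  obtain B where B: "\<And>k. k \<ge> 1 \<Longrightarrow> norm (u k) \<le> B"
    using assms unfolding almost_convergent_to_def bounded_iff by auto
  fix n k :: nat assume k: "k \<ge> 1"
  \<comment> \<open>Without this bound the \<open>SUP\<close> would carry no information on the
    individual windows.\<close>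
  have "bdd_above ((\<lambda>k. norm ((\<Sum>i=k..k+n. u i) / of_nat (n + 1) - c)) ` {1..})"
  proof (rule bdd_aboveI2[where M = "B + norm c"])
    fix k :: nat assume "k \<in> {1..}"
    then have "norm (\<Sum>i=k..k+n. u i) \<le> real (card {k..k+n}) * B"
      by (intro sum_norm_bound) (use B in auto)
    then have "norm ((\<Sum>i=k..k+n. u i) / of_nat (n + 1)) \<le> B"
      by (simp add: norm_divide field_simps del: of_nat_Suc)
    then show "norm ((\<Sum>i=k..k+n. u i) / of_nat (n + 1) - c) \<le> B + norm c"
      using norm_triangle_ineq4[of "(\<Sum>i=k..k+n. u i) / of_nat (n + 1)" c] by linarith
  qed
  then show "norm ((\<Sum>i=k..k+n. u i) / of_nat (n + 1) - c) \<le> ?a n"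
    using k by (intro cSUP_upper) auto
qed

lemma almost_convergent_to_I:
  fixes u :: "nat \<Rightarrow> 'a::real_normed_field"
  assumes bd: "bounded (u ` {1..})"
    and ev: "\<And>e. e > 0 \<Longrightarrow>
      \<forall>\<^sub>F n in sequentially. \<forall>k\<ge>1. norm ((\<Sum>i=k..k+n. u i) / of_nat (n + 1) - c) \<le> e"
  shows "almost_convergent_to u c"
  unfolding almost_convergent_to_def
proof (intro conjI bd tendstoI)
  fix e :: real assume e: "e > 0"
  let ?f = "\<lambda>n k. norm ((\<Sum>i=k..k+n. u i) / of_nat (n + 1) - c)"
  show "\<forall>\<^sub>F n in sequentially. dist (SUP k\<in>{1..}. ?f n k) 0 < e"
    using ev[OF half_gt_zero[OF e]]
  proof eventually_elim
    case (elim n)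
    have le: "(SUP k\<in>{1..}. ?f n k) \<le> e / 2" by (rule cSUP_least) (use elim in auto)
    have "bdd_above (?f n ` {1..})" by (rule bdd_aboveI2[where M = "e / 2"]) (use elim in auto)
    then have "?f n 1 \<le> (SUP k\<in>{1..}. ?f n k)" by (intro cSUP_upper) auto
    then have "0 \<le> (SUP k\<in>{1..}. ?f n k)" using norm_ge_zero order_trans by blast
    then show ?case using le e by simp
  qed
qed

text \<open>\<open>L\<close> does not change when the sequence is replaced by its window means, and
  these lie within \<open>a n\<close> of \<open>c\<close> uniformly in the starting index.
  Contractivity of \<open>L\<close> then bounds the distance of the limit from \<open>c\<close> by
  \<open>a n\<close>, for every \<open>n\<close>.\<close>

lemma seq_limit_almost_convergent:
  assumes L: "banach_limit L" and u: "almost_convergent_to u c"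
  shows "seq_limit L u = c"
proof -
  obtain a where a: "a \<longlonglongrightarrow> (0::real)"
    and le: "\<And>n k. k \<ge> 1 \<Longrightarrow> norm ((\<Sum>i=k..k+n. u i) / of_nat (n + 1) - c) \<le> a n"
    using almost_convergent_to_D[OF u] by blast
  define v where "v = (\<lambda>n. u (Suc n))"
  have v: "Bseq v" using u Bseq_bounded_from_1[of u] unfolding v_def almost_convergent_to_def by simp
  have "cmod (L v - c) \<le> a n" for n
  proof -
    let ?m = "\<lambda>k. (\<Sum>i=k..k+n. v i) / of_nat (n + 1)"
    have shift: "(\<Sum>i=k..k+n. v i) = (\<Sum>i=Suc k..Suc k+n. u i)" for k
      unfolding v_def using sum.shift_bounds_cl_Suc_ivl[of u k "k+n"] by simp
    have le': "cmod (?m k + (- c)) \<le> a n" for k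
      using le[of "Suc k" n] shift[of k] by simp
    have Bm: "Bseq ?m"
    proof (rule BseqI'[where K = "a n + cmod c"])
      fix k show "cmod (?m k) \<le> a n + cmod c"
        using le'[of k] norm_triangle_ineq2[of "?m k" c] by (simp del: of_nat_add)
    qed
    have "L (\<lambda>k. ?m k + (- c)) = L v + (- c)"
      using banach_limit_add[OF L Bm, of "\<lambda>k. - c"] banach_limit_mean_shift[OF L v, of n]
        banach_limit_const[OF L, of "- c"] by (simp add: Bseq_def exI[of _ "cmod c + 1"])
    then show ?thesis using banach_limit_bound[where u = "\<lambda>k. ?m k + (- c)", OF L le'] by simp
  qed
  then have "cmod (L v - c) \<le> 0" using a by (intro LIMSEQ_le_const[OF a]) auto
  then show ?thesis by (simp add: seq_limit_def v_def)
qed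


text \<open>Strong almost convergence is what makes a bounded factor harmless: the window means of
  \<open>norm (u n)\<close> dominate those of \<open>u n * v n\<close> up to a constant, whereas
  mere cancellation in the means of \<open>u\<close> could be destroyed by \<open>v\<close>.\<close>

lemma strongly_almost_convergent_mult:
  fixes u v :: "nat \<Rightarrow> complex"
  assumes u: "almost_convergent_to (\<lambda>n. norm (u n)) 0" and v: "bounded (v ` {1..})"
  shows "almost_convergent_to (\<lambda>n. u n * v n) 0"
proof -
  obtain a where a: "a \<longlonglongrightarrow> (0::real)"
    and le: "\<And>n k. k \<ge> 1 \<Longrightarrow> norm ((\<Sum>i=k..k+n. norm (u i)) / of_nat (n + 1) - 0) \<le> a n"
    using almost_convergent_to_D[OF u] by blast
  obtain C0 where C0: "\<And>k. k \<ge> 1 \<Longrightarrow> cmod (v k) \<le> C0" using v unfolding bounded_iff by auto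
  define C where "C = max C0 1"
  have C: "\<And>k. k \<ge> 1 \<Longrightarrow> cmod (v k) \<le> C" "C > 0" using C0 unfolding C_def by force+
  obtain D where D: "\<And>k. k \<ge> 1 \<Longrightarrow> cmod (u k) \<le> D"
    using u unfolding almost_convergent_to_def bounded_iff by auto
  show ?thesis
  proof (rule almost_convergent_to_I)
    have "cmod (u k * v k) \<le> D * C" if "k \<ge> 1" for k
      unfolding norm_mult using C(1)[OF that] D[OF that] by (intro mult_mono) (auto intro: order_trans[OF norm_ge_zero])
    then show "bounded ((\<lambda>n. u n * v n) ` {1..})" unfolding bounded_iff by auto
    fix e :: real assume e: "e > 0"
    have "(\<lambda>n. a n * C) \<longlonglongrightarrow> 0" using a by (rule tendsto_mult_left_zero)
    then have "\<forall>\<^sub>F n in sequentially. a n * C < e" using e by (rule order_tendstoD)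
    then show "\<forall>\<^sub>F n in sequentially. \<forall>k\<ge>1. norm ((\<Sum>i=k..k+n. u i * v i) / of_nat (n + 1) - 0) \<le> e"
    proof eventually_elim
      case (elim n)
      show ?case
      proof (intro allI impI)
        fix k :: nat assume k: "k \<ge> 1"
        have "norm (\<Sum>i=k..k+n. u i * v i) \<le> (\<Sum>i=k..k+n. norm (u i) * C)"
          by (rule sum_norm_le) (use C k in \<open>auto simp: norm_mult intro!: mult_left_mono\<close>)
        also have "\<dots> = (\<Sum>i=k..k+n. norm (u i)) * C" by (simp add: sum_distrib_right)
        finally have "norm (\<Sum>i=k..k+n. u i * v i) / of_nat (n + 1) \<le> (\<Sum>i=k..k+n. norm (u i)) / of_nat (n + 1) * C"
          by (simp add: divide_right_mono)
        also have "\<dots> \<le> a n * C"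
          using le[OF k, of n] C(2) by (intro mult_right_mono) (auto simp: sum_nonneg abs_of_nonneg)
        finally show "norm ((\<Sum>i=k..k+n. u i * v i) / of_nat (n + 1) - 0) \<le> e"
          using elim by (simp add: norm_divide del: of_nat_Suc of_nat_add)
      qed
    qed
  qed
qed

text \<open>A bounded sequence cannot decrease by a fixed amount at every step. With
  \<open>f\<close> the real part of a corrector \<open>w\<close>, this is the condition at 0 that a
  cone for Banach limits has to meet.\<close>

lemma bounded_increment_nonneg:
  fixes f :: "nat \<Rightarrow> real"
  assumes bd: "\<And>k. \<bar>f k\<bar> \<le> K" and inc: "\<And>k. f (Suc k) \<le> f k + t"
  shows "t \<ge> 0"
proof (rule ccontr)
  assume "\<not> t \<ge> 0"
  then have t: "t < 0" by simp
  have le: "f n \<le> f 0 + real n * t" for n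
  proof (induction n)
    case (Suc n)
    then show ?case using inc[of n] by (simp add: algebra_simps)
  qed simp
  obtain n where n: "2 * K + 1 < real n * (- t)"
    using t ex_less_of_nat_mult[of "- t" "2 * K + 1"] by auto
  show False using bd[of n] bd[of 0] le[of n] n by simp
qed

text \<open>The sublinear functional behind this is
  \<open>u \<mapsto> inf\<^sub>w sup\<^sub>k Re (u\<^sub>k - w\<^sub>k + w\<^sub>k\<^sub>+\<^sub>1)\<close>, which vanishes on coboundaries, so that every linear
  functional below it is invariant under the shift.\<close>

lemma exists_banach_limit_ge:
  assumes u: "Bseq u"
    and a: "\<And>w t. Bseq w \<Longrightarrow> (\<And>k. Re (u k - w k + w (Suc k)) \<le> t) \<Longrightarrow> a \<le> t"
  obtains L where "banach_limit L" "Re (L u) \<ge> a"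
proof -
  \<comment> \<open>Bounded continuous functions on the discrete space \<open>nat\<close> serve as
    the real vector space of bounded sequences.\<close>
  define R :: "((nat \<Rightarrow>\<^sub>C complex) \<times> real) set"
    where "R = {(b :: nat \<Rightarrow>\<^sub>C complex, t). \<exists>w::nat \<Rightarrow>\<^sub>C complex. \<forall>k. Re (b k - w k + w (Suc k)) \<le> t}"
  define B :: "(nat \<Rightarrow> complex) \<Rightarrow> (nat \<Rightarrow>\<^sub>C complex)" where "B = Bcontfun"
  have B: "apply_bcontfun (B v) = v" if "Bseq v" for v
    unfolding B_def using that
    by (intro Bcontfun_inverse) (auto simp: bcontfun_def Bseq_eq_bounded)
  have Bs: "Bseq (apply_bcontfun b)" for b :: "nat \<Rightarrow>\<^sub>C complex"
    by (simp add: Bseq_eq_bounded)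
  have R0: "(b, t) \<in> R" if "\<And>k. Re (b k) \<le> t" for t and b :: "nat \<Rightarrow>\<^sub>C complex"
    unfolding R_def using that by (auto intro!: exI[of _ 0])
  have "epi_cone R"
    unfolding epi_cone_def
  proof (intro conjI allI impI)
    show "(0, 0) \<in> R" by (rule R0) simp
  next
    fix x s y t assume "(x, s) \<in> R \<and> (y, t) \<in> R"
    then obtain w w' :: "nat \<Rightarrow>\<^sub>C complex" where w: "\<And>k. Re (x k - w k + w (Suc k)) \<le> s" "\<And>k. Re (y k - w' k + w' (Suc k)) \<le> t"
      unfolding R_def by blast
    have "Re ((x + y) k - (w + w') k + (w + w') (Suc k)) \<le> s + t" for k
      using w[of k] by simp
    then show "(x + y, s + t) \<in> R" unfolding R_def by blast
  next
    fix x s and c :: real assume "(x, s) \<in> R \<and> c > 0"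
    then obtain w :: "nat \<Rightarrow>\<^sub>C complex" where w: "\<And>k. Re (x k - w k + w (Suc k)) \<le> s" and c: "c > 0"
      unfolding R_def by blast
    have "Re ((c *\<^sub>R x) k - (c *\<^sub>R w) k + (c *\<^sub>R w) (Suc k)) \<le> c * s" for k
      using mult_left_mono[OF w[of k], of c] c by (simp add: algebra_simps)
    then show "(c *\<^sub>R x, c * s) \<in> R" unfolding R_def by blast
  next
    fix t assume "(0, t) \<in> R"
    then obtain w :: "nat \<Rightarrow>\<^sub>C complex" where w: "\<And>k. Re (w (Suc k)) \<le> Re (w k) + t"
      unfolding R_def by (auto simp: algebra_simps)
    have "\<bar>Re (w k)\<bar> \<le> norm w" for k
      using abs_Re_le_cmod[of "w k"] norm_bounded[of w k] by linarith
    then show "t \<ge> 0" using w by (rule bounded_increment_nonneg)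
  qed
  moreover have "\<exists>t. (b, t) \<in> R" for b
    using R0[of b "norm b"] complex_Re_le_cmod norm_bounded order_trans by blast
  moreover have "a \<le> t" if Bt: "(B u, t) \<in> R" for t
  proof -
    obtain w :: "nat \<Rightarrow>\<^sub>C complex" where "\<forall>k. Re (B u k - w k + w (Suc k)) \<le> t"
      using Bt unfolding R_def by blast
    then show ?thesis using a[OF Bs[of w]] B[OF u] by simp
  qed
  ultimately obtain \<phi> where lin: "linear \<phi>" and le: "\<And>x t. (x, t) \<in> R \<Longrightarrow> \<phi> x \<le> t"
    and ge: "\<phi> (B u) \<ge> a"
    using hahn_banach_epi_cone[of R "B u" a] by blast
  interpret \<phi>: linear \<phi> by (rule lin)
  \<comment> \<open>The complex functional with real part \<phi>, namely \<phi>(v) - i \<phi>(i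
    v).\<close>
  define L where "L v = Complex (\<phi> (B v)) (- \<phi> (B (\<lambda>n. \<i> * v n)))" for v
  have Bi: "Bseq (\<lambda>n. c * v n)" if "Bseq v" for v :: "nat \<Rightarrow> complex" and c by (intro Bseq_mult Bfun_const that)
  have add: "B (\<lambda>n. v n + w n) = B v + B w" if v: "Bseq v" and w: "Bseq w" for v w
  proof -
    have "apply_bcontfun (B v + B w) = (\<lambda>n. v n + w n)" using B[OF v] B[OF w] by auto
    then show ?thesis unfolding B_def by (metis apply_bcontfun_inverse)
  qed
  have mult: "B (\<lambda>n. c * v n) = Re c *\<^sub>R B v + Im c *\<^sub>R B (\<lambda>n. \<i> * v n)" if v: "Bseq v" for c v
    by (rule bcontfun_eqI) (simp add: B Bi v complex_eq_iff)
  have L_add: "L (\<lambda>n. v n + w n) = L v + L w" if "Bseq v" "Bseq w" for v w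
  proof -
    have "B (\<lambda>n. \<i> * (v n + w n)) = B (\<lambda>n. \<i> * v n) + B (\<lambda>n. \<i> * w n)"
      unfolding distrib_left by (rule add) (simp_all add: Bi that)
    then show ?thesis by (simp add: L_def add that \<phi>.add complex_eq_iff)
  qed
  have L_mult: "L (\<lambda>n. c * v n) = c * L v" if v: "Bseq v" for c v
  proof -
    have "B (\<lambda>n. \<i> * (c * v n)) = Re (\<i> * c) *\<^sub>R B v + Im (\<i> * c) *\<^sub>R B (\<lambda>n. \<i> * v n)"
      using mult[OF v, of "\<i> * c"] by (simp add: mult.assoc)
    then show ?thesis
      by (simp add: L_def mult[OF v, of c] \<phi>.add \<phi>.diff \<phi>.scale complex_eq_iff)
  qed
  have shift: "\<phi> (B (\<lambda>n. v (Suc n))) = \<phi> (B v)" if v: "Bseq v" for v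
  proof -
    have v': "Bseq (\<lambda>n. v (Suc n))" using Bseq_ignore_initial_segment[OF v, of 1] by simp
    \<comment> \<open>The corrector \<open>- B v\<close> cancels this coboundary exactly. Together
      with the opposite sign below, this squeezes the value of \<phi> on the coboundary to
      0.\<close>
    have 1: "(B (\<lambda>n. v (Suc n)) - B v, 0) \<in> R"
      unfolding R_def by (auto simp: B v v' intro!: exI[of _ "- B v"])
    have 2: "(B v - B (\<lambda>n. v (Suc n)), 0) \<in> R"
      unfolding R_def by (auto simp: B v v' intro!: exI[of _ "B v"])
    from le[OF 1] le[OF 2] show ?thesis by (simp add: \<phi>.diff)
  qed
  have one: "L (\<lambda>n. 1) = 1"
  proof -
    have c: "\<phi> (B (\<lambda>n. c)) = Re c" for c
    proof -
      have cB: "Bseq (\<lambda>n. c)" by (rule Bfun_const)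
      have "(B (\<lambda>n. c), Re c) \<in> R" "(- B (\<lambda>n. c), - Re c) \<in> R" by (rule R0; simp add: B cB)+
      from le[OF this(1)] le[OF this(2)] show ?thesis by (simp add: \<phi>.neg)
    qed
    show ?thesis using c[of 1] c[of \<i>] by (simp add: L_def complex_eq_iff)
  qed
  have bound: "cmod (L v) \<le> 1" if v: "\<And>n. cmod (v n) \<le> 1" for v
  proof -
    have Bv: "Bseq v" by (rule BseqI') (rule v)
    \<comment> \<open>Rotation by \<open>c\<close> makes \<open>L v\<close> real and nonnegative, so
      its modulus is itself a value of \<phi>.\<close>
    define c where "c = cnj (sgn (L v))"
    have c: "cmod c \<le> 1" by (simp add: c_def norm_sgn)
    have "c * L v = of_real (cmod (L v))"
      unfolding c_def sgn_eq by (simp add: complex_norm_square[symmetric] power2_eq_square mult.commute)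
    then have "cmod (L v) = \<phi> (B (\<lambda>n. c * v n))"
      using L_mult[OF Bv, of c] by (simp add: L_def complex_eq_iff)
    also have "\<dots> \<le> 1"
    proof (rule le[OF R0])
      fix k
      have "cmod (c * v k) \<le> 1" unfolding norm_mult using c v by (rule mult_le_one[OF _ norm_ge_zero])
      then show "Re (B (\<lambda>n. c * v n) k) \<le> 1"
        using complex_Re_le_cmod[of "c * v k"] by (simp add: B Bi Bv)
    qed
    finally show ?thesis .
  qed
  have "banach_limit L"
    unfolding banach_limit_def
  proof (intro conjI allI impI L_add L_mult one)
    show bdd: "bdd_above ((\<lambda>u. cmod (L u)) ` {u. \<forall>n. cmod (u n) \<le> 1})"
      by (rule bdd_aboveI2[where M = 1]) (use bound in auto)
    show "(SUP u\<in>{u. \<forall>n. cmod (u n) \<le> 1}. cmod (L u)) = 1"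
    proof (rule antisym)
      show "(SUP u\<in>{u. \<forall>n. cmod (u n) \<le> 1}. cmod (L u)) \<le> 1"
        by (rule cSUP_least) (use bound in \<open>auto intro!: exI[of _ "\<lambda>n. 0"]\<close>)
      have "cmod (L (\<lambda>n. 1)) \<le> (SUP u\<in>{u. \<forall>n. cmod (u n) \<le> 1}. cmod (L u))"
        using bdd by (intro cSUP_upper) auto
      then show "1 \<le> (SUP u\<in>{u. \<forall>n. cmod (u n) \<le> 1}. cmod (L u))" by (simp add: one)
    qed
    show "L (\<lambda>n. v (n + 1)) = L v" if "Bseq v" for v
      using shift[OF that] shift[OF Bi[OF that, of \<i>]] by (simp add: L_def)
  qed
  moreover have "Re (L u) \<ge> a" using ge by (simp add: L_def)
  ultimately show thesis using that by blast
qed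

lemma exists_banach_limit: "\<exists>L. banach_limit L"
proof (rule exists_banach_limit_ge[of "\<lambda>n. 0" 0])
  fix w :: "nat \<Rightarrow> complex" and t
  assume w: "Bseq w" "\<And>k. Re (0 - w k + w (Suc k)) \<le> t"
  obtain K where K: "\<And>n. cmod (w n) \<le> K" using w by (auto simp: Bseq_def)
  have "\<bar>Re (w k)\<bar> \<le> K" for k using abs_Re_le_cmod[of "w k"] K[of k] by linarith
  then show "0 \<le> t" by (rule bounded_increment_nonneg) (use w(2) in \<open>simp add: algebra_simps\<close>)
qed (auto intro: Bfun_const)

text \<open>The harder half of Lorentz's theorem. As no Banach limit of \<open>c * v\<close> reaches
  e / 4, the construction of Banach limits must fail at that level: some bounded corrector
  \<open>w\<close> keeps Re (c * v k - w k + w (k + 1)) at most e / 4. Over a window the corrector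
  telescopes to a boundary term bounded independently of position and length, which division by n +
  1 makes uniformly small.\<close>

lemma almost_convergent_if_seq_limits_eq_0:
  assumes u: "bounded (u ` {1..})" and L0: "\<And>L. banach_limit L \<Longrightarrow> seq_limit L u = 0"
  shows "almost_convergent_to u 0"
proof (rule almost_convergent_to_I[OF u])
  fix e :: real assume e: "e > 0"
  define v where "v = (\<lambda>n. u (Suc n))"
  have v: "Bseq v" using u Bseq_bounded_from_1[of u] unfolding v_def by simp
  have one_sided: "\<exists>K. \<forall>n k. k \<ge> 1 \<longrightarrow> Re (c * (\<Sum>i=k..k+n. u i)) \<le> real (n + 1) * (e / 4) + K" for c
  proof -
    have cv: "Bseq (\<lambda>n. c * v n)" by (intro Bseq_mult Bfun_const v)
    have "\<exists>w. Bseq w \<and> (\<forall>k. Re (c * v k - w k + w (Suc k)) \<le> e / 4)"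
    proof (rule ccontr)
      assume neg: "\<not> ?thesis"
      obtain L where L: "banach_limit L" "Re (L (\<lambda>n. c * v n)) \<ge> e / 4"
      proof (rule exists_banach_limit_ge[OF cv, of "e / 4"])
        fix w t assume "Bseq w" "\<And>k. Re (c * v k - w k + w (Suc k)) \<le> t"
        then show "e / 4 \<le> t" using neg by (meson linear order_trans)
      qed blast
      then show False
        using L0[OF L(1)] banach_limit_mult[OF L(1) v, of c] e by (simp add: seq_limit_def v_def)
    qed
    then obtain w where w: "Bseq w" "\<And>k. Re (c * v k - w k + w (Suc k)) \<le> e / 4" by blast
    obtain K where K: "\<And>n. cmod (w n) \<le> K" using w by (auto simp: Bseq_def)
    have Rew: "\<bar>Re (w k)\<bar> \<le> K" for k
      using abs_Re_le_cmod[of "w k"] K[of k] by linarith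
    have le: "Re (c * (\<Sum>i=Suc j..Suc j+n. u i)) \<le> real (n + 1) * (e / 4) + Re (w j) - Re (w (Suc (j + n)))" for n j
    proof (induction n)
      case 0
      then show ?case using w(2)[of j] by (simp add: v_def algebra_simps)
    next
      case (Suc n)
      have "c * (\<Sum>i=Suc j..Suc j+Suc n. u i) = c * (\<Sum>i=Suc j..Suc j+n. u i) + c * v (Suc (j + n))"
        by (simp add: v_def distrib_left)
      moreover have "real (Suc n + 1) * (e / 4) = real (n + 1) * (e / 4) + e / 4" by (simp add: algebra_simps)
      moreover have "Re (c * v (Suc (j + n))) \<le> e / 4 + Re (w (Suc (j + n))) - Re (w (Suc (j + Suc n)))"
        using w(2)[of "Suc (j + n)"] by (simp only: plus_complex.sel minus_complex.sel add_Suc_right)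
      ultimately show ?case using Suc by (simp only: plus_complex.sel)
    qed
    have "Re (c * (\<Sum>i=k..k+n. u i)) \<le> real (n + 1) * (e / 4) + 2 * K" if k: "k \<ge> 1" for n k
    proof -
      obtain j where j: "k = Suc j" using k by (cases k) auto
      show ?thesis using le[of j n] Rew[of j] Rew[of "Suc (j + n)"] unfolding j by linarith
    qed
    then show ?thesis by blast
  qed
  \<comment> \<open>The four rotations bound the real and the imaginary part from both sides. Each
    part is at most (n + 1) e / 4 plus a constant, which for large n is also at most (n + 1) e / 4;
    the two parts add up to (n + 1) e, whence the quarter.\<close>
  obtain K1 K2 K3 K4 where K:
      "\<And>n k. k \<ge> 1 \<Longrightarrow> Re (1 * (\<Sum>i=k..k+n. u i)) \<le> real (n + 1) * (e / 4) + K1"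
      "\<And>n k. k \<ge> 1 \<Longrightarrow> Re ((-1) * (\<Sum>i=k..k+n. u i)) \<le> real (n + 1) * (e / 4) + K2"
      "\<And>n k. k \<ge> 1 \<Longrightarrow> Re (\<i> * (\<Sum>i=k..k+n. u i)) \<le> real (n + 1) * (e / 4) + K3"
      "\<And>n k. k \<ge> 1 \<Longrightarrow> Re ((-\<i>) * (\<Sum>i=k..k+n. u i)) \<le> real (n + 1) * (e / 4) + K4"
    using one_sided by metis
  define K where "K = \<bar>K1\<bar> + \<bar>K2\<bar> + \<bar>K3\<bar> + \<bar>K4\<bar>"
  have "\<forall>\<^sub>F n in sequentially. 4 * K / e \<le> real n"
    using eventually_ge_at_top[of "nat \<lceil>4 * K / e\<rceil>"] by eventually_elim linarith
  then show "\<forall>\<^sub>F n in sequentially. \<forall>k\<ge>1. norm ((\<Sum>i=k..k+n. u i) / of_nat (n + 1) - 0) \<le> e"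
  proof eventually_elim
    case (elim n)
    show ?case
    proof (intro allI impI)
      fix k :: nat assume k: "k \<ge> 1"
      let ?S = "\<Sum>i=k..k+n. u i"
      have "\<bar>Re ?S\<bar> \<le> real (n + 1) * (e / 4) + K" "\<bar>Im ?S\<bar> \<le> real (n + 1) * (e / 4) + K"
        using K[OF k, of n] unfolding K_def by simp_all
      moreover have "K \<le> real (n + 1) * (e / 4)" using elim e by (simp add: field_simps)
      ultimately have "cmod ?S \<le> real (n + 1) * e" using cmod_le[of ?S] by (simp add: field_simps)
      then show "norm (?S / of_nat (n + 1) - 0) \<le> e"
        by (simp add: norm_divide field_simps del: of_nat_Suc of_nat_add)
    qed
  qed
qed

section \<open>Riesz representation on complex Hilbert spaces\<close>

lemma scaleC_one [simp]: "1 *\<^sub>C (x::'a::complex_hilbert) = x"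
  using scaleR_scaleC[of 1 x] by simp

lemma scaleC_zero_left [simp]: "0 *\<^sub>C (x::'a::complex_hilbert) = 0"
  using scaleR_scaleC[of 0 x] by simp

lemma cinner_add_right: "cinner x (y + z) = cinner x y + cinner (x::'a::complex_hilbert) z"
  by (metis cinner_add_left cinner_commute complex_cnj_add)

lemma cinner_scaleC_right: "cinner x (c *\<^sub>C y) = cnj c * cinner (x::'a::complex_hilbert) y"
  by (metis cinner_scaleC_left cinner_commute complex_cnj_mult)

lemma cinner_scaleR_left: "cinner (r *\<^sub>R x) y = of_real r * cinner (x::'a::complex_hilbert) y"
  by (simp add: scaleR_scaleC cinner_scaleC_left)

lemma cinner_scaleR_right: "cinner x (r *\<^sub>R y) = of_real r * cinner (x::'a::complex_hilbert) y"
  by (simp add: scaleR_scaleC cinner_scaleC_right)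

lemma cinner_zero_left [simp]: "cinner 0 (y::'a::complex_hilbert) = 0"
  using cinner_scaleR_left[of 0 0 y] by simp

lemma cinner_zero_right [simp]: "cinner (y::'a::complex_hilbert) 0 = 0"
  using cinner_scaleR_right[of y 0 0] by simp

lemma cinner_minus_left: "cinner (- x) y = - cinner (x::'a::complex_hilbert) y"
  using cinner_scaleR_left[of "-1" x y] by simp

lemma cinner_minus_right: "cinner x (- y) = - cinner (x::'a::complex_hilbert) y"
  using cinner_scaleR_right[of x "-1" y] by simp

lemma cinner_diff_left: "cinner (x - z) y = cinner (x::'a::complex_hilbert) y - cinner z y"
  using cinner_add_left[of x "- z" y] by (simp add: cinner_minus_left)

lemma cinner_eq_0D: "cinner x x = 0 \<Longrightarrow> (x::'a::complex_hilbert) = 0"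
  by (simp add: cinner_self)

text \<open>The class postulates homogeneity for real scalars; for complex ones it comes from the
  inner product that defines the norm.\<close>

lemma norm_scaleC: "norm (c *\<^sub>C x) = cmod c * norm (x::'a::complex_hilbert)"
proof -
  have "complex_of_real ((norm (c *\<^sub>C x))\<^sup>2) = c * cnj c * complex_of_real ((norm x)\<^sup>2)"
    by (simp only: cinner_self[symmetric] cinner_scaleC_left cinner_scaleC_right) simp
  also have "\<dots> = complex_of_real ((cmod c * norm x)\<^sup>2)"
    by (simp add: complex_norm_square[symmetric] power_mult_distrib)
  finally have "(norm (c *\<^sub>C x))\<^sup>2 = (cmod c * norm x)\<^sup>2" by (simp only: of_real_eq_iff)
  then show ?thesis by simp
qed

lemma Re_cinner_commute: "Re (cinner x y) = Re (cinner y (x::'a::complex_hilbert))"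
  by (subst cinner_commute) simp

lemma norm_add_square:
  "(norm (x + y))\<^sup>2 = (norm x)\<^sup>2 + 2 * Re (cinner x y) + (norm (y::'a::complex_hilbert))\<^sup>2"
proof -
  have "complex_of_real ((norm (x + y))\<^sup>2) = cinner x x + cinner x y + cinner y x + cinner y y"
    by (simp only: cinner_self[symmetric] cinner_add_left cinner_add_right) simp
  then have "Re (complex_of_real ((norm (x + y))\<^sup>2)) = Re (cinner x x + cinner x y + cinner y x + cinner y y)"
    by (rule arg_cong)
  then show ?thesis using Re_cinner_commute[of x y] by (simp add: cinner_self)
qed

lemma cinner_cauchy_schwarz: "cmod (cinner x y) \<le> norm x * norm (y::'a::complex_hilbert)"
proof (cases "y = 0")
  case False
  define a b where "a = (norm x)\<^sup>2" and "b = (norm y)\<^sup>2"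
  \<comment> \<open>With this coefficient x + c y is the component of \<open>x\<close> orthogonal to
    \<open>y\<close>, and the inequality says that its squared norm is nonnegative.\<close>
  define c where "c = - (cinner x y) / of_real b"
  have b: "b > 0" using False by (simp add: b_def)
  have "cnj c * cinner x y = - of_real ((cmod (cinner x y))\<^sup>2 / b)"
    unfolding c_def by (simp add: mult.commute[of "cnj _"] flip: complex_norm_square)
  then have "Re (cinner x (c *\<^sub>C y)) = - (cmod (cinner x y))\<^sup>2 / b"
    by (simp add: cinner_scaleC_right)
  moreover have "(norm (c *\<^sub>C y))\<^sup>2 = (cmod (cinner x y))\<^sup>2 / b"
    using b by (simp add: norm_scaleC c_def norm_divide power_mult_distrib power_divide b_def[symmetric] power2_eq_square[of b])
  ultimately have "(norm (x + c *\<^sub>C y))\<^sup>2 = a - (cmod (cinner x y))\<^sup>2 / b"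
    by (simp add: norm_add_square a_def)
  then have "(cmod (cinner x y))\<^sup>2 / b \<le> a" by (metis diff_ge_0_iff_ge zero_le_power2)
  then have "(cmod (cinner x y))\<^sup>2 \<le> (norm x * norm y)\<^sup>2"
    using b by (simp add: a_def b_def field_simps)
  then show ?thesis by (rule power2_le_imp_le) simp
qed simp

lemma bounded_bilinear_cinner: "bounded_bilinear (cinner :: 'a::complex_hilbert \<Rightarrow> 'a \<Rightarrow> complex)"
proof
  show "\<exists>K. \<forall>a b::'a. norm (cinner a b) \<le> norm a * norm b * K"
    by (rule exI[of _ 1]) (simp add: cinner_cauchy_schwarz)
qed (simp_all add: cinner_add_left cinner_add_right cinner_scaleR_left cinner_scaleR_right scaleR_conv_of_real)

lemma bounded_linear_scaleC: "bounded_linear (\<lambda>x::'a::complex_hilbert. c *\<^sub>C x)"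
proof
  show "\<exists>K. \<forall>x::'a. norm (c *\<^sub>C x) \<le> norm x * K"
    by (rule exI[of _ "cmod c"]) (simp add: norm_scaleC mult.commute)
qed (simp_all add: scaleC_add_right scaleR_scaleC scaleC_scaleC mult.commute)

lemma cinner_ext_left:
  fixes x x' :: "'a::complex_hilbert"
  assumes "\<And>y. cinner x y = cinner x' y"
  shows "x = x'"
  using cinner_eq_0D[of "x - x'"] assms[of "x - x'"] by (simp add: cinner_diff_left)

text \<open>Riesz representation, by minimising \<open>(norm x)\<^sup>2 - 2 f x\<close>.\<close>

lemma riesz_representation_Re:
  fixes f :: "'a::complex_hilbert \<Rightarrow> real"
  assumes "bounded_linear f"
  obtains z where "\<And>x. f x = Re (cinner z x)"
proof -
  interpret f: bounded_linear f by fact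
  obtain C where C: "\<And>x. \<bar>f x\<bar> \<le> norm x * C" using f.bounded by auto
  define J where "J x = (norm x)\<^sup>2 - 2 * f x" for x
  have lower: "- C\<^sup>2 \<le> J x" for x
  proof -
    have "0 \<le> (norm x - C)\<^sup>2" by simp
    then have "2 * (norm x * C) \<le> (norm x)\<^sup>2 + C\<^sup>2" by (simp add: power2_diff)
    then show ?thesis using C[of x] unfolding J_def by linarith
  qed
  define d where "d = Inf (range J)"
  have bdd: "bdd_below (range J)" using lower by (intro bdd_belowI2) auto
  have d_le: "d \<le> J x" for x unfolding d_def using bdd by (intro cInf_lower) auto
  \<comment> \<open>The parallelogram law, with \<open>d\<close> as lower bound at the midpoint:
    near-minimisers are close to each other, so a minimising sequence is Cauchy.\<close>
  have cvx: "(norm (u - v))\<^sup>2 \<le> 2 * (J u + J v - 2 * d)" for u v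
  proof -
    have "(norm (u + v))\<^sup>2 + (norm (u + - v))\<^sup>2 = 2 * (norm u)\<^sup>2 + 2 * (norm v)\<^sup>2"
      by (simp only: norm_add_square cinner_minus_right norm_minus_cancel) simp
    moreover have "(norm ((1/2) *\<^sub>R (u + v)))\<^sup>2 = (norm (u + v))\<^sup>2 / 4"
      by (simp add: power_divide)
    moreover have "f ((1/2) *\<^sub>R (u + v)) = (f u + f v) / 2" by (simp add: f.scaleR f.add)
    ultimately show ?thesis using d_le[of "(1/2) *\<^sub>R (u + v)"] unfolding J_def by simp
  qed
  have "\<exists>x. J x < d + 1 / real (Suc n)" for n
    using cInf_lessD[of "range J" "d + 1 / real (Suc n)"] unfolding d_def by force
  then obtain x where x: "\<And>n. J (x n) < d + 1 / real (Suc n)" by metis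
  have J_lim: "(\<lambda>n. J (x n)) \<longlonglongrightarrow> d"
  proof (rule real_tendsto_sandwich)
    show "\<forall>\<^sub>F n in sequentially. d \<le> J (x n)" using d_le by simp
    show "\<forall>\<^sub>F n in sequentially. J (x n) \<le> d + 1 / real (Suc n)"
      using x less_imp_le by (intro always_eventually allI) blast
    show "(\<lambda>n. d + 1 / real (Suc n)) \<longlonglongrightarrow> d"
      using tendsto_add[OF tendsto_const LIMSEQ_Suc[OF lim_1_over_n]] by fastforce
  qed simp
  have "Cauchy x"
  proof (rule CauchyI)
    fix e :: real assume e: "e > 0"
    have "\<forall>\<^sub>F n in sequentially. J (x n) < d + e\<^sup>2 / 4"
      using J_lim e by (intro order_tendstoD(2)) auto
    then obtain N where N: "\<And>n. n \<ge> N \<Longrightarrow> J (x n) < d + e\<^sup>2 / 4"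
      unfolding eventually_sequentially by blast
    have "norm (x m - x n) < e" if "m \<ge> N" "n \<ge> N" for m n
    proof -
      have "(norm (x m - x n))\<^sup>2 < e\<^sup>2"
        using cvx[of "x m" "x n"] N[OF that(1)] N[OF that(2)] by (simp add: algebra_simps)
      then show ?thesis using e by (intro power2_less_imp_less[of _ e]) auto
    qed
    then show "\<exists>M. \<forall>m\<ge>M. \<forall>n\<ge>M. norm (x m - x n) < e" by blast
  qed
  then obtain z where z: "x \<longlonglongrightarrow> z" using Cauchy_convergent convergent_def by blast
  have "(\<lambda>n. J (x n)) \<longlonglongrightarrow> J z"
    unfolding J_def by (intro tendsto_intros f.tendsto z)
  then have Jz: "J z = d" using J_lim LIMSEQ_unique by blast
  have "f y = Re (cinner z y)" for y
  proof (rule ccontr)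
    define g where "g = Re (cinner z y) - f y"
    assume "f y \<noteq> Re (cinner z y)"
    then have g: "g \<noteq> 0" by (simp add: g_def)
    then have y: "(norm y)\<^sup>2 > 0" unfolding g_def by (auto simp: f.zero)
    \<comment> \<open>Minimality along the line z + t y. A nonzero linear coefficient
      \<open>g\<close> would make the value at t = - g / (norm y)^2, the vertex of the parabola,
      negative.\<close>
    have quad: "0 \<le> t\<^sup>2 * (norm y)\<^sup>2 + 2 * t * g" for t
    proof -
      have "J (z + t *\<^sub>R y) = J z + t\<^sup>2 * (norm y)\<^sup>2 + 2 * t * g"
        unfolding J_def g_def norm_add_square
        by (simp add: cinner_scaleR_right f.add f.scaleR power_mult_distrib algebra_simps)
      then show ?thesis using d_le[of "z + t *\<^sub>R y"] Jz by simp
    qed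
    have "(- g / (norm y)\<^sup>2)\<^sup>2 * (norm y)\<^sup>2 + 2 * (- g / (norm y)\<^sup>2) * g = - g\<^sup>2 / (norm y)\<^sup>2"
      using y by (simp add: field_simps power2_eq_square)
    moreover have "g\<^sup>2 / (norm y)\<^sup>2 > 0" using g y by simp
    ultimately show False using quad[of "- g / (norm y)\<^sup>2"] by simp
  qed
  then show thesis using that by blast
qed

text \<open>Riesz representation is applied to the real part for each fixed \<open>x\<close>; the
  imaginary part is read off at \<open>\<i> *\<^sub>C y\<close>, and uniqueness of the representing
  vector makes it linear in \<open>x\<close>. Adjoints, separating elements of \<open>M\<close> and
  Banach limits of operators are all obtained from their forms in this way.\<close>

lemma sesquilinear_representation:
  fixes \<beta> :: "'a::complex_hilbert \<Rightarrow> 'a \<Rightarrow> complex"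
  assumes add_left: "\<And>x x' y. \<beta> (x + x') y = \<beta> x y + \<beta> x' y"
    and add_right: "\<And>x y y'. \<beta> x (y + y') = \<beta> x y + \<beta> x y'"
    and scale_left: "\<And>c x y. \<beta> (c *\<^sub>C x) y = c * \<beta> x y"
    and scale_right: "\<And>c x y. \<beta> x (c *\<^sub>C y) = cnj c * \<beta> x y"
    and bound: "\<And>x y. cmod (\<beta> x y) \<le> K * norm x * norm y"
  obtains A where "A \<in> bounded_ops" "\<And>x y. cinner (blinfun_apply A x) y = \<beta> x y"
proof -
  have "\<exists>z. \<forall>y. \<beta> x y = cinner z y" for x
  proof -
    have "bounded_linear (\<lambda>y. Re (\<beta> x y))"
    proof
      show "\<exists>K. \<forall>y. norm (Re (\<beta> x y)) \<le> norm y * K"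
        using bound[of x] abs_Re_le_cmod order_trans
        by (intro exI[of _ "K * norm x"]) (fastforce simp: mult.commute)
    qed (simp_all add: add_right scaleR_scaleC scale_right)
    then obtain z where z: "\<And>y. Re (\<beta> x y) = Re (cinner z y)" by (rule riesz_representation_Re) blast
    have "Im (\<beta> x y) = Im (cinner z y)" for y
      using z[of "\<i> *\<^sub>C y"] by (simp add: scale_right cinner_scaleC_right)
    then show ?thesis using z by (auto simp: complex_eq_iff)
  qed
  then obtain F where F: "\<And>x y. \<beta> x y = cinner (F x) y" by metis
  have add: "F (x + x') = F x + F x'" for x x'
    by (rule cinner_ext_left) (simp add: F[symmetric] cinner_add_left add_left)
  have scale: "F (c *\<^sub>C x) = c *\<^sub>C F x" for c x
    by (rule cinner_ext_left) (simp add: F[symmetric] cinner_scaleC_left scale_left)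
  have "norm (F x) \<le> norm x * K" for x
  proof (cases "F x = 0")
    case True
    have "0 \<le> K * norm x * norm x" using bound[of x x] norm_ge_zero order_trans by blast
    then have "0 \<le> norm x * K" by (cases "x = 0") (simp_all add: zero_le_mult_iff)
    then show ?thesis using True by simp
  next
    case False
    have "(norm (F x))\<^sup>2 = cmod (\<beta> x (F x))" unfolding F cinner_self norm_of_real by simp
    also have "\<dots> \<le> K * norm x * norm (F x)" by (rule bound)
    finally show ?thesis using False by (simp add: power2_eq_square mult.commute)
  qed
  then have bl: "bounded_linear F"
    by (intro bounded_linear_intro[where K = K]) (simp_all add: add scale scaleR_scaleC)
  show thesis
    by (rule that[of "Blinfun F"]) (simp_all add: bounded_ops_def bounded_linear_Blinfun_apply[OF bl] scale F)
qed

section \<open>Complex scalars and adjoints for bounded operators\<close>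

lemma blinfun_eqI_cinner:
  fixes A B :: "'h::complex_hilbert \<Rightarrow>\<^sub>L 'h"
  assumes "\<And>x y. cinner (blinfun_apply A x) y = cinner (blinfun_apply B x) y"
  shows "A = B"
  by (rule blinfun_eqI) (rule cinner_ext_left, rule assms)

lemma op_scale_apply [simp]:
  "blinfun_apply (c \<cdot>\<^sub>C A) x = c *\<^sub>C blinfun_apply A (x :: 'h::complex_hilbert)"
  unfolding op_scale_def
  by (subst bounded_linear_Blinfun_apply)
    (auto intro: bounded_linear_compose[OF bounded_linear_scaleC blinfun.bounded_linear_right])

lemma bounded_ops_scaleC: "A \<in> bounded_ops \<Longrightarrow> blinfun_apply A (c *\<^sub>C x) = c *\<^sub>C blinfun_apply A x"
  by (simp add: bounded_ops_def)

lemma norm_op_scale: "norm (c \<cdot>\<^sub>C A) \<le> cmod c * norm A"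
  for A :: "'h::complex_hilbert \<Rightarrow>\<^sub>L 'h"
proof (rule norm_blinfun_bound)
  fix x
  show "norm (blinfun_apply (c \<cdot>\<^sub>C A) x) \<le> cmod c * norm A * norm x"
    using mult_left_mono[OF norm_blinfun[of A x], of "cmod c"] by (simp add: norm_scaleC mult.assoc)
qed simp

lemma op_scale_simps:
  fixes A B :: "'h::complex_hilbert \<Rightarrow>\<^sub>L 'h"
  shows "1 \<cdot>\<^sub>C A = A" "0 \<cdot>\<^sub>C A = 0" "c \<cdot>\<^sub>C (A + B) = c \<cdot>\<^sub>C A + c \<cdot>\<^sub>C B" "c \<cdot>\<^sub>C d \<cdot>\<^sub>C A = (c * d) \<cdot>\<^sub>C A"
    "(- 1) \<cdot>\<^sub>C A = - A" "complex_of_real r \<cdot>\<^sub>C A = r *\<^sub>R A"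
proof -
  show "1 \<cdot>\<^sub>C A = A" "0 \<cdot>\<^sub>C A = 0" "c \<cdot>\<^sub>C d \<cdot>\<^sub>C A = (c * d) \<cdot>\<^sub>C A"
    by (rule blinfun_eqI; simp add: scaleC_scaleC)+
  show "c \<cdot>\<^sub>C (A + B) = c \<cdot>\<^sub>C A + c \<cdot>\<^sub>C B"
    by (rule blinfun_eqI) (simp add: blinfun.add_left scaleC_add_right)
  show r: "complex_of_real r \<cdot>\<^sub>C A = r *\<^sub>R A" for r
    by (rule blinfun_eqI) (simp add: blinfun.scaleR_left scaleR_scaleC)
  show "(- 1) \<cdot>\<^sub>C A = - A" using r[of "- 1"] by simp
qed

lemma adjoint_exists:
  fixes A :: "'h::complex_hilbert \<Rightarrow>\<^sub>L 'h"
  assumes A: "A \<in> bounded_ops"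
  obtains B where "B \<in> bounded_ops" "is_adjoint A B"
proof (rule sesquilinear_representation[where \<beta> = "\<lambda>x y. cinner x (blinfun_apply A y)" and K = "norm A"])
  fix x y :: 'h
  show "cmod (cinner x (blinfun_apply A y)) \<le> norm A * norm x * norm y"
    using order_trans[OF cinner_cauchy_schwarz mult_left_mono[OF norm_blinfun[of A y] norm_ge_zero[of x]]]
    by (simp add: mult_ac)
next
  fix B :: "'h \<Rightarrow>\<^sub>L 'h"
  assume B: "B \<in> bounded_ops" "\<And>x y. cinner (blinfun_apply B x) y = cinner x (blinfun_apply A y)"
  have "cinner (blinfun_apply A x) y = cinner x (blinfun_apply B y)" for x y
    by (metis B(2) cinner_commute)
  then show thesis using that B by (simp add: is_adjoint_def)
qed (simp_all add: cinner_add_left cinner_add_right blinfun.add_right cinner_scaleC_left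
    cinner_scaleC_right bounded_ops_scaleC[OF A])

section \<open>Ultraweakly continuous functionals\<close>

text \<open>Defined on all bounded real-linear operators rather than on \<open>M\<close>, so that
  the Hahn-Banach theorem works in one fixed vector space; restriction to \<open>M\<close> is
  expressed by estimates tested on \<open>M\<close>.\<close>

definition vec_functional :: "'h::complex_hilbert \<Rightarrow> 'h \<Rightarrow> ('h \<Rightarrow>\<^sub>L 'h) \<Rightarrow>\<^sub>L complex" where
  "vec_functional x y = Blinfun (\<lambda>A. cinner (blinfun_apply A x) y)"

lemma vec_functional_apply [simp]:
  "blinfun_apply (vec_functional x y) A = cinner (blinfun_apply A x) y"
  unfolding vec_functional_def
  by (subst bounded_linear_Blinfun_apply)
    (auto intro: bounded_linear_compose[OF bounded_bilinear.bounded_linear_left[OF bounded_bilinear_cinner] blinfun.bounded_linear_left])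

definition vec_sum :: "('h::complex_hilbert \<times> 'h) list \<Rightarrow> ('h \<Rightarrow>\<^sub>L 'h) \<Rightarrow>\<^sub>L complex" where
  "vec_sum zs = (\<Sum>z\<leftarrow>zs. vec_functional (fst z) (snd z))"

lemma vec_sum_Nil [simp]: "vec_sum [] = 0"
  and vec_sum_Cons [simp]: "vec_sum (z # zs) = vec_functional (fst z) (snd z) + vec_sum zs"
  and vec_sum_append [simp]: "vec_sum (zs @ ws) = vec_sum zs + vec_sum ws"
  by (simp_all add: vec_sum_def)

lemma vec_sum_scaleC_right:
  "blinfun_apply (vec_sum (map (\<lambda>z. (fst z, cnj c *\<^sub>C snd z)) zs)) A = c * blinfun_apply (vec_sum zs) A"
  by (induction zs) (simp_all add: blinfun.add_left cinner_scaleC_right distrib_left)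

definition clinear_on :: "('h::complex_hilbert \<Rightarrow>\<^sub>L 'h) set \<Rightarrow> (('h \<Rightarrow>\<^sub>L 'h) \<Rightarrow> complex) \<Rightarrow> bool" where
  "clinear_on V f \<longleftrightarrow> (\<forall>A\<in>V. \<forall>B\<in>V. f (A + B) = f A + f B) \<and> (\<forall>c. \<forall>A\<in>V. f (c \<cdot>\<^sub>C A) = c * f A)"

lemma clinear_onD:
  assumes "clinear_on V f" "A \<in> V"
  shows "B \<in> V \<Longrightarrow> f (A + B) = f A + f B" "f (c \<cdot>\<^sub>C A) = c * f A"
  using assms by (auto simp: clinear_on_def)

lemma clinear_on_subset: "clinear_on V f \<Longrightarrow> W \<subseteq> V \<Longrightarrow> clinear_on W f"
  unfolding clinear_on_def by blast

lemma clinear_on_combination: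
  assumes "clinear_on V f" "clinear_on V g" "\<And>A B. A \<in> V \<Longrightarrow> B \<in> V \<Longrightarrow> A + B \<in> V"
    "\<And>c A. A \<in> V \<Longrightarrow> c \<cdot>\<^sub>C A \<in> V"
  shows "clinear_on V (\<lambda>A. f A + c * g A)"
  unfolding clinear_on_def
  by (auto simp: clinear_onD[OF assms(1)] clinear_onD[OF assms(2)] assms(3,4) algebra_simps)

text \<open>Approximation in the norm of the dual of \<open>M\<close>: the error is tested on
  \<open>M\<close> only.\<close>

definition vec_approximable :: "('h::complex_hilbert \<Rightarrow>\<^sub>L 'h) set \<Rightarrow> (('h \<Rightarrow>\<^sub>L 'h) \<Rightarrow> complex) \<Rightarrow> bool" where
  "vec_approximable M f \<longleftrightarrow>
     (\<forall>e>0. \<exists>zs. \<forall>A\<in>M. cmod (f A - blinfun_apply (vec_sum zs) A) \<le> e * norm A)"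

lemma vec_approximable_vec_sum: "vec_approximable M (blinfun_apply (vec_sum zs))"
  unfolding vec_approximable_def by (intro allI impI exI[of _ zs]) simp

lemma vec_approximable_limit:
  assumes "\<And>e. e > 0 \<Longrightarrow> \<exists>g. vec_approximable M g \<and> (\<forall>A\<in>M. cmod (f A - g A) \<le> e * norm A)"
  shows "vec_approximable M f"
  unfolding vec_approximable_def
proof (intro allI impI)
  fix e :: real assume e: "e > 0"
  obtain g where g: "vec_approximable M g" "\<And>A. A \<in> M \<Longrightarrow> cmod (f A - g A) \<le> (e / 2) * norm A"
    using assms[of "e / 2"] e by auto
  obtain zs where zs: "\<And>A. A \<in> M \<Longrightarrow> cmod (g A - blinfun_apply (vec_sum zs) A) \<le> (e / 2) * norm A"
    using g(1) e unfolding vec_approximable_def by (meson half_gt_zero)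
  have "cmod (f A - blinfun_apply (vec_sum zs) A) \<le> e * norm A" if "A \<in> M" for A
    using norm_triangle_ineq[of "f A - g A" "g A - blinfun_apply (vec_sum zs) A"] g(2)[OF that] zs[OF that]
    by (simp add: field_simps)
  then show "\<exists>zs. \<forall>A\<in>M. cmod (f A - blinfun_apply (vec_sum zs) A) \<le> e * norm A" by blast
qed

lemma vec_approximable_combination:
  assumes f: "vec_approximable M f" and g: "vec_approximable M g"
  shows "vec_approximable M (\<lambda>A. f A + c * g A)"
  unfolding vec_approximable_def
proof (intro allI impI)
  fix e :: real assume e: "e > 0"
  define d where "d = e / (1 + cmod c)"
  have d: "d > 0" unfolding d_def using e by (intro divide_pos_pos add_pos_nonneg) auto
  have de: "d + cmod c * d = e"
    unfolding d_def using norm_ge_zero[of c] by (simp add: field_simps add_nonneg_eq_0_iff)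
  obtain zs ws where zs: "\<And>A. A \<in> M \<Longrightarrow> cmod (f A - blinfun_apply (vec_sum zs) A) \<le> d * norm A"
    and ws: "\<And>A. A \<in> M \<Longrightarrow> cmod (g A - blinfun_apply (vec_sum ws) A) \<le> d * norm A"
    using f g d unfolding vec_approximable_def by meson
  let ?us = "zs @ map (\<lambda>z. (fst z, cnj c *\<^sub>C snd z)) ws"
  have "cmod (f A + c * g A - blinfun_apply (vec_sum ?us) A) \<le> e * norm A" if "A \<in> M" for A
  proof -
    have "f A + c * g A - blinfun_apply (vec_sum ?us) A
        = (f A - blinfun_apply (vec_sum zs) A) + c * (g A - blinfun_apply (vec_sum ws) A)"
      by (simp add: blinfun.add_left vec_sum_scaleC_right algebra_simps)
    then have "cmod (f A + c * g A - blinfun_apply (vec_sum ?us) A)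
        \<le> cmod (f A - blinfun_apply (vec_sum zs) A) + cmod c * cmod (g A - blinfun_apply (vec_sum ws) A)"
      by (metis norm_triangle_ineq norm_mult)
    also have "\<dots> \<le> d * norm A + cmod c * (d * norm A)"
      by (intro add_mono mult_left_mono zs ws that) simp
    also have "\<dots> = e * norm A" unfolding de[symmetric] by (simp add: algebra_simps)
    finally show ?thesis .
  qed
  then show "\<exists>zs. \<forall>A\<in>M. cmod (f A + c * g A - blinfun_apply (vec_sum zs) A) \<le> e * norm A" by blast
qed

lemma vec_approximable_bounded:
  assumes "vec_approximable M f"
  obtains C where "C > 0" "\<And>A. A \<in> M \<Longrightarrow> cmod (f A) \<le> C * norm A"
proof -
  obtain zs where zs: "\<And>A. A \<in> M \<Longrightarrow> cmod (f A - blinfun_apply (vec_sum zs) A) \<le> 1 * norm A"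
    using assms unfolding vec_approximable_def by (meson zero_less_one)
  have "cmod (f A) \<le> (1 + norm (vec_sum zs)) * norm A" if "A \<in> M" for A
    using norm_triangle_sub[of "f A" "blinfun_apply (vec_sum zs) A"] zs[OF that]
      norm_blinfun[of "vec_sum zs" A] by (simp add: algebra_simps)
  then show thesis using that[of "1 + norm (vec_sum zs)"] by (simp add: add_pos_nonneg)
qed

text \<open>A functional vanishing on the common kernel of finitely many others is a combination of
  them. In the induction the claim holds on the kernel of \<open>f\<close>, and one multiple of
  \<open>f\<close> repairs the value at a vector outside; \<open>V\<close> varies because the
  induction passes to that kernel. Keeping \<open>P\<close> abstract lets the combination inherit
  linearity and approximability together.\<close>

lemma clinear_kernel_combination:
  fixes P :: "(('h::complex_hilbert \<Rightarrow>\<^sub>L 'h) \<Rightarrow> complex) \<Rightarrow> bool"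
  assumes fin: "finite G"
    and P0: "P (\<lambda>A. 0)" and Pcomb: "\<And>f g c. P f \<Longrightarrow> P g \<Longrightarrow> P (\<lambda>A. f A + c * g A)"
    and Plin: "\<And>f. P f \<Longrightarrow> clinear_on M f"
  shows "\<lbrakk>\<And>f. f \<in> G \<Longrightarrow> P f; V \<subseteq> M; clinear_on V l;
      \<And>A B. A \<in> V \<Longrightarrow> B \<in> V \<Longrightarrow> A + B \<in> V; \<And>c A. A \<in> V \<Longrightarrow> c \<cdot>\<^sub>C A \<in> V;
      \<And>A. A \<in> V \<Longrightarrow> \<forall>f\<in>G. f A = 0 \<Longrightarrow> l A = 0\<rbrakk>
    \<Longrightarrow> \<exists>g. P g \<and> (\<forall>A\<in>V. l A = g A)"
  using fin
proof (induction G arbitrary: V)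
  case empty
  then show ?case using P0 by auto
next
  case (insert f G)
  have Pf: "P f" using insert.prems by simp
  have lin_V: "clinear_on V h" if "P h" for h
    using Plin[OF that] insert.prems(2) clinear_on_subset by blast
  note f = clinear_onD[OF lin_V[OF Pf]]
  let ?V = "{A \<in> V. f A = 0}"
  have "\<exists>g. P g \<and> (\<forall>A\<in>?V. l A = g A)"
  proof (rule insert.IH)
    show "clinear_on ?V l" using insert.prems(3) by (rule clinear_on_subset) auto
    show "A + B \<in> ?V" if "A \<in> ?V" "B \<in> ?V" for A B using that insert.prems(4) f(1) by auto
    show "c \<cdot>\<^sub>C A \<in> ?V" if "A \<in> ?V" for c A using that insert.prems(5) f(2) by auto
    show "l A = 0" if "A \<in> ?V" "\<forall>f\<in>G. f A = 0" for A using that insert.prems(6)[of A] by auto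
  qed (use insert.prems in auto)
  then obtain g where g: "P g" "\<And>A. A \<in> V \<Longrightarrow> f A = 0 \<Longrightarrow> l A = g A" by auto
  show ?case
  proof (cases "\<exists>v\<in>V. f v \<noteq> 0")
    case False
    then show ?thesis using g by blast
  next
    case True
    then obtain v where v: "v \<in> V" "f v \<noteq> 0" by blast
    define a where "a = (l v - g v) / f v"
    have "l A = g A + a * f A" if A: "A \<in> V" for A
    proof -
      define c where "c = - (f A / f v)"
      have cv: "c \<cdot>\<^sub>C v \<in> V" using insert.prems(5) v(1) by blast
      have mem: "A + c \<cdot>\<^sub>C v \<in> V" using insert.prems(4)[OF A cv] .
      have "f (A + c \<cdot>\<^sub>C v) = 0" using f(1)[OF A cv] f(2)[OF v(1)] v(2) by (simp add: c_def)
      from g(2)[OF mem this] have "l A + c * l v = g A + c * g v"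
        using clinear_onD[OF insert.prems(3)] clinear_onD[OF lin_V[OF g(1)]] A cv v(1) by simp
      then show ?thesis using v(2) unfolding c_def a_def by (simp add: field_simps)
    qed
    then show ?thesis using Pcomb[OF g(1) Pf] by blast
  qed
qed

lemma summable_square_pairing:
  fixes x y :: "nat \<Rightarrow> 'h::complex_hilbert"
  assumes "summable (\<lambda>n. (norm (x n))\<^sup>2)" "summable (\<lambda>n. (norm (y n))\<^sup>2)"
  shows "summable (\<lambda>n. norm (x n) * norm (y n))"
proof (rule summable_comparison_test')
  show "summable (\<lambda>n. (norm (x n))\<^sup>2 + (norm (y n))\<^sup>2)" using assms by (rule summable_add)
  fix n
  have "2 * (norm (x n) * norm (y n)) \<le> (norm (x n))\<^sup>2 + (norm (y n))\<^sup>2"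
    using sum_squares_bound[of "norm (x n)" "norm (y n)"] by simp
  moreover have "0 \<le> norm (x n) * norm (y n)" by simp
  ultimately show "norm (norm (x n) * norm (y n)) \<le> (norm (x n))\<^sup>2 + (norm (y n))\<^sup>2"
    by (simp add: abs_of_nonneg del: mult_nonneg_nonneg)
qed

lemma cmod_cinner_apply: "cmod (cinner (blinfun_apply A x) y) \<le> norm A * (norm x * norm y)"
  for A :: "'h::complex_hilbert \<Rightarrow>\<^sub>L 'h"
  using order_trans[OF cinner_cauchy_schwarz mult_right_mono[OF norm_blinfun[of A x] norm_ge_zero[of y]]]
  by (simp add: mult.assoc)

definition nuclear :: "(nat \<Rightarrow> 'h::complex_hilbert) \<Rightarrow> (nat \<Rightarrow> 'h) \<Rightarrow> ('h \<Rightarrow>\<^sub>L 'h) \<Rightarrow> complex" where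
  "nuclear x y A = (\<Sum>n. cinner (blinfun_apply A (x n)) (y n))"

context
  fixes x y :: "nat \<Rightarrow> 'h::complex_hilbert"
  assumes xy: "summable (\<lambda>n. (norm (x n))\<^sup>2)" "summable (\<lambda>n. (norm (y n))\<^sup>2)"
begin

lemma nuclear_summable:
  "summable (\<lambda>n. norm (cinner (blinfun_apply A (x n)) (y n)))"
  by (rule summable_comparison_test'[OF summable_mult[OF summable_square_pairing[OF xy], of "norm A"]])
    (simp add: cmod_cinner_apply)

lemma nuclear_clinear: "clinear_on bounded_ops (nuclear x y)"
proof -
  have s: "summable (\<lambda>n. cinner (blinfun_apply A (x n)) (y n))" for A
    by (rule summable_norm_cancel[OF nuclear_summable])
  show ?thesis
    unfolding clinear_on_def nuclear_def
    by (simp add: blinfun.add_left cinner_add_left suminf_add[OF s s] cinner_scaleC_left suminf_mult[OF s])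
qed

text \<open>Partial sums approximate: on \<open>A\<close> the tail is at most \<open>norm A\<close>
  times a tail of the summable series of \<open>norm (x n) * norm (y n)\<close>.\<close>

lemma nuclear_vec_approximable: "vec_approximable M (nuclear x y)"
  unfolding vec_approximable_def
proof (intro allI impI)
  fix e :: real assume e: "e > 0"
  note sp = summable_square_pairing[OF xy]
  obtain N where N: "norm (\<Sum>i. norm (x (i + N)) * norm (y (i + N))) < e"
    using suminf_exist_split[OF e sp] by blast
  have vs: "blinfun_apply (vec_sum (map (\<lambda>n. (x n, y n)) [0..<n])) A = (\<Sum>i<n. cinner (blinfun_apply A (x i)) (y i))" for n A
    by (induction n) (simp_all add: blinfun.add_left)
  have "cmod (nuclear x y A - blinfun_apply (vec_sum (map (\<lambda>n. (x n, y n)) [0..<N])) A) \<le> e * norm A" for A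
  proof -
    have s: "summable (\<lambda>n. cinner (blinfun_apply A (x n)) (y n))"
      by (rule summable_norm_cancel[OF nuclear_summable])
    have "nuclear x y A - blinfun_apply (vec_sum (map (\<lambda>n. (x n, y n)) [0..<N])) A
        = (\<Sum>i. cinner (blinfun_apply A (x (i + N))) (y (i + N)))"
      unfolding nuclear_def vs using suminf_minus_initial_segment[OF s, of N] by simp
    also have "cmod \<dots> \<le> (\<Sum>i. cmod (cinner (blinfun_apply A (x (i + N))) (y (i + N))))"
      by (rule summable_norm) (rule summable_ignore_initial_segment[OF nuclear_summable])
    also have "\<dots> \<le> (\<Sum>i. norm A * (norm (x (i + N)) * norm (y (i + N))))"
      by (intro suminf_le cmod_cinner_apply summable_ignore_initial_segment[OF nuclear_summable]
          summable_mult summable_ignore_initial_segment[OF sp])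
    also have "\<dots> = norm A * (\<Sum>i. norm (x (i + N)) * norm (y (i + N)))"
      by (rule suminf_mult[OF summable_ignore_initial_segment[OF sp]])
    also have "\<dots> \<le> norm A * e" using N by (intro mult_left_mono) auto
    finally show ?thesis by (simp add: mult.commute)
  qed
  then show "\<exists>zs. \<forall>A\<in>M. cmod (nuclear x y A - blinfun_apply (vec_sum zs) A) \<le> e * norm A" by blast
qed

end

text \<open>Zero vectors and U = UNIV exhibit \<open>bounded_ops\<close> as a generator of the
  topology, so the elements of \<open>M\<close> lie in the topspace.\<close>

lemma openin_bounded_ops: "openin ultraweak_topology (bounded_ops :: ('h::complex_hilbert \<Rightarrow>\<^sub>L 'h) set)"
  unfolding ultraweak_topology_def
proof (rule topology_generated_by_Basis, rule CollectI, intro exI conjI)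
  show "bounded_ops = {A \<in> bounded_ops. (\<Sum>n. cinner (blinfun_apply A ((\<lambda>n. 0) n)) ((\<lambda>n. 0) n)) \<in> UNIV}" by simp
qed simp_all

text \<open>Induction on the generation of the topology: an intersection merges the two finite sets
  of functionals and takes the smaller radius, a union keeps the data of one member.\<close>

lemma ultraweak_open_nhd:
  assumes "openin ultraweak_topology T" "A \<in> (T :: ('h::complex_hilbert \<Rightarrow>\<^sub>L 'h) set)"
  shows "\<exists>G d. finite G \<and> d > 0 \<and>
    (\<forall>f\<in>G. \<exists>x y. f = nuclear x y \<and> summable (\<lambda>n. (norm (x n :: 'h))\<^sup>2) \<and> summable (\<lambda>n. (norm (y n :: 'h))\<^sup>2)) \<and>
    (\<forall>B\<in>bounded_ops. (\<forall>f\<in>G. cmod (f B - f A) < d) \<longrightarrow> B \<in> T)"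
proof -
  let ?nuc = "\<lambda>f. \<exists>x y. f = nuclear x y \<and> summable (\<lambda>n. (norm (x n :: 'h))\<^sup>2) \<and> summable (\<lambda>n. (norm (y n :: 'h))\<^sup>2)"
  let ?Q = "\<lambda>T G d. finite G \<and> d > 0 \<and> (\<forall>f\<in>G. ?nuc f) \<and>
      (\<forall>B\<in>bounded_ops. (\<forall>f\<in>G. cmod (f B - f A) < d) \<longrightarrow> B \<in> T)"
  have "generate_topology_on
     {{A \<in> bounded_ops. (\<Sum>n. cinner (blinfun_apply A (x n)) (y n)) \<in> U} | x y U.
        summable (\<lambda>n. (norm (x n :: 'h))\<^sup>2) \<and> summable (\<lambda>n. (norm (y n :: 'h))\<^sup>2) \<and> open U} T"
    using assms(1) unfolding ultraweak_topology_def by (rule openin_topology_generated_by)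
  then have "A \<in> T \<Longrightarrow> \<exists>G d. ?Q T G d"
  proof (induction rule: generate_topology_on.induct)
    case Empty
    then show ?case by simp
  next
    case (Int a b)
    then obtain G d G' d' where 1: "?Q a G d" and 2: "?Q b G' d'" by blast
    have "?Q (a \<inter> b) (G \<union> G') (min d d')" using 1 2 by auto
    then show ?case by blast
  next
    case (UN K)
    then obtain k where k: "k \<in> K" "A \<in> k" by blast
    obtain G d where "?Q k G d" using UN.IH[OF k] by blast
    then have "?Q (\<Union>K) G d" using k by blast
    then show ?case by blast
  next
    case (Basis s)
    then obtain x y U where s: "s = {A \<in> bounded_ops. nuclear x y A \<in> U}"
      and sum: "summable (\<lambda>n. (norm (x n :: 'h))\<^sup>2)" "summable (\<lambda>n. (norm (y n :: 'h))\<^sup>2)" and U: "open U"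
      unfolding nuclear_def by blast
    have "nuclear x y A \<in> U" using Basis s by blast
    then obtain d where d: "d > 0" "\<And>z. dist z (nuclear x y A) < d \<Longrightarrow> z \<in> U"
      using U unfolding open_dist by blast
    have "?Q s {nuclear x y} d" using sum d s by (auto simp: dist_norm)
    then show ?case by blast
  qed
  then show ?thesis using assms(2) by blast
qed

section \<open>Ultraweakly continuous functionals on a von Neumann algebra\<close>

locale von_neumann =
  fixes M :: "('h::complex_hilbert \<Rightarrow>\<^sub>L 'h) set"
  assumes vN: "von_neumann_algebra M"
begin

lemma star: "star_subalgebra M"
  using vN by (simp add: von_neumann_algebra_def)

lemma M_bounded_ops: "A \<in> M \<Longrightarrow> A \<in> bounded_ops"
  and M_id: "id_blinfun \<in> M"
  and M_add: "A \<in> M \<Longrightarrow> B \<in> M \<Longrightarrow> A + B \<in> M"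
  and M_comp: "A \<in> M \<Longrightarrow> B \<in> M \<Longrightarrow> A o\<^sub>L B \<in> M"
  and M_scale: "A \<in> M \<Longrightarrow> c \<cdot>\<^sub>C A \<in> M"
  and M_adjoint: "A \<in> M \<Longrightarrow> \<exists>B\<in>M. is_adjoint A B"
  using star unfolding star_subalgebra_def by blast+

lemma M_zero: "0 \<in> M"
  using M_scale[OF M_id, of 0] by (simp add: op_scale_simps)

lemma M_minus: "A \<in> M \<Longrightarrow> - A \<in> M"
  using M_scale[of A "- 1"] by (simp add: op_scale_simps)

lemma M_diff: "A \<in> M \<Longrightarrow> B \<in> M \<Longrightarrow> A - B \<in> M"
  using M_add[of A "- B"] M_minus[of B] by simp

text \<open>Membership in the double commutant, tested on the form of \<open>A\<close> alone by
  moving \<open>C\<close> to the other side as its adjoint. This suits operators known only through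
  a form, such as those coming from separation or from a Banach limit.\<close>

lemma M_memI:
  assumes A: "A \<in> bounded_ops"
    and comm: "\<And>C D x y. C \<in> commutant M \<Longrightarrow> is_adjoint C D \<Longrightarrow>
      cinner (blinfun_apply A (blinfun_apply C x)) y = cinner (blinfun_apply A x) (blinfun_apply D y)"
  shows "A \<in> M"
proof -
  have "C o\<^sub>L A = A o\<^sub>L C" if C: "C \<in> commutant M" for C
  proof (rule blinfun_eqI_cinner)
    fix x y
    obtain D where D: "is_adjoint C D"
      using C adjoint_exists[of C] by (auto simp: commutant_def)
    then show "cinner (blinfun_apply (C o\<^sub>L A) x) y = cinner (blinfun_apply (A o\<^sub>L C) x) y"
      using comm[OF C D] by (simp add: is_adjoint_def)
  qed
  then have "A \<in> commutant (commutant M)" using A by (simp add: commutant_def)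
  then show ?thesis using vN by (simp add: von_neumann_algebra_def)
qed

lemma predual_clinear: "l \<in> predual M \<Longrightarrow> clinear_on M l"
  by (simp add: predual_def clinear_on_def)

text \<open>Continuity at 0 bounds \<open>l\<close> by 1 on a neighbourhood cut out by finitely many
  nuclear functionals. Their common kernel is closed under scaling, so \<open>l\<close> vanishes on
  it and is a combination of these functionals, each of which is a norm limit of vector
  sums.\<close>

lemma predual_vec_approximable:
  assumes l: "l \<in> predual M"
  shows "vec_approximable M l"
proof -
  have lin: "clinear_on M l" using l by (rule predual_clinear)
  have l0: "l 0 = 0" using clinear_onD(2)[OF lin M_zero, of 0] by (simp add: op_scale_simps)
  have "openin (subtopology ultraweak_topology M) {A \<in> topspace (subtopology ultraweak_topology M). l A \<in> ball 0 1}"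
    using l by (intro openin_continuous_map_preimage[where Y = euclidean]) (auto simp: predual_def)
  then obtain T where T: "openin ultraweak_topology T"
    "{A \<in> topspace (subtopology ultraweak_topology M). l A \<in> ball 0 1} = T \<inter> M"
    unfolding openin_subtopology by blast
  have top: "bounded_ops \<subseteq> topspace (ultraweak_topology :: ('h \<Rightarrow>\<^sub>L 'h) topology)"
    using openin_bounded_ops by (rule openin_subset)
  then have "0 \<in> {A \<in> topspace (subtopology ultraweak_topology M). l A \<in> ball 0 1}"
    using M_zero M_bounded_ops[OF M_zero] l0 by auto
  then have 0: "0 \<in> T" using T by blast
  obtain G d where G: "finite G" "d > 0"
    and nuc: "\<forall>f\<in>G. \<exists>x y. f = nuclear x y \<and> summable (\<lambda>n. (norm (x n))\<^sup>2) \<and> summable (\<lambda>n. (norm (y n))\<^sup>2)"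
    and nhd: "\<forall>B\<in>bounded_ops. (\<forall>f\<in>G. cmod (f B - f 0) < d) \<longrightarrow> B \<in> T"
    using ultraweak_open_nhd[OF T(1) 0] by (elim exE conjE) (rule that)
  have "\<exists>g. (clinear_on M g \<and> vec_approximable M g) \<and> (\<forall>A\<in>M. l A = g A)"
  proof (rule clinear_kernel_combination[OF G(1), where M = M and P = "\<lambda>g. clinear_on M g \<and> vec_approximable M g"])
    show "clinear_on M (\<lambda>A. 0) \<and> vec_approximable M (\<lambda>A. 0)"
    proof -
      have "(\<lambda>A. 0) = blinfun_apply (vec_sum ([] :: ('h \<times> 'h) list))" by (simp add: fun_eq_iff)
      then show ?thesis using vec_approximable_vec_sum[of M "[]"] by (simp add: clinear_on_def)
    qed
    show "clinear_on M f \<and> vec_approximable M f" if f: "f \<in> G" for f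
    proof -
      obtain x y where f: "f = nuclear x y" and xy: "summable (\<lambda>n. (norm (x n))\<^sup>2)" "summable (\<lambda>n. (norm (y n))\<^sup>2)"
        using bspec[OF nuc f] by blast
      have "M \<subseteq> bounded_ops" using M_bounded_ops by blast
      with nuclear_clinear[OF xy] have "clinear_on M f" unfolding f by (rule clinear_on_subset)
      then show ?thesis using nuclear_vec_approximable[OF xy] unfolding f by blast
    qed
    show "clinear_on M (\<lambda>A. f A + c * g A) \<and> vec_approximable M (\<lambda>A. f A + c * g A)"
      if "clinear_on M f \<and> vec_approximable M f" "clinear_on M g \<and> vec_approximable M g" for f g c
      by (intro conjI clinear_on_combination[OF conjunct1[OF that(1)] conjunct1[OF that(2)]] M_add M_scale
          vec_approximable_combination[OF conjunct2[OF that(1)] conjunct2[OF that(2)]])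
    show "l A = 0" if A: "A \<in> M" and f0: "\<forall>f\<in>G. f A = 0" for A
    proof (rule ccontr)
      assume n: "l A \<noteq> 0"
      \<comment> \<open>Scaling to the value 1 keeps the kernel element inside \<open>T\<close>,
        where \<open>l\<close> has modulus below 1 on \<open>M\<close>.\<close>
      define c where "c = 1 / l A"
      have cA: "c \<cdot>\<^sub>C A \<in> M" using A by (rule M_scale)
      have f_0: "f (c \<cdot>\<^sub>C A) = 0 \<and> f 0 = 0" if f: "f \<in> G" for f
      proof -
        have flin: "clinear_on bounded_ops f" using bspec[OF nuc f] nuclear_clinear by (elim exE conjE) simp
        show ?thesis
          using clinear_onD(2)[OF flin M_bounded_ops[OF A], of c] clinear_onD(2)[OF flin M_bounded_ops[OF A], of 0] f0 f
          by (simp add: op_scale_simps)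
      qed
      have "cmod (f (c \<cdot>\<^sub>C A) - f 0) < d" if "f \<in> G" for f using f_0[OF that] G(2) by simp
      then have "c \<cdot>\<^sub>C A \<in> T" using nhd M_bounded_ops[OF cA] by simp
      then have "l (c \<cdot>\<^sub>C A) \<in> ball 0 1" using T(2) cA by blast
      moreover have "l (c \<cdot>\<^sub>C A) = 1" using clinear_onD(2)[OF lin A, of c] n by (simp add: c_def)
      ultimately show False by simp
    qed
  qed (simp_all add: lin M_add M_scale)
  then obtain g where g: "vec_approximable M g" "\<forall>A\<in>M. l A = g A" by blast
  show ?thesis
  proof (rule vec_approximable_limit)
    fix e :: real assume "e > 0"
    then have "\<forall>A\<in>M. cmod (l A - g A) \<le> e * norm A" using g(2) by simp
    then show "\<exists>g. vec_approximable M g \<and> (\<forall>A\<in>M. cmod (l A - g A) \<le> e * norm A)" using g(1) by blast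
  qed
qed

lemma nuclear_in_predual:
  assumes ext: "l \<in> extensional M" and lin: "clinear_on M l"
    and xy: "summable (\<lambda>n. (norm (x n))\<^sup>2)" "summable (\<lambda>n. (norm (y n))\<^sup>2)"
    and eq: "\<And>A. A \<in> M \<Longrightarrow> l A = nuclear x y A"
  shows "l \<in> predual M"
proof -
  have "continuous_map (subtopology ultraweak_topology M) euclidean l"
    unfolding continuous_map_def
  proof (intro conjI allI impI)
    fix U :: "complex set" assume "openin euclidean U"
    then have U: "open U" by simp
    have "openin ultraweak_topology {A \<in> bounded_ops. nuclear x y A \<in> U}"
      unfolding ultraweak_topology_def nuclear_def
      by (rule topology_generated_by_Basis) (use xy U in blast)
    then have op: "openin (subtopology ultraweak_topology M) ({A \<in> bounded_ops. nuclear x y A \<in> U} \<inter> M)"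
      unfolding openin_subtopology by blast
    then have "{A \<in> bounded_ops. nuclear x y A \<in> U} \<inter> M \<subseteq> topspace (subtopology ultraweak_topology M)"
      by (rule openin_subset)
    then have "{A \<in> topspace (subtopology ultraweak_topology M). l A \<in> U} = {A \<in> bounded_ops. nuclear x y A \<in> U} \<inter> M"
      using M_bounded_ops eq by auto
    then show "openin (subtopology ultraweak_topology M) {A \<in> topspace (subtopology ultraweak_topology M). l A \<in> U}"
      using op by simp
  qed simp
  then show ?thesis using ext lin by (simp add: predual_def clinear_on_def)
qed

end

section \<open>The predual is norm closed\<close>

text \<open>By the inequality of arithmetic and geometric means this bounds the norm of
  \<open>vec_sum zs\<close>. Unlike the sum of the products of the norms, it controls the two
  families of vectors separately, as square summability demands.\<close>

definition vec_weight :: "('h::complex_hilbert \<times> 'h) list \<Rightarrow> real" where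
  "vec_weight zs = (\<Sum>z\<leftarrow>zs. ((norm (fst z))\<^sup>2 + (norm (snd z))\<^sup>2) / 2)"

lemma vec_weight_simps [simp]:
  "vec_weight [] = 0"
  "vec_weight (z # zs) = ((norm (fst z))\<^sup>2 + (norm (snd z))\<^sup>2) / 2 + vec_weight zs"
  "vec_weight (zs @ ws) = vec_weight zs + vec_weight ws"
  by (simp_all add: vec_weight_def)

lemma vec_weight_nonneg: "vec_weight zs \<ge> 0"
  by (induction zs) auto

text \<open>The square root gives each of the two vectors half of the factor, so that the weight,
  quadratic in the vectors, scales exactly as the functional does.\<close>

lemma vec_sum_sqrt_scale:
  assumes "c \<ge> 0"
  shows "vec_sum (map (\<lambda>z. (sqrt c *\<^sub>R fst z, sqrt c *\<^sub>R snd z)) zs) = c *\<^sub>R vec_sum zs"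
proof -
  have "vec_functional (sqrt c *\<^sub>R x) (sqrt c *\<^sub>R y) = c *\<^sub>R vec_functional x y" for x y :: 'a
  proof (rule blinfun_eqI)
    fix A
    have "complex_of_real (sqrt c) * complex_of_real (sqrt c) = complex_of_real c"
      using assms by (simp flip: of_real_mult)
    then show "blinfun_apply (vec_functional (sqrt c *\<^sub>R x) (sqrt c *\<^sub>R y)) A = blinfun_apply (c *\<^sub>R vec_functional x y) A"
      by (simp add: blinfun.scaleR_left blinfun.scaleR_right cinner_scaleR_left cinner_scaleR_right
          mult.assoc[symmetric] scaleR_conv_of_real)
  qed
  then show ?thesis by (induction zs) (simp_all add: scaleR_add_right)
qed

lemma vec_weight_sqrt_scale:
  "c \<ge> 0 \<Longrightarrow> vec_weight (map (\<lambda>z. (sqrt c *\<^sub>R fst z, sqrt c *\<^sub>R snd z)) zs) = c * vec_weight zs"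
  by (induction zs) (simp_all add: power_mult_distrib field_simps)

lemma vec_functional_linear:
  fixes x x' y y' :: "'h::complex_hilbert"
  shows "vec_functional (x + x') y = vec_functional x y + vec_functional x' y"
    "vec_functional x (y + y') = vec_functional x y + vec_functional x y'"
    "vec_functional (r *\<^sub>R x) y = r *\<^sub>R vec_functional x y"
  by (rule blinfun_eqI; simp add: blinfun.add_left blinfun.add_right blinfun.scaleR_left blinfun.scaleR_right
      cinner_add_left cinner_add_right cinner_scaleR_left scaleR_conv_of_real)+

context von_neumann
begin

text \<open>A bounded functional on the span of the vector functionals that annihilates those vanishing on
  \<open>M\<close> is evaluation at an element of \<open>M\<close>: the commutation with the commutant is tested by
  functionals vanishing on \<open>M\<close>, and the double commutant theorem is the definition of \<open>M\<close>.\<close>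

lemma functional_on_vec_sums:
  fixes \<phi> :: "(('h \<Rightarrow>\<^sub>L 'h) \<Rightarrow>\<^sub>L complex) \<Rightarrow> real"
  assumes lin: "linear \<phi>" and K: "K \<ge> 0"
    and le: "\<And>f c. c \<ge> 0 \<Longrightarrow> (\<And>A. A \<in> M \<Longrightarrow> cmod (blinfun_apply f A) \<le> c * norm A) \<Longrightarrow> \<phi> f \<le> K * c"
  obtains B where "B \<in> M" "\<And>zs. \<phi> (vec_sum zs) = Re (blinfun_apply (vec_sum zs) B)"
proof -
  interpret \<phi>: linear \<phi> by (rule lin)
  have abs_le: "\<bar>\<phi> f\<bar> \<le> K * c" if "c \<ge> 0" "\<And>A. A \<in> M \<Longrightarrow> cmod (blinfun_apply f A) \<le> c * norm A" for f c
    using le[of c f] le[of c "- f"] that by (simp add: \<phi>.neg blinfun.minus_left abs_le_iff)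
  \<comment> \<open>The case c = 0 of the bound: \<phi> sees only the values of a functional on
    \<open>M\<close>.\<close>
  have eq: "\<phi> f = \<phi> g" if "\<And>A. A \<in> M \<Longrightarrow> blinfun_apply f A = blinfun_apply g A" for f g
    using abs_le[of 0 "f - g"] that by (simp add: \<phi>.diff blinfun.diff_left)
  have bound: "\<bar>\<phi> (vec_functional x y)\<bar> \<le> K * (norm x * norm y)" for x y
    by (rule abs_le) (use cmod_cinner_apply in \<open>simp_all add: mult.commute\<close>)
  \<comment> \<open>The complex form whose real part is \<phi> at the vector functional;
    \<open>scale\<close> and \<open>swap\<close> make it sesquilinear.\<close>
  define \<beta> where "\<beta> x y = Complex (\<phi> (vec_functional x y)) (- \<phi> (vec_functional (\<i> *\<^sub>C x) y))" for x y
  have scale: "\<phi> (vec_functional (c *\<^sub>C x) y)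
      = Re c * \<phi> (vec_functional x y) + Im c * \<phi> (vec_functional (\<i> *\<^sub>C x) y)" for c x y
  proof -
    have "c *\<^sub>C x = Re c *\<^sub>R x + Im c *\<^sub>R (\<i> *\<^sub>C x)"
      by (simp add: scaleR_scaleC scaleC_scaleC scaleC_add_left[symmetric])
        (metis complex_eq mult.commute)
    then show ?thesis by (simp add: vec_functional_linear \<phi>.add \<phi>.scale)
  qed
  have swap: "\<phi> (vec_functional x (c *\<^sub>C y)) = \<phi> (vec_functional (cnj c *\<^sub>C x) y)" for c x y
    by (rule eq) (simp add: bounded_ops_scaleC[OF M_bounded_ops] cinner_scaleC_left cinner_scaleC_right)
  obtain B where B: "B \<in> bounded_ops" "\<And>x y. cinner (blinfun_apply B x) y = \<beta> x y"
  proof (rule sesquilinear_representation[of \<beta> "2 * K"])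
    fix c x x' y y'
    show "\<beta> (x + x') y = \<beta> x y + \<beta> x' y" "\<beta> x (y + y') = \<beta> x y + \<beta> x y'"
      by (simp_all add: \<beta>_def scaleC_add_right vec_functional_linear \<phi>.add complex_eq_iff)
    show scl: "\<beta> (c *\<^sub>C x) y = c * \<beta> x y" for c x y
      using scale[of c x y] scale[of "\<i> * c" x y]
      by (simp add: \<beta>_def scaleC_scaleC complex_eq_iff)
    have "\<beta> x (c *\<^sub>C y) = \<beta> (cnj c *\<^sub>C x) y"
      by (simp add: \<beta>_def swap scaleC_scaleC mult.commute)
    then show "\<beta> x (c *\<^sub>C y) = cnj c * \<beta> x y" by (simp add: scl)
    show "cmod (\<beta> x y) \<le> 2 * K * norm x * norm y"
      using cmod_le[of "\<beta> x y"] bound[of x y] bound[of "\<i> *\<^sub>C x" y]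
      by (simp add: \<beta>_def norm_scaleC mult.assoc)
  qed blast
  have "B \<in> M"
  proof (rule M_memI[OF B(1)])
    fix C D x y assume C: "C \<in> commutant M" and D: "is_adjoint C D"
    have C': "C \<in> bounded_ops" and comm: "\<And>A z. A \<in> M \<Longrightarrow> blinfun_apply A (blinfun_apply C z) = blinfun_apply C (blinfun_apply A z)"
      using C by (auto simp: commutant_def dest: arg_cong[where f = "\<lambda>F. blinfun_apply F _"]) (metis blinfun_apply_blinfun_compose)
    have "\<phi> (vec_functional (blinfun_apply C z) y) = \<phi> (vec_functional z (blinfun_apply D y))" for z
      by (rule eq) (use D in \<open>simp add: comm is_adjoint_def\<close>)
    from this[of x] this[of "\<i> *\<^sub>C x"]
    show "cinner (blinfun_apply B (blinfun_apply C x)) y = cinner (blinfun_apply B x) (blinfun_apply D y)"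
      by (simp add: B(2) \<beta>_def bounded_ops_scaleC[OF C'])
  qed
  moreover have "\<phi> (vec_sum zs) = Re (blinfun_apply (vec_sum zs) B)" for zs
    by (induction zs) (simp_all add: \<phi>.add \<phi>.zero blinfun.add_left B(2) \<beta>_def)
  ultimately show thesis using that by blast
qed

text \<open>The hypothesis \<open>dom\<close> bounds the Hahn-Banach functional by a multiple of the
  norm on \<open>M\<close>, and such a functional is evaluation at an element of \<open>M\<close> on
  vector sums.\<close>

lemma separation_from_cone:
  fixes R :: "((('h \<Rightarrow>\<^sub>L 'h) \<Rightarrow>\<^sub>L complex) \<times> real) set"
  assumes R: "epi_cone R" and K: "K \<ge> 0"
    and dom: "\<And>f c. c \<ge> 0 \<Longrightarrow> (\<And>A. A \<in> M \<Longrightarrow> cmod (blinfun_apply f A) \<le> c * norm A) \<Longrightarrow> (f, K * c) \<in> R"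
    and a: "\<And>t. (vec_sum zs, t) \<in> R \<Longrightarrow> a \<le> t"
  obtains B where "B \<in> M" "\<And>ws t. (vec_sum ws, t) \<in> R \<Longrightarrow> Re (blinfun_apply (vec_sum ws) B) \<le> t"
    "Re (blinfun_apply (vec_sum zs) B) \<ge> a"
proof -
  have "\<exists>t. (f, t) \<in> R" for f
    using dom[of "norm f" f] norm_blinfun[of f] by auto
  then obtain \<phi> where \<phi>: "linear \<phi>" "\<And>f t. (f, t) \<in> R \<Longrightarrow> \<phi> f \<le> t" "\<phi> (vec_sum zs) \<ge> a"
    using hahn_banach_epi_cone[OF R _ a] by metis
  obtain B where "B \<in> M" "\<And>zs. \<phi> (vec_sum zs) = Re (blinfun_apply (vec_sum zs) B)"
    using functional_on_vec_sums[OF \<phi>(1) K \<phi>(2)[OF dom]] by metis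
  then show thesis using that[of B] \<phi>(2,3) by metis
qed

text \<open>Testing with the multiple of B x that has the same norm as \<open>x\<close> turns the
  right-hand side into the square of \<open>norm x\<close>.\<close>

lemma norm_le_if_Re_cinner_le:
  fixes B :: "'h \<Rightarrow>\<^sub>L 'h"
  assumes "\<And>x y. Re (cinner (blinfun_apply B x) y) \<le> ((norm x)\<^sup>2 + (norm y)\<^sup>2) / 2"
  shows "norm B \<le> 1"
proof (rule norm_blinfun_bound)
  fix x
  show "norm (blinfun_apply B x) \<le> 1 * norm x"
  proof (cases "blinfun_apply B x = 0")
    case False
    define b where "b = norm (blinfun_apply B x)"
    have b: "b > 0" using False by (simp add: b_def)
    define y where "y = (norm x / b) *\<^sub>R blinfun_apply B x"
    have "norm y = norm x" using b by (simp add: y_def b_def)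
    moreover have "Re (cinner (blinfun_apply B x) y) = norm x * b"
      using b by (simp add: y_def cinner_scaleR_right cinner_self b_def[symmetric] power2_eq_square)
    ultimately have "norm x * b \<le> norm x * norm x"
      using assms[of x y] by (simp add: power2_eq_square)
    moreover have "x \<noteq> 0" using False by (auto simp: blinfun.zero_right)
    ultimately show ?thesis by (simp add: b_def)
  qed simp
qed simp

text \<open>\<open>R\<close> is the epigraph of the infimal convolution of \<open>vec_weight\<close>
  with 4 times the norm on \<open>M\<close>. If the value at \<open>vec_sum zs\<close> were not
  below \<open>d\<close>, separation would give \<open>B\<close> in \<open>M\<close> with value at
  least \<open>d\<close>; but single vector functionals show \<open>norm B \<le> 1\<close>, so this
  value is at most \<open>c\<close>. The factor 4 keeps the error \<open>s\<close> a small fraction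
  of \<open>d\<close>.\<close>

lemma vec_sum_small_weight:
  assumes c: "\<And>A. A \<in> M \<Longrightarrow> cmod (blinfun_apply (vec_sum zs) A) \<le> c * norm A" and d: "c < d" and c0: "c \<ge> 0"
  shows "\<exists>ws s. s \<ge> 0 \<and> vec_weight ws + 4 * s < d \<and>
    (\<forall>A\<in>M. cmod (blinfun_apply (vec_sum zs) A - blinfun_apply (vec_sum ws) A) \<le> s * norm A)"
proof -
  define R where "R = {(f, t). \<exists>ws s. s \<ge> 0 \<and> vec_weight ws + 4 * s \<le> t \<and>
      (\<forall>A\<in>M. cmod (blinfun_apply f A - blinfun_apply (vec_sum ws) A) \<le> s * norm A)}"
  have RI: "(f, t) \<in> R" if "s \<ge> 0" "vec_weight ws + 4 * s \<le> t"
      "\<And>A. A \<in> M \<Longrightarrow> cmod (blinfun_apply f A - blinfun_apply (vec_sum ws) A) \<le> s * norm A" for f t ws s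
    unfolding R_def using that by blast
  have RE: "\<exists>ws s. s \<ge> 0 \<and> vec_weight ws + 4 * s \<le> t \<and>
      (\<forall>A\<in>M. cmod (blinfun_apply f A - blinfun_apply (vec_sum ws) A) \<le> s * norm A)" if "(f, t) \<in> R" for f t
    using that unfolding R_def by blast
  have R: "epi_cone R"
    unfolding epi_cone_def
  proof (intro conjI allI impI)
    show "(0, 0) \<in> R" by (rule RI[of 0 "[]"]) auto
  next
    fix f s g t assume "(f, s) \<in> R \<and> (g, t) \<in> R"
    then obtain ws r ws' r' where 1: "r \<ge> 0" "vec_weight ws + 4 * r \<le> s"
        "\<And>A. A \<in> M \<Longrightarrow> cmod (blinfun_apply f A - blinfun_apply (vec_sum ws) A) \<le> r * norm A"
      and 2: "r' \<ge> 0" "vec_weight ws' + 4 * r' \<le> t"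
        "\<And>A. A \<in> M \<Longrightarrow> cmod (blinfun_apply g A - blinfun_apply (vec_sum ws') A) \<le> r' * norm A"
      by (meson RE)
    show "(f + g, s + t) \<in> R"
    proof (rule RI[of "r + r'" "ws @ ws'"])
      fix A assume A: "A \<in> M"
      show "cmod (blinfun_apply (f + g) A - blinfun_apply (vec_sum (ws @ ws')) A) \<le> (r + r') * norm A"
        using norm_triangle_ineq[of "blinfun_apply f A - blinfun_apply (vec_sum ws) A"
            "blinfun_apply g A - blinfun_apply (vec_sum ws') A"] 1(3)[OF A] 2(3)[OF A]
        by (simp add: blinfun.add_left algebra_simps)
    qed (use 1 2 in auto)
  next
    fix f s and c :: real assume "(f, s) \<in> R \<and> c > 0"
    then obtain ws r where 1: "r \<ge> 0" "vec_weight ws + 4 * r \<le> s" "c > 0"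
        "\<And>A. A \<in> M \<Longrightarrow> cmod (blinfun_apply f A - blinfun_apply (vec_sum ws) A) \<le> r * norm A"
      by (meson RE)
    show "(c *\<^sub>R f, c * s) \<in> R"
    proof (rule RI[of "c * r" "map (\<lambda>z. (sqrt c *\<^sub>R fst z, sqrt c *\<^sub>R snd z)) ws"])
      show "vec_weight (map (\<lambda>z. (sqrt c *\<^sub>R fst z, sqrt c *\<^sub>R snd z)) ws) + 4 * (c * r) \<le> c * s"
        using mult_left_mono[OF 1(2), of c] 1(3) by (simp add: vec_weight_sqrt_scale algebra_simps)
      fix A assume A: "A \<in> M"
      show "cmod (blinfun_apply (c *\<^sub>R f) A - blinfun_apply (vec_sum (map (\<lambda>z. (sqrt c *\<^sub>R fst z, sqrt c *\<^sub>R snd z)) ws)) A) \<le> c * r * norm A"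
        using mult_left_mono[OF 1(4)[OF A], of c] 1(3)
        by (simp add: vec_sum_sqrt_scale blinfun.scaleR_left mult.assoc scaleR_diff_right[symmetric])
    qed (use 1 in auto)
  next
    fix t assume "(0, t) \<in> R"
    then obtain ws s where "s \<ge> 0" "vec_weight (ws :: ('h \<times> 'h) list) + 4 * s \<le> t" using RE by blast
    then show "t \<ge> 0" using vec_weight_nonneg[of ws] by linarith
  qed
  have "\<exists>t. (vec_sum zs, t) \<in> R \<and> t < d"
  proof (rule ccontr)
    assume neg: "\<not> ?thesis"
    obtain B where B: "B \<in> M" "\<And>ws t. (vec_sum ws, t) \<in> R \<Longrightarrow> Re (blinfun_apply (vec_sum ws) B) \<le> t"
      "Re (blinfun_apply (vec_sum zs) B) \<ge> d"
    proof (rule separation_from_cone[OF R, of 4 zs d])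
      show "(f, 4 * c) \<in> R" if "c \<ge> 0" "\<And>A. A \<in> M \<Longrightarrow> cmod (blinfun_apply f A) \<le> c * norm A" for f c
        by (rule RI[of c "[]"]) (use that in auto)
      show "d \<le> t" if "(vec_sum zs, t) \<in> R" for t using neg that by force
    qed auto
    have "norm B \<le> 1"
    proof (rule norm_le_if_Re_cinner_le)
      fix x y
      have "(vec_sum [(x, y)], ((norm x)\<^sup>2 + (norm y)\<^sup>2) / 2) \<in> R"
        by (rule RI[of 0 "[(x, y)]"]) auto
      from B(2)[OF this] show "Re (cinner (blinfun_apply B x) y) \<le> ((norm x)\<^sup>2 + (norm y)\<^sup>2) / 2"
        by (simp add: blinfun.add_left)
    qed
    then have "c * norm B \<le> c" using c0 by (simp add: mult_left_le)
    then show False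
      using c[OF B(1)] B(3) d complex_Re_le_cmod[of "blinfun_apply (vec_sum zs) B"] by linarith
  qed
  then show ?thesis using RE by (meson le_less_trans)
qed

text \<open>An approximation within c / 8 has norm at most 9c / 8 on \<open>M\<close>, so the level
  10c / 8 is admissible. Then 4 s < 10c / 8, and the total error c / 8 + s stays below c /
  2.\<close>

lemma vec_approximable_halving:
  assumes f: "vec_approximable M f" and c: "c > 0" and bound: "\<And>A. A \<in> M \<Longrightarrow> cmod (f A) \<le> c * norm A"
  obtains ws where "vec_weight ws \<le> 2 * c"
    "\<And>A. A \<in> M \<Longrightarrow> cmod (f A - blinfun_apply (vec_sum ws) A) \<le> c / 2 * norm A"
proof -
  obtain zs where zs: "\<And>A. A \<in> M \<Longrightarrow> cmod (f A - blinfun_apply (vec_sum zs) A) \<le> c / 8 * norm A"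
    using f c unfolding vec_approximable_def by (meson zero_less_divide_iff zero_less_numeral)
  have le: "cmod (blinfun_apply (vec_sum zs) A) \<le> 9 * c / 8 * norm A" if A: "A \<in> M" for A
    using norm_triangle_sub[of "blinfun_apply (vec_sum zs) A" "f A"] zs[OF A] bound[OF A]
    by (simp add: norm_minus_commute field_simps)
  have c': "9 * c / 8 < 10 * c / 8" "0 \<le> 9 * c / 8" using c by simp_all
  obtain ws s where ws: "s \<ge> 0" "vec_weight ws + 4 * s < 10 * c / 8"
    "\<And>A. A \<in> M \<Longrightarrow> cmod (blinfun_apply (vec_sum zs) A - blinfun_apply (vec_sum ws) A) \<le> s * norm A"
    using vec_sum_small_weight[of zs "9 * c / 8" "10 * c / 8", OF _ c'] le by meson
  show thesis
  proof
    show "vec_weight ws \<le> 2 * c" using ws c by linarith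
    fix A assume A: "A \<in> M"
    have "cmod (f A - blinfun_apply (vec_sum ws) A) \<le> (c / 8 + s) * norm A"
      using norm_triangle_ineq[of "f A - blinfun_apply (vec_sum zs) A"
          "blinfun_apply (vec_sum zs) A - blinfun_apply (vec_sum ws) A"] zs[OF A] ws(3)[OF A]
      by (simp add: distrib_right)
    also have "\<dots> \<le> c / 2 * norm A"
      using ws(1,2) vec_weight_nonneg[of ws] c by (intro mult_right_mono) auto
    finally show "cmod (f A - blinfun_apply (vec_sum ws) A) \<le> c / 2 * norm A" .
  qed
qed

text \<open>Repeated halving writes \<open>f\<close> as a series of finite vector sums with weights
  at most 2c / 2^n. The total weight is finite, so all the vectors listed together are
  square-summable.\<close>

lemma vec_approximable_imp_nuclear:
  assumes f: "vec_approximable M f"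
  obtains x y where "summable (\<lambda>n. (norm (x n))\<^sup>2)" "summable (\<lambda>n. (norm (y n))\<^sup>2)"
    "\<And>A. A \<in> M \<Longrightarrow> f A = nuclear x y A"
proof -
  obtain c where c: "c > 0" "\<And>A. A \<in> M \<Longrightarrow> cmod (f A) \<le> c * norm A"
    using vec_approximable_bounded[OF f] by blast
  \<comment> \<open>\<open>F\<close> is the remainder after \<open>n\<close> halvings; the last
    clause anchors the recursion at \<open>f\<close>.\<close>
  define P where "P n F \<longleftrightarrow> vec_approximable M F \<and> (\<forall>A\<in>M. cmod (F A) \<le> c / 2 ^ n * norm A) \<and>
      (n = 0 \<longrightarrow> F = f)" for n :: nat and F
  define Q where "Q n F F' \<longleftrightarrow> (\<exists>ws. vec_weight ws \<le> 2 * (c / 2 ^ n) \<and> F' = (\<lambda>A. F A - blinfun_apply (vec_sum ws) A))"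
    for n :: nat and F F' :: "('h \<Rightarrow>\<^sub>L 'h) \<Rightarrow> complex"
  have "\<exists>F. \<forall>n. P n (F n) \<and> Q n (F n) (F (Suc n))"
  proof (rule dependent_nat_choice)
    show "\<exists>F. P 0 F" using f c unfolding P_def by auto
    fix F n assume P: "P n F"
    obtain ws where ws: "vec_weight ws \<le> 2 * (c / 2 ^ n)"
      "\<And>A. A \<in> M \<Longrightarrow> cmod (F A - blinfun_apply (vec_sum ws) A) \<le> c / 2 ^ n / 2 * norm A"
      using vec_approximable_halving[of F "c / 2 ^ n"] P c(1) unfolding P_def by auto
    have "vec_approximable M (\<lambda>A. F A + (- 1) * blinfun_apply (vec_sum ws) A)"
      using P unfolding P_def by (intro vec_approximable_combination vec_approximable_vec_sum) auto
    then have "P (Suc n) (\<lambda>A. F A - blinfun_apply (vec_sum ws) A)"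
      using ws(2) unfolding P_def by (simp add: mult.commute)
    then show "\<exists>F'. P (Suc n) F' \<and> Q n F F'" using ws(1) unfolding Q_def by blast
  qed
  then obtain F where F: "\<And>n. P n (F n)" and "\<And>n. Q n (F n) (F (Suc n))" by blast
  then obtain w where w: "\<And>n. vec_weight (w n) \<le> 2 * (c / 2 ^ n)"
    "\<And>n. F (Suc n) = (\<lambda>A. F n A - blinfun_apply (vec_sum (w n)) A)"
    unfolding Q_def by metis
  have sums: "(\<lambda>n. blinfun_apply (vec_sum (w n)) A) sums f A" if A: "A \<in> M" for A
  proof -
    have "(\<Sum>i<n. blinfun_apply (vec_sum (w i)) A) = f A - F n A" for n
    proof (induction n)
      case 0
      then show ?case using F[of 0] by (simp add: P_def)
    qed (simp add: w(2))
    moreover have "(\<lambda>n. F n A) \<longlonglongrightarrow> 0"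
    proof (rule Lim_null_comparison)
      show "\<forall>\<^sub>F n in sequentially. norm (F n A) \<le> c * norm A * (1 / 2) ^ n"
        using F A unfolding P_def by (simp add: power_divide)
      show "(\<lambda>n. c * norm A * (1 / 2) ^ n) \<longlonglongrightarrow> 0"
        by (intro tendsto_mult_right_zero LIMSEQ_power_zero) simp
    qed
    ultimately show ?thesis
      unfolding sums_def using tendsto_diff[OF tendsto_const, of "\<lambda>n. F n A" 0 sequentially "f A"] by simp
  qed
  \<comment> \<open>Padding with zero vectors turns lists of varying length into one double family
    over all pairs of indices, which \<open>prod_decode\<close> then arranges in a sequence.\<close>
  define z where "z k i = (if i < length (w k) then w k ! i else (0, 0))" for k i
  have sum_z: "(\<Sum>i<length (w k). g (z k i)) = (\<Sum>z\<leftarrow>w k. g z)" for k and g :: "'h \<times> 'h \<Rightarrow> 'b::comm_monoid_add"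
    by (simp add: z_def sum_list_sum_nth atLeast0LessThan)
  have hs: "((\<lambda>i. g (z k i)) has_sum (\<Sum>z\<leftarrow>w k. g z)) UNIV" if "g (0, 0) = 0"
    for k and g :: "'h \<times> 'h \<Rightarrow> 'b::{comm_monoid_add, t2_space}"
    by (rule has_sum_finite_neutralI[of "{..<length (w k)}"]) (auto simp: sum_z[symmetric] z_def that)
  define N :: "'h \<times> 'h \<Rightarrow> real" where "N u = ((norm (fst u))\<^sup>2 + (norm (snd u))\<^sup>2) / 2" for u
  have geo: "(\<lambda>k. vec_weight (w k)) summable_on UNIV"
  proof -
    have "summable (\<lambda>k. 2 * c * (1 / 2) ^ k)" by (intro summable_mult summable_geometric) simp
    then have "summable (\<lambda>k. vec_weight (w k))"
      by (rule summable_comparison_test') (use w(1) in \<open>simp add: power_divide abs_of_nonneg[OF vec_weight_nonneg]\<close>)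
    then show ?thesis
      using summable_on_UNIV_nonneg_real_iff[of "\<lambda>k. vec_weight (w k)"] vec_weight_nonneg by blast
  qed
  have N: "(\<lambda>(k, i). N (z k i)) summable_on UNIV \<times> UNIV"
  proof (rule summable_on_SigmaI[OF _ geo])
    show "((\<lambda>i. case (k, i) of (k, i) \<Rightarrow> N (z k i)) has_sum vec_weight (w k)) UNIV" for k
      using hs[of N k] by (simp add: N_def vec_weight_def)
  qed (simp add: N_def)
  let ?z = "\<lambda>n. case prod_decode n of (k, i) \<Rightarrow> z k i"
  have bij: "bij_betw prod_decode UNIV (UNIV \<times> UNIV)" using bij_prod_decode by simp
  have N': "summable (\<lambda>n. N (?z n))"
    using N unfolding summable_on_reindex_bij_betw[OF bij, of "\<lambda>(k, i). N (z k i)", symmetric]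
    by (intro summable_on_imp_summable) (simp add: case_prod_beta)
  show thesis
  proof
    show s1: "summable (\<lambda>n. (norm (fst (?z n)))\<^sup>2)" and s2: "summable (\<lambda>n. (norm (snd (?z n)))\<^sup>2)"
      by (rule summable_comparison_test'[OF summable_mult[OF N', of 2]], simp add: N_def)+
    fix A assume A: "A \<in> M"
    define p where "p u = cinner (blinfun_apply A (fst u)) (snd u)" for u
    have p0: "p (0, 0) = 0" by (simp add: p_def)
    have ws: "(\<Sum>z\<leftarrow>zs. p z) = blinfun_apply (vec_sum zs) A" for zs
      by (induction zs) (simp_all add: p_def blinfun.add_left)
    have "summable (\<lambda>n. norm (p (?z n)))"
      unfolding p_def by (rule nuclear_summable[OF s1 s2])
    then have "(\<lambda>n. p (?z n)) summable_on UNIV" by (rule norm_summable_imp_summable_on)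
    then have psum: "(\<lambda>(k, i). p (z k i)) summable_on UNIV \<times> UNIV"
      unfolding summable_on_reindex_bij_betw[OF bij, of "\<lambda>(k, i). p (z k i)", symmetric]
      by (simp add: case_prod_beta)
    then have has: "((\<lambda>(k, i). p (z k i)) has_sum infsum (\<lambda>(k, i). p (z k i)) (UNIV \<times> UNIV)) (UNIV \<times> UNIV)"
      by (rule has_sum_infsum)
    \<comment> \<open>Absolute summability allows summation by rows; row \<open>k\<close> is the
      k-th vector sum, so the total is \<open>f A\<close>.\<close>
    have "((\<lambda>k. blinfun_apply (vec_sum (w k)) A) has_sum infsum (\<lambda>(k, i). p (z k i)) (UNIV \<times> UNIV)) UNIV"
      by (rule has_sum_SigmaD[OF has]) (use hs[of p, OF p0] in \<open>simp add: ws\<close>)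
    then have "infsum (\<lambda>(k, i). p (z k i)) (UNIV \<times> UNIV) = f A"
      using has_sum_imp_sums sums[OF A] sums_unique2 by blast
    then have "((\<lambda>n. p (?z n)) has_sum f A) UNIV"
      using has unfolding has_sum_reindex_bij_betw[OF bij, of "\<lambda>(k, i). p (z k i)", symmetric]
      by (simp add: case_prod_beta)
    then have "(\<lambda>n. p (?z n)) sums f A" by (rule has_sum_imp_sums)
    then show "f A = nuclear (\<lambda>n. fst (?z n)) (\<lambda>n. snd (?z n)) A"
      unfolding nuclear_def p_def by (rule sums_unique)
  qed
qed

text \<open>The working description of the predual: topology has disappeared, and stability under
  norm limits is now a statement about approximation.\<close>

lemma predual_iff:
  "l \<in> predual M \<longleftrightarrow> l \<in> extensional M \<and> clinear_on M l \<and> vec_approximable M l"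
proof
  assume l: "l \<in> predual M"
  then show "l \<in> extensional M \<and> clinear_on M l \<and> vec_approximable M l"
    using predual_clinear predual_vec_approximable by (auto simp: predual_def)
next
  assume l: "l \<in> extensional M \<and> clinear_on M l \<and> vec_approximable M l"
  then obtain x y where "summable (\<lambda>n. (norm (x n))\<^sup>2)" "summable (\<lambda>n. (norm (y n))\<^sup>2)"
    "\<And>A. A \<in> M \<Longrightarrow> l A = nuclear x y A"
    using vec_approximable_imp_nuclear by metis
  then show "l \<in> predual M" using nuclear_in_predual l by blast
qed

end

section \<open>Operators on the algebra and their Banach limits\<close>

lemma is_adjoint_sym: "is_adjoint A B \<Longrightarrow> is_adjoint B A"
  unfolding is_adjoint_def by (metis cinner_commute)

lemma op_scale_comp: "X \<in> bounded_ops \<Longrightarrow> X o\<^sub>L (c \<cdot>\<^sub>C A) = c \<cdot>\<^sub>C (X o\<^sub>L A)"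
  by (rule blinfun_eqI) (simp add: bounded_ops_scaleC)

context von_neumann
begin

text \<open>Vector functionals restricted to \<open>M\<close> belong to the predual, and they
  determine an operator.\<close>

lemma predual_separates:
  assumes Z: "Z \<in> M" "Z' \<in> M" and eq: "\<And>l. l \<in> predual M \<Longrightarrow> l Z = l Z'"
  shows "Z = Z'"
proof (rule blinfun_eqI_cinner)
  fix x y
  let ?l = "\<lambda>A\<in>M. blinfun_apply (vec_sum [(x, y)]) A"
  have "?l \<in> predual M"
    unfolding predual_iff
  proof (intro conjI)
    show "clinear_on M ?l"
      unfolding clinear_on_def
      by (simp add: M_add M_scale blinfun.add_left cinner_add_left cinner_scaleC_left)
    show "vec_approximable M ?l"
      unfolding vec_approximable_def by (intro allI impI exI[of _ "[(x, y)]"]) simp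
  qed simp
  from eq[OF this] Z show "cinner (blinfun_apply Z x) y = cinner (blinfun_apply Z' x) y"
    by (simp add: blinfun.add_left)
qed

lemma predual_add: "l \<in> predual M \<Longrightarrow> A \<in> M \<Longrightarrow> B \<in> M \<Longrightarrow> l (A + B) = l A + l B"
  and predual_scale: "l \<in> predual M \<Longrightarrow> A \<in> M \<Longrightarrow> l (c \<cdot>\<^sub>C A) = c * l A"
  using predual_clinear clinear_onD by blast+

lemma predual_diff: "l \<in> predual M \<Longrightarrow> A \<in> M \<Longrightarrow> B \<in> M \<Longrightarrow> l (A - B) = l A - l B"
  using predual_add[of l A "- B"] predual_scale[of l B "- 1"] M_minus[of B]
  by (simp add: op_scale_simps)

lemma predual_bounded:
  assumes "l \<in> predual M"
  obtains C where "C > 0" "\<And>A. A \<in> M \<Longrightarrow> cmod (l A) \<le> C * norm A"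
  using vec_approximable_bounded predual_vec_approximable[OF assms] by blast

text \<open>In a vector functional, left multiplication by \<open>X\<close> moves to the second
  vector as the adjoint of \<open>X\<close>.\<close>

lemma vec_approximable_left_mult:
  assumes f: "vec_approximable M f" and X: "X \<in> M"
  shows "vec_approximable M (\<lambda>A. f (X o\<^sub>L A))"
  unfolding vec_approximable_def
proof (intro allI impI)
  fix e :: real assume e: "e > 0"
  obtain Y where Y: "is_adjoint X Y" using M_adjoint[OF X] by blast
  define d where "d = e / (1 + norm X)"
  have d: "d > 0" unfolding d_def using e by (intro divide_pos_pos add_pos_nonneg) auto
  have "1 + norm X > 0" by (simp add: add_pos_nonneg)
  then have "d * (1 + norm X) = e" by (simp add: d_def)
  then have de: "d * norm X \<le> e" using d by (simp add: algebra_simps)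
  obtain zs where zs: "\<And>A. A \<in> M \<Longrightarrow> cmod (f A - blinfun_apply (vec_sum zs) A) \<le> d * norm A"
    using f d unfolding vec_approximable_def by meson
  have eq: "blinfun_apply (vec_sum (map (\<lambda>z. (fst z, blinfun_apply Y (snd z))) zs)) A = blinfun_apply (vec_sum zs) (X o\<^sub>L A)" for A
    using Y by (induction zs) (simp_all add: blinfun.add_left is_adjoint_def)
  have "cmod (f (X o\<^sub>L A) - blinfun_apply (vec_sum (map (\<lambda>z. (fst z, blinfun_apply Y (snd z))) zs)) A) \<le> e * norm A"
    if A: "A \<in> M" for A
  proof -
    have "cmod (f (X o\<^sub>L A) - blinfun_apply (vec_sum zs) (X o\<^sub>L A)) \<le> d * norm (X o\<^sub>L A)"
      by (rule zs[OF M_comp[OF X A]])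
    also have "\<dots> \<le> d * (norm X * norm A)" using d by (intro mult_left_mono norm_blinfun_compose) simp
    also have "\<dots> \<le> e * norm A" using mult_right_mono[OF de, of "norm A"] by (simp add: mult.assoc)
    finally show ?thesis by (simp only: eq)
  qed
  then show "\<exists>zs. \<forall>A\<in>M. cmod (f (X o\<^sub>L A) - blinfun_apply (vec_sum zs) A) \<le> e * norm A" by blast
qed

lemma Psi_in_predual:
  assumes \<tau>: "\<tau> \<in> predual M" and X: "X \<in> M"
  shows "Psi M \<tau> X \<in> predual M"
  unfolding predual_iff
proof (intro conjI)
  show "Psi M \<tau> X \<in> extensional M" by (simp add: Psi_def)
  show "clinear_on M (Psi M \<tau> X)"
    unfolding clinear_on_def Psi_def
    using X by (simp add: M_add M_scale bounded_bilinear.add_right[OF bounded_bilinear_blinfun_compose] predual_add[OF \<tau>] M_comp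
        op_scale_comp[OF M_bounded_ops] predual_scale[OF \<tau>])
  have "vec_approximable M (\<lambda>A. \<tau> (X o\<^sub>L A))"
    using predual_vec_approximable[OF \<tau>] X by (rule vec_approximable_left_mult)
  then show "vec_approximable M (Psi M \<tau> X)"
    unfolding vec_approximable_def Psi_def by simp
qed

section \<open>Bounded operators on the algebra and weak*-continuity\<close>

lemma BM_mem: "\<phi> \<in> BM M \<Longrightarrow> X \<in> M \<Longrightarrow> \<phi> X \<in> M"
  and BM_add: "\<phi> \<in> BM M \<Longrightarrow> X \<in> M \<Longrightarrow> Y \<in> M \<Longrightarrow> \<phi> (X + Y) = \<phi> X + \<phi> Y"
  and BM_scaleC: "\<phi> \<in> BM M \<Longrightarrow> X \<in> M \<Longrightarrow> \<phi> (c \<cdot>\<^sub>C X) = c \<cdot>\<^sub>C \<phi> X"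
  by (auto simp: BM_def)

lemma BM_bounded:
  assumes "\<phi> \<in> BM M"
  obtains K where "K > 0" "\<And>A. A \<in> M \<Longrightarrow> norm (\<phi> A) \<le> K * norm A"
proof -
  obtain K where K: "\<forall>A\<in>M. norm (\<phi> A) \<le> K * norm A" using assms by (auto simp: BM_def)
  have "norm (\<phi> A) \<le> max K 1 * norm A" if "A \<in> M" for A
    using K that mult_right_mono[of K "max K 1" "norm A"] by fastforce
  then show thesis using that[of "max K 1"] by simp
qed

lemma BM_norm_le:
  assumes \<phi>: "\<phi> \<in> BM M" and X: "X \<in> M"
  shows "norm (\<phi> X) \<le> BM_norm M \<phi> * norm X"
proof (cases "X = 0")
  case True
  then show ?thesis using BM_scaleC[OF \<phi> X, of 0] by (simp add: op_scale_simps)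
next
  case False
  obtain K where K: "K > 0" "\<And>A. A \<in> M \<Longrightarrow> norm (\<phi> A) \<le> K * norm A" using BM_bounded[OF \<phi>] by blast
  define c where "c = complex_of_real (1 / norm X)"
  have cX: "c \<cdot>\<^sub>C X = (1 / norm X) *\<^sub>R X" unfolding c_def by (rule op_scale_simps)
  have mem: "c \<cdot>\<^sub>C X \<in> {A \<in> M. norm A \<le> 1}" using M_scale[OF X, of c] False by (simp add: cX)
  have "bdd_above ((\<lambda>A. norm (\<phi> A)) ` {A \<in> M. norm A \<le> 1})"
  proof (rule bdd_aboveI2[where M = K])
    fix A assume "A \<in> {A \<in> M. norm A \<le> 1}"
    then have "norm (\<phi> A) \<le> K * norm A" "K * norm A \<le> K * 1"
      using K(2)[of A] K(1) mult_left_mono[of "norm A" 1 K] by simp_all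
    then show "norm (\<phi> A) \<le> K" by simp
  qed
  then have "norm (\<phi> (c \<cdot>\<^sub>C X)) \<le> BM_norm M \<phi>"
    unfolding BM_norm_def using mem by (intro cSUP_upper)
  moreover have "\<phi> (c \<cdot>\<^sub>C X) = (1 / norm X) *\<^sub>R \<phi> X"
    unfolding BM_scaleC[OF \<phi> X] unfolding c_def by (rule op_scale_simps)
  ultimately show ?thesis using False by (simp add: field_simps)
qed

lemma openin_weak_star: "l \<in> predual M \<Longrightarrow> open U \<Longrightarrow> openin (weak_star_topology M) {X \<in> M. l X \<in> U}"
  unfolding weak_star_topology_def by (rule topology_generated_by_Basis) blast

lemma topspace_weak_star:
  assumes l: "l \<in> predual M"
  shows "topspace (weak_star_topology M) = M"
proof
  show "topspace (weak_star_topology M) \<subseteq> M"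
    unfolding weak_star_topology_def by (auto simp: topology_generated_by_topspace)
  show "M \<subseteq> topspace (weak_star_topology M)"
    using openin_subset[OF openin_weak_star[OF l open_UNIV]] by simp
qed

text \<open>Forwards: the ultraweak topology on \<open>M\<close> is finer than the weak* one, so l
  composed with a weak*-continuous operator is ultraweakly continuous. Backwards: the preimage of
  the generator given by \<open>l\<close> is the generator given by its preadjoint.\<close>

lemma BwM_iff:
  assumes ne: "predual M \<noteq> {}"
  shows "\<phi> \<in> BwM M \<longleftrightarrow> \<phi> \<in> BM M \<and> (\<forall>l\<in>predual M. preadjoint M \<phi> l \<in> predual M)"
proof (intro iffI conjI ballI)
  assume "\<phi> \<in> BwM M"
  then show \<phi>: "\<phi> \<in> BM M" by (simp add: BwM_def)
  fix l assume l: "l \<in> predual M"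
  let ?W = "weak_star_topology M" and ?U = "subtopology ultraweak_topology M"
  have topU: "topspace ?U = M"
    using openin_subset[OF openin_bounded_ops] M_bounded_ops by (auto simp: topspace_subtopology)
  have topW: "topspace ?W = M" using topspace_weak_star[OF l] .
  have coarser: "continuous_map ?U ?W (\<lambda>X. X)"
    unfolding weak_star_topology_def
  proof (rule continuous_on_generated_topo)
    fix S assume "S \<in> {{X \<in> M. l X \<in> U} |l U. l \<in> predual M \<and> open U}"
    then obtain k U where S: "S = {X \<in> M. k X \<in> U}" "k \<in> predual M" "open U" by blast
    have "openin ?U {X \<in> topspace ?U. k X \<in> U}"
      using S by (intro openin_continuous_map_preimage[where Y = euclidean]) (auto simp: predual_def)
    moreover have "(\<lambda>X. X) -` S \<inter> topspace ?U = {X \<in> topspace ?U. k X \<in> U}"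
      unfolding S topU by auto
    ultimately show "openin ?U ((\<lambda>X. X) -` S \<inter> topspace ?U)" by simp
  next
    show "(\<lambda>X. X) ` topspace ?U \<subseteq> \<Union> {{X \<in> M. l X \<in> U} |l U. l \<in> predual M \<and> open U}"
      unfolding topU using l by (auto intro!: exI[of _ "{X \<in> M. l X \<in> UNIV}"])
  qed
  have l_cont: "continuous_map ?W euclidean l"
    unfolding continuous_map_def topW
  proof (intro conjI allI impI)
    fix U :: "complex set" assume "openin euclidean U"
    then show "openin ?W {X \<in> M. l X \<in> U}" using openin_weak_star[OF l] by simp
  qed simp
  have "continuous_map ?W ?W \<phi>" using \<open>\<phi> \<in> BwM M\<close> by (simp add: BwM_def)
  then have "continuous_map ?U euclidean (l \<circ> (\<phi> \<circ> (\<lambda>X. X)))"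
    using coarser l_cont by (intro continuous_map_compose)
  then have "continuous_map ?U euclidean (preadjoint M \<phi> l)"
    by (rule continuous_map_eq) (simp add: preadjoint_def topU)
  then show "preadjoint M \<phi> l \<in> predual M"
    unfolding predual_def preadjoint_def
    using l by (simp add: M_add M_scale BM_add[OF \<phi>] BM_scaleC[OF \<phi>] BM_mem[OF \<phi>] predual_add predual_scale)
next
  assume *: "\<phi> \<in> BM M \<and> (\<forall>l\<in>predual M. preadjoint M \<phi> l \<in> predual M)"
  let ?W = "weak_star_topology M"
  obtain l0 where l0: "l0 \<in> predual M" using ne by blast
  have topW: "topspace ?W = M" using topspace_weak_star[OF l0] .
  have "continuous_map ?W ?W \<phi>"
    unfolding weak_star_topology_def[of M]
  proof (rule continuous_on_generated_topo, fold weak_star_topology_def)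
    fix S assume "S \<in> {{X \<in> M. l X \<in> U} |l U. l \<in> predual M \<and> open U}"
    then obtain k U where S: "S = {X \<in> M. k X \<in> U}" "k \<in> predual M" "open U" by blast
    have "\<phi> -` S \<inter> topspace ?W = {X \<in> M. preadjoint M \<phi> k X \<in> U}"
      unfolding S topW preadjoint_def using * BM_mem by auto
    then show "openin ?W (\<phi> -` S \<inter> topspace ?W)" using openin_weak_star * S by simp
  next
    show "\<phi> ` topspace ?W \<subseteq> \<Union> {{X \<in> M. l X \<in> U} |l U. l \<in> predual M \<and> open U}"
      unfolding topW using l0 * BM_mem by (auto intro!: exI[of _ "{X \<in> M. l0 X \<in> UNIV}"])
  qed
  then show "\<phi> \<in> BwM M" using * by (simp add: BwM_def)
qed

text \<open>This plays the role of weak* compactness of balls. The Banach limits of the matrix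
  coefficients form a bounded sesquilinear form, hence an operator, and commutation with the
  commutant passes through \<open>L\<close>. The pairing is right for vector sums by construction,
  and for the whole predual by approximation, uniformly along the bounded sequence.\<close>

lemma banach_limit_of_operators:
  assumes L: "banach_limit L" and Y: "\<And>n. Y n \<in> M" "\<And>n. norm (Y n) \<le> C"
  shows "\<exists>Z\<in>M. norm Z \<le> C \<and> (\<forall>l\<in>predual M. l Z = L (\<lambda>n. l (Y n)))"
proof -
  have C: "C \<ge> 0" using Y(2)[of 0] norm_ge_zero order_trans by blast
  have bd: "cmod (cinner (blinfun_apply (Y n) x) y) \<le> C * norm x * norm y" for n x y
    using cmod_cinner_apply[of "Y n" x y] mult_right_mono[OF Y(2)[of n], of "norm x * norm y"]
    by (simp add: mult.assoc)
  have Bs: "Bseq (\<lambda>n. cinner (blinfun_apply (Y n) x) y)" for x y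
    by (rule BseqI') (rule bd)
  define \<beta> where "\<beta> x y = L (\<lambda>n. cinner (blinfun_apply (Y n) x) y)" for x y
  have \<beta>_le: "cmod (\<beta> x y) \<le> C * norm x * norm y" for x y
    unfolding \<beta>_def by (rule banach_limit_bound[OF L bd])
  obtain Z where Z: "Z \<in> bounded_ops" "\<And>x y. cinner (blinfun_apply Z x) y = \<beta> x y"
  proof (rule sesquilinear_representation[of \<beta> C])
    fix c x x' y y'
    show "\<beta> (x + x') y = \<beta> x y + \<beta> x' y" "\<beta> x (y + y') = \<beta> x y + \<beta> x y'"
      by (simp_all add: \<beta>_def blinfun.add_right cinner_add_left cinner_add_right banach_limit_add[OF L Bs Bs])
    show "\<beta> (c *\<^sub>C x) y = c * \<beta> x y" "\<beta> x (c *\<^sub>C y) = cnj c * \<beta> x y"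
      by (simp_all add: \<beta>_def bounded_ops_scaleC[OF M_bounded_ops[OF Y(1)]] cinner_scaleC_left
          cinner_scaleC_right banach_limit_mult[OF L Bs])
    show "cmod (\<beta> x y) \<le> C * norm x * norm y" by (rule \<beta>_le)
  qed blast
  have "Z \<in> M"
  proof (rule M_memI[OF Z(1)])
    fix D D' x y assume D: "D \<in> commutant M" "is_adjoint D D'"
    have "blinfun_apply A (blinfun_apply D z) = blinfun_apply D (blinfun_apply A z)" if "A \<in> M" for A z
      using D(1) that unfolding commutant_def by (metis (mono_tags, lifting) blinfun_apply_blinfun_compose mem_Collect_eq)
    then show "cinner (blinfun_apply Z (blinfun_apply D x)) y = cinner (blinfun_apply Z x) (blinfun_apply D' y)"
      using D(2) Y(1) by (simp add: Z(2) \<beta>_def is_adjoint_def)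
  qed
  moreover have normZ: "norm Z \<le> C"
  proof (rule norm_blinfun_bound[OF C])
    fix x
    have "(norm (blinfun_apply Z x))\<^sup>2 = cmod (\<beta> x (blinfun_apply Z x))"
      unfolding Z(2)[symmetric] cinner_self norm_of_real by simp
    also have "\<dots> \<le> C * norm x * norm (blinfun_apply Z x)" by (rule \<beta>_le)
    finally show "norm (blinfun_apply Z x) \<le> C * norm x"
      using C by (cases "blinfun_apply Z x = 0") (simp_all add: power2_eq_square)
  qed
  moreover have "l Z = L (\<lambda>n. l (Y n))" if l: "l \<in> predual M" for l
  proof -
    have vs: "Bseq (\<lambda>n. blinfun_apply (vec_sum zs) (Y n)) \<and> L (\<lambda>n. blinfun_apply (vec_sum zs) (Y n)) = blinfun_apply (vec_sum zs) Z" for zs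
    proof (induction zs)
      case Nil
      then show ?case by (simp add: banach_limit_const[OF L] Bfun_const)
    next
      case (Cons z zs)
      have "Bseq (\<lambda>n. blinfun_apply (vec_sum (z # zs)) (Y n))"
      proof (rule BseqI')
        fix n
        show "cmod (blinfun_apply (vec_sum (z # zs)) (Y n)) \<le> norm (vec_sum (z # zs)) * C"
          using norm_blinfun[of "vec_sum (z # zs)" "Y n"] mult_left_mono[OF Y(2)[of n] norm_ge_zero[of "vec_sum (z # zs)"]]
          by linarith
      qed
      moreover have "L (\<lambda>n. blinfun_apply (vec_sum (z # zs)) (Y n)) = blinfun_apply (vec_sum (z # zs)) Z"
        using banach_limit_add[OF L Bs[of "fst z" "snd z"] conjunct1[OF Cons.IH]] Cons.IH
        by (simp add: blinfun.add_left Z(2) \<beta>_def)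
      ultimately show ?case by blast
    qed
    obtain K where K: "K > 0" "\<And>A. A \<in> M \<Longrightarrow> cmod (l A) \<le> K * norm A" using predual_bounded[OF l] by blast
    have lY: "Bseq (\<lambda>n. l (Y n))"
    proof (rule BseqI')
      fix n show "cmod (l (Y n)) \<le> K * C"
        using K(2)[OF Y(1)[of n]] mult_left_mono[OF Y(2)[of n], of K] K(1) by linarith
    qed
    have le: "cmod (l Z - L (\<lambda>n. l (Y n))) \<le> e * (2 * C)" if e: "e > 0" for e
    proof -
      obtain zs where zs: "\<And>A. A \<in> M \<Longrightarrow> cmod (l A - blinfun_apply (vec_sum zs) A) \<le> e * norm A"
        using predual_vec_approximable[OF l] e unfolding vec_approximable_def by meson
      have 1: "cmod (l A - blinfun_apply (vec_sum zs) A) \<le> e * C" if "A \<in> M" "norm A \<le> C" for A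
        using zs[OF that(1)] mult_left_mono[OF that(2), of e] e by linarith
      have "cmod (L (\<lambda>n. l (Y n) + (- 1) * blinfun_apply (vec_sum zs) (Y n))) \<le> e * C"
        by (rule banach_limit_bound[OF L]) (use 1[OF Y] in simp)
      moreover have "Bseq (\<lambda>n. (- 1) * blinfun_apply (vec_sum zs) (Y n))"
        using vs[of zs] Bseq_minus_iff[of "\<lambda>n. blinfun_apply (vec_sum zs) (Y n)"] by simp
      then have "L (\<lambda>n. l (Y n) + (- 1) * blinfun_apply (vec_sum zs) (Y n))
          = L (\<lambda>n. l (Y n)) + (- 1) * blinfun_apply (vec_sum zs) Z"
        using banach_limit_add[OF L lY] banach_limit_mult[OF L conjunct1[OF vs[of zs]], of "- 1"] vs[of zs]
        by metis
      ultimately have "cmod (L (\<lambda>n. l (Y n)) - blinfun_apply (vec_sum zs) Z) \<le> e * C" by simp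
      then show ?thesis
        using 1[OF \<open>Z \<in> M\<close> normZ] norm_triangle_ineq4[of "l Z - blinfun_apply (vec_sum zs) Z"
            "L (\<lambda>n. l (Y n)) - blinfun_apply (vec_sum zs) Z"] by simp
    qed
    have "cmod (l Z - L (\<lambda>n. l (Y n))) \<le> 0 + e" if "e > 0" for e
    proof -
      have "e / (2 * C + 1) * (2 * C) \<le> e" using that C by (simp add: field_simps)
      moreover have "e / (2 * C + 1) > 0" using that C by simp
      ultimately show ?thesis
        using le[of "e / (2 * C + 1)"] by linarith
    qed
    then have "cmod (l Z - L (\<lambda>n. l (Y n))) \<le> 0" by (rule field_le_epsilon)
    then show ?thesis by simp
  qed
  ultimately show ?thesis by blast
qed

section \<open>The operator attached to a dominated sequence and a Banach limit\<close>

context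
  fixes p :: "nat \<Rightarrow> real" and \<Phi> :: "nat \<Rightarrow> ('h \<Rightarrow>\<^sub>L 'h) \<Rightarrow> ('h \<Rightarrow>\<^sub>L 'h)"
  assumes p: "\<And>n. n \<ge> 1 \<Longrightarrow> p n > 0" and dom: "dominated M p \<Phi>"
begin

lemma dominated_norm_le:
  assumes "n \<ge> 1" "X \<in> M"
  shows "norm (\<Phi> n X) \<le> p n * norm X"
proof -
  have "\<Phi> n \<in> BM M" "BM_norm M (\<Phi> n) \<le> p n" using dom assms by (auto simp: dominated_def)
  then show ?thesis
    using BM_norm_le[of "\<Phi> n" X] assms(2) mult_right_mono[of "BM_norm M (\<Phi> n)" "p n" "norm X"] by simp
qed

lemma dominated_BM: "n \<ge> 1 \<Longrightarrow> \<Phi> n \<in> BM M"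
  using dom by (simp add: dominated_def)

lemma dominated_Bseq:
  assumes l: "l \<in> predual M" and X: "X \<in> M"
  shows "Bseq (\<lambda>n. l (\<Phi> (Suc n) X) / complex_of_real (p (Suc n)))"
proof -
  obtain K where K: "K > 0" "\<And>A. A \<in> M \<Longrightarrow> cmod (l A) \<le> K * norm A" using predual_bounded[OF l] by blast
  show ?thesis
  proof (rule BseqI')
    fix n
    have "cmod (l (\<Phi> (Suc n) X)) \<le> K * norm (\<Phi> (Suc n) X)"
      using K(2) BM_mem[OF dominated_BM X] by simp
    also have "\<dots> \<le> K * (p (Suc n) * norm X)"
      using K(1) dominated_norm_le[of "Suc n" X] X by (intro mult_left_mono) auto
    finally show "cmod (l (\<Phi> (Suc n) X) / complex_of_real (p (Suc n))) \<le> K * norm X"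
      using p[of "Suc n"] by (simp add: norm_divide field_simps)
  qed
qed

context
  fixes L :: "(nat \<Rightarrow> complex) \<Rightarrow> complex"
  assumes L: "banach_limit L"
begin

text \<open>Dominance bounds the normalised values at \<open>X\<close> by \<open>norm X\<close>, so
  their operator Banach limit exists; the predual separates points, so it is unique and the definite
  description in \<open>Elim\<close> is justified.\<close>

lemma Elim_spec:
  assumes X: "X \<in> M"
  shows "Elim M p \<Phi> L X \<in> M \<and> norm (Elim M p \<Phi> L X) \<le> norm X \<and>
    (\<forall>l\<in>predual M. l (Elim M p \<Phi> L X) = seq_limit L (\<lambda>n. l (\<Phi> n X) / complex_of_real (p n)))"
proof -
  define Y where "Y n = complex_of_real (1 / p (Suc n)) \<cdot>\<^sub>C \<Phi> (Suc n) X" for n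
  have \<Phi>: "\<Phi> (Suc n) X \<in> M" for n using BM_mem[OF dominated_BM X] by simp
  have Y: "Y n \<in> M" for n unfolding Y_def by (rule M_scale[OF \<Phi>])
  have "norm (Y n) \<le> norm X" for n
    unfolding Y_def op_scale_simps using dominated_norm_le[of "Suc n" X] X p[of "Suc n"]
    by (simp add: field_simps)
  then obtain Z
    where Z: "Z \<in> M" "norm Z \<le> norm X" "\<And>l. l \<in> predual M \<Longrightarrow> l Z = L (\<lambda>n. l (Y n))"
    using banach_limit_of_operators[where Y = Y, OF L Y] by blast
  have lZ: "l Z = seq_limit L (\<lambda>n. l (\<Phi> n X) / complex_of_real (p n))" if "l \<in> predual M" for l
    using Z(3)[OF that] predual_scale[OF that \<Phi>] unfolding Y_def seq_limit_def
    by (simp add: field_simps)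
  have "Elim M p \<Phi> L X = Z"
    unfolding Elim_def using X
    by (simp, intro the_equality) (use Z(1) lZ predual_separates in auto)
  then show ?thesis using Z lZ by simp
qed

lemma Elim_pairing:
  "X \<in> M \<Longrightarrow> l \<in> predual M \<Longrightarrow> l (Elim M p \<Phi> L X) = seq_limit L (\<lambda>n. l (\<Phi> n X) / complex_of_real (p n))"
  using Elim_spec by blast

lemma Elim_mem: "X \<in> M \<Longrightarrow> Elim M p \<Phi> L X \<in> M"
  using Elim_spec by blast

lemma Elim_extensional: "Elim M p \<Phi> L \<in> extensional M"
  by (simp add: Elim_def)

lemma Elim_BM: "Elim M p \<Phi> L \<in> BM M"
proof -
  let ?E = "Elim M p \<Phi> L"
  have add: "?E (A + B) = ?E A + ?E B" if A: "A \<in> M" and B: "B \<in> M" for A B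
  proof (rule predual_separates)
    fix l assume l: "l \<in> predual M"
    have "l (?E (A + B)) = seq_limit L (\<lambda>n. l (\<Phi> n A) / complex_of_real (p n) + l (\<Phi> n B) / complex_of_real (p n))"
      unfolding Elim_pairing[OF M_add[OF A B] l] seq_limit_def
      using A B l by (simp add: BM_add[OF dominated_BM] predual_add BM_mem[OF dominated_BM] add_divide_distrib)
    also have "\<dots> = l (?E A) + l (?E B)"
      unfolding seq_limit_def Elim_pairing[OF A l] Elim_pairing[OF B l]
      using banach_limit_add[OF L dominated_Bseq[OF l A] dominated_Bseq[OF l B]] by simp
    finally show "l (?E (A + B)) = l (?E A + ?E B)" using predual_add[OF l] Elim_mem A B by simp
  qed (use A B M_add Elim_mem in auto)
  have scale: "?E (c \<cdot>\<^sub>C A) = c \<cdot>\<^sub>C ?E A" if A: "A \<in> M" for A c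
  proof (rule predual_separates)
    fix l assume l: "l \<in> predual M"
    have "l (?E (c \<cdot>\<^sub>C A)) = seq_limit L (\<lambda>n. c * (l (\<Phi> n A) / complex_of_real (p n)))"
      unfolding Elim_pairing[OF M_scale[OF A] l] seq_limit_def
      using A l by (simp add: BM_scaleC[OF dominated_BM] predual_scale BM_mem[OF dominated_BM])
    also have "\<dots> = c * l (?E A)"
      unfolding seq_limit_def Elim_pairing[OF A l]
      using banach_limit_mult[OF L dominated_Bseq[OF l A]] by simp
    finally show "l (?E (c \<cdot>\<^sub>C A)) = l (c \<cdot>\<^sub>C ?E A)" using predual_scale[OF l] Elim_mem A by simp
  qed (use A M_scale Elim_mem in auto)
  have "norm (?E A) \<le> 1 * norm A" if "A \<in> M" for A using Elim_spec[OF that] by simp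
  then show ?thesis
    unfolding BM_def using add scale Elim_mem Elim_extensional by blast
qed

end

end

end

section \<open>Gauges and the trace\<close>

text \<open>At every index the distance of \<open>c\<close> and \<open>c'\<close> is at most the sum
  of the two deviations, hence at most the sum of their window means. This makes
  \<open>gauge_const\<close> meaningful.\<close>

lemma gauge_limit_unique:
  assumes c: "gauge_limit p c" and c': "gauge_limit p c'"
  shows "c = c'"
proof -
  let ?r = "\<lambda>n. p (n + 1) / p n"
  have "almost_convergent_to (\<lambda>n. norm (?r n - c)) 0" "almost_convergent_to (\<lambda>n. norm (?r n - c')) 0"
    using c c' unfolding gauge_limit_def strongly_almost_convergent_to_def by blast+
  note ac = this
  obtain a where a: "a \<longlonglongrightarrow> (0::real)"
    and le: "\<And>n k. k \<ge> 1 \<Longrightarrow> norm ((\<Sum>i=k..k+n. norm (?r i - c)) / of_nat (n + 1) - 0) \<le> a n"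
    using almost_convergent_to_D[OF ac(1)] by blast
  obtain a' where a': "a' \<longlonglongrightarrow> (0::real)"
    and le': "\<And>n k. k \<ge> 1 \<Longrightarrow> norm ((\<Sum>i=k..k+n. norm (?r i - c')) / of_nat (n + 1) - 0) \<le> a' n"
    using almost_convergent_to_D[OF ac(2)] by blast
  have "\<bar>c - c'\<bar> \<le> a n + a' n" for n
  proof -
    have "real (n + 1) * \<bar>c - c'\<bar> = (\<Sum>i=1..1+n. \<bar>c - c'\<bar>)" by simp
    also have "\<dots> \<le> (\<Sum>i=1..1+n. norm (?r i - c) + norm (?r i - c'))" by (rule sum_mono) simp
    also have "\<dots> = (\<Sum>i=1..1+n. norm (?r i - c)) + (\<Sum>i=1..1+n. norm (?r i - c'))" by (rule sum.distrib)
    finally have "\<bar>c - c'\<bar> \<le> (\<Sum>i=1..1+n. norm (?r i - c)) / of_nat (n + 1) + (\<Sum>i=1..1+n. norm (?r i - c')) / of_nat (n + 1)"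
      unfolding add_divide_distrib[symmetric] by (simp add: pos_le_divide_eq mult.commute del: real_norm_def)
    then show ?thesis using le[of 1 n] le'[of 1 n] unfolding diff_zero real_norm_def by linarith
  qed
  then have "\<bar>c - c'\<bar> \<le> 0" by (intro LIMSEQ_le_const[OF tendsto_add_zero[OF a a']]) auto
  then show ?thesis by simp
qed

lemma gauge_limit_gauge_const: "growth_gauge p \<Longrightarrow> gauge_limit p (gauge_const p)"
  unfolding growth_gauge_def gauge_const_def by (rule theI') (blast intro: gauge_limit_unique)

lemma almost_convergent_to_of_real:
  assumes "almost_convergent_to u c"
  shows "almost_convergent_to (\<lambda>n. complex_of_real (u n)) (complex_of_real c)"
proof -
  have eq: "(\<Sum>i=k..k+n. complex_of_real (u i)) / of_nat (n + 1) - of_real c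
      = of_real ((\<Sum>i=k..k+n. u i) / of_nat (n + 1) - c)" for k n by simp
  show ?thesis
    using assms unfolding almost_convergent_to_def eq norm_of_real real_norm_def
    by (simp add: bounded_iff)
qed

lemma seq_limit_cong: "(\<And>n. n \<ge> 1 \<Longrightarrow> u n = v n) \<Longrightarrow> seq_limit L u = seq_limit L v"
  by (simp add: seq_limit_def)

text \<open>The ratio deviates from the gauge constant by a sequence strongly almost convergent to
  0. Its product with the bounded \<open>v\<close> is almost convergent to 0, so \<open>L\<close>
  vanishes on it; linearity and shift invariance do the rest.\<close>

lemma seq_limit_gauge_ratio:
  assumes L: "banach_limit L" and p: "growth_gauge p" and v: "Bseq (\<lambda>n. v (Suc n))"
  shows "seq_limit L (\<lambda>n. complex_of_real (p (n + 1) / p n) * v (Suc n)) = of_real (gauge_const p) * seq_limit L v"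
proof -
  let ?c = "gauge_const p" and ?r = "\<lambda>n. p (n + 1) / p n"
  have "gauge_limit p ?c" using p by (rule gauge_limit_gauge_const)
  then have r: "almost_convergent_to (\<lambda>n. norm (?r n - ?c)) 0"
    by (simp add: gauge_limit_def strongly_almost_convergent_to_def)
  have v': "Bseq (\<lambda>n. v (Suc (Suc n)))" using Bseq_ignore_initial_segment[OF v, of 1] by simp
  have "norm (complex_of_real (?r n - ?c)) = norm (?r n - ?c)" for n by (simp only: norm_of_real real_norm_def)
  with r have "almost_convergent_to (\<lambda>n. norm (complex_of_real (?r n - ?c))) 0" by simp
  then have ac: "almost_convergent_to (\<lambda>n. complex_of_real (?r n - ?c) * v (Suc n)) 0"
    by (rule strongly_almost_convergent_mult) (simp only: Bseq_bounded_from_1 v')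
  then have B: "Bseq (\<lambda>n. complex_of_real (?r (Suc n) - ?c) * v (Suc (Suc n)))"
    by (simp only: almost_convergent_to_def Bseq_bounded_from_1)
  have B': "Bseq (\<lambda>n. complex_of_real ?c * v (Suc (Suc n)))" by (intro Bseq_mult Bfun_const v')
  have "seq_limit L (\<lambda>n. complex_of_real (?r n) * v (Suc n))
      = seq_limit L (\<lambda>n. complex_of_real (?r n - ?c) * v (Suc n) + complex_of_real ?c * v (Suc n))"
    by (rule seq_limit_cong) (simp add: algebra_simps)
  also have "\<dots> = seq_limit L (\<lambda>n. complex_of_real (?r n - ?c) * v (Suc n)) + seq_limit L (\<lambda>n. complex_of_real ?c * v (Suc n))"
    unfolding seq_limit_def using banach_limit_add[OF L B B'] by simp
  also have "seq_limit L (\<lambda>n. complex_of_real (?r n - ?c) * v (Suc n)) = 0"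
    by (rule seq_limit_almost_convergent[OF L ac])
  also have "seq_limit L (\<lambda>n. complex_of_real ?c * v (Suc n)) = complex_of_real ?c * seq_limit L (\<lambda>n. v (Suc n))"
    unfolding seq_limit_def using banach_limit_mult[OF L v'] by simp
  also have "seq_limit L (\<lambda>n. v (Suc n)) = seq_limit L v" by (rule seq_limit_shift[OF L v])
  finally show ?thesis by simp
qed

lemma BM_power_apply: "X \<in> M \<Longrightarrow> BM_power M \<psi> n X = (\<psi> ^^ n) X"
  by (simp add: BM_power_def)

section \<open>The trace form\<close>

locale traced_von_neumann = von_neumann M for M :: "('h::complex_hilbert \<Rightarrow>\<^sub>L 'h) set" +
  fixes \<tau> :: "('h \<Rightarrow>\<^sub>L 'h) \<Rightarrow> complex"
  assumes trace: "faithful_normal_trace M \<tau>"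
begin

lemma trace_predual: "\<tau> \<in> predual M"
  and trace_commute: "A \<in> M \<Longrightarrow> B \<in> M \<Longrightarrow> \<tau> (A o\<^sub>L B) = \<tau> (B o\<^sub>L A)"
  and trace_positive: "A \<in> M \<Longrightarrow> positive_op A \<Longrightarrow> \<tau> A \<in> \<real>\<^sub>\<ge>\<^sub>0"
  and trace_faithful: "A \<in> M \<Longrightarrow> positive_op A \<Longrightarrow> \<tau> A = 0 \<Longrightarrow> A = 0"
  using trace by (simp_all add: faithful_normal_trace_def)

lemma predual_nonempty: "predual M \<noteq> {}"
  using trace_predual by blast

lemma Psi_apply: "Y \<in> M \<Longrightarrow> Psi M \<tau> X Y = \<tau> (X o\<^sub>L Y)"
  by (simp add: Psi_def)

lemmas Psi_predual = Psi_in_predual[OF trace_predual]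

text \<open>Testing with the adjoint of \<open>A\<close> gives a positive operator whose trace is at
  most 0, hence 0 by faithfulness. The hypothesis is one-sided because separation delivers only
  upper bounds for real parts.\<close>

lemma trace_form_nondegenerate:
  assumes A: "A \<in> M" and le: "\<And>X. X \<in> M \<Longrightarrow> Re (\<tau> (X o\<^sub>L A)) \<le> 0"
  shows "A = 0"
proof -
  obtain B where B: "B \<in> M" "is_adjoint A B" using M_adjoint[OF A] by blast
  have sq: "cinner (blinfun_apply (B o\<^sub>L A) x) x = complex_of_real ((norm (blinfun_apply A x))\<^sup>2)" for x
    using is_adjoint_sym[OF B(2)] by (simp add: is_adjoint_def cinner_self)
  have pos: "positive_op (B o\<^sub>L A)"
    unfolding positive_op_def sq by simp
  have BA: "B o\<^sub>L A \<in> M" using B A M_comp by blast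
  have "\<tau> (B o\<^sub>L A) = 0"
    using trace_positive[OF BA pos] le[OF B(1)] by (auto simp: complex_eq_iff complex_nonneg_Reals_iff)
  then have "B o\<^sub>L A = 0" by (rule trace_faithful[OF BA pos])
  then have "norm (blinfun_apply A x) = 0" for x using sq[of x] by simp
  then show ?thesis by (intro blinfun_eqI) simp
qed

lemma Psi_inj: "inj_on (Psi M \<tau>) M"
proof (rule inj_onI)
  fix X Y assume X: "X \<in> M" and Y: "Y \<in> M" and eq: "Psi M \<tau> X = Psi M \<tau> Y"
  have "\<tau> (Z o\<^sub>L (X - Y)) = 0" if Z: "Z \<in> M" for Z
  proof -
    have "\<tau> (X o\<^sub>L Z) = \<tau> (Y o\<^sub>L Z)" using eq Z by (metis Psi_apply)
    moreover have "Z o\<^sub>L (X - Y) = (Z o\<^sub>L X) - (Z o\<^sub>L Y)"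
      by (rule bounded_bilinear.diff_right[OF bounded_bilinear_blinfun_compose])
    ultimately show ?thesis
      using X Y Z by (simp add: predual_diff[OF trace_predual] M_comp trace_commute[OF Z])
  qed
  then have "X - Y = 0" by (intro trace_form_nondegenerate M_diff X Y) simp
  then show "X = Y" by simp
qed

text \<open>An element of \<open>M\<close> separating a vector functional from \<open>Mhat M \<tau>\<close> would be orthogonal to \<open>M\<close>
  for the trace form.\<close>

lemma Psi_dense_vec_sum:
  assumes e: "e > 0"
  shows "\<exists>X\<in>M. \<forall>A\<in>M. cmod (blinfun_apply (vec_sum zs) A - \<tau> (X o\<^sub>L A)) \<le> e * norm A"
proof (rule ccontr)
  assume neg: "\<not> ?thesis"
  \<comment> \<open>The infimum of \<open>t\<close> over \<open>f\<close> is the distance, in the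
    norm on \<open>M\<close>, from \<open>f\<close> to the functionals that elements of
    \<open>M\<close> induce through the trace.\<close>
  define R where "R = {(f, t). t \<ge> 0 \<and> (\<exists>X\<in>M. \<forall>A\<in>M. cmod (blinfun_apply f A - \<tau> (X o\<^sub>L A)) \<le> t * norm A)}"
  have RI: "(f, t) \<in> R" if "t \<ge> 0" "X \<in> M"
      "\<And>A. A \<in> M \<Longrightarrow> cmod (blinfun_apply f A - \<tau> (X o\<^sub>L A)) \<le> t * norm A" for f t X
    unfolding R_def using that by blast
  have RE: "t \<ge> 0 \<and> (\<exists>X\<in>M. \<forall>A\<in>M. cmod (blinfun_apply f A - \<tau> (X o\<^sub>L A)) \<le> t * norm A)" if "(f, t) \<in> R" for f t
    using that unfolding R_def by blast
  have \<tau>0: "\<tau> 0 = 0" using predual_scale[OF trace_predual M_zero, of 0] by (simp add: op_scale_simps)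
  have zero_comp: "0 o\<^sub>L A = 0" for A :: "'h \<Rightarrow>\<^sub>L 'h" by (rule blinfun_eqI) simp
  have dom: "(f, 1 * c) \<in> R" if "c \<ge> 0" "\<And>A. A \<in> M \<Longrightarrow> cmod (blinfun_apply f A) \<le> c * norm A" for f c
    by (rule RI[OF _ M_zero]) (use that in \<open>simp_all add: zero_comp \<tau>0\<close>)
  have R: "epi_cone R"
    unfolding epi_cone_def
  proof (intro conjI allI impI)
    show "(0, 0) \<in> R" using dom[of 0 0] by simp
  next
    fix f s g t assume "(f, s) \<in> R \<and> (g, t) \<in> R"
    then obtain X Y where 1: "s \<ge> 0" "X \<in> M" "\<And>A. A \<in> M \<Longrightarrow> cmod (blinfun_apply f A - \<tau> (X o\<^sub>L A)) \<le> s * norm A"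
      and 2: "t \<ge> 0" "Y \<in> M" "\<And>A. A \<in> M \<Longrightarrow> cmod (blinfun_apply g A - \<tau> (Y o\<^sub>L A)) \<le> t * norm A"
      by (meson RE)
    show "(f + g, s + t) \<in> R"
    proof (rule RI[OF _ M_add[OF 1(2) 2(2)]])
      fix A assume A: "A \<in> M"
      have "\<tau> ((X + Y) o\<^sub>L A) = \<tau> (X o\<^sub>L A) + \<tau> (Y o\<^sub>L A)"
        using A 1 2 by (simp add: bounded_bilinear.add_left[OF bounded_bilinear_blinfun_compose]
            predual_add[OF trace_predual] M_comp)
      then show "cmod (blinfun_apply (f + g) A - \<tau> ((X + Y) o\<^sub>L A)) \<le> (s + t) * norm A"
        using norm_triangle_ineq[of "blinfun_apply f A - \<tau> (X o\<^sub>L A)" "blinfun_apply g A - \<tau> (Y o\<^sub>L A)"]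
          1(3)[OF A] 2(3)[OF A] by (simp add: blinfun.add_left algebra_simps)
    qed (use 1 2 in simp)
  next
    fix f s and c :: real assume "(f, s) \<in> R \<and> c > 0"
    then obtain X where 1: "s \<ge> 0" "X \<in> M" "c > 0" "\<And>A. A \<in> M \<Longrightarrow> cmod (blinfun_apply f A - \<tau> (X o\<^sub>L A)) \<le> s * norm A"
      by (meson RE)
    show "(c *\<^sub>R f, c * s) \<in> R"
    proof (rule RI[OF _ M_scale[OF 1(2), of "complex_of_real c"]])
      fix A assume A: "A \<in> M"
      have "\<tau> ((complex_of_real c \<cdot>\<^sub>C X) o\<^sub>L A) = complex_of_real c * \<tau> (X o\<^sub>L A)"
        unfolding predual_scale[OF trace_predual M_comp[OF 1(2) A], symmetric] op_scale_simps
        by (simp add: bounded_bilinear.scaleR_left[OF bounded_bilinear_blinfun_compose])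
      then have "blinfun_apply (c *\<^sub>R f) A - \<tau> ((complex_of_real c \<cdot>\<^sub>C X) o\<^sub>L A) = complex_of_real c * (blinfun_apply f A - \<tau> (X o\<^sub>L A))"
        by (simp add: blinfun.scaleR_left scaleR_conv_of_real right_diff_distrib)
      then show "cmod (blinfun_apply (c *\<^sub>R f) A - \<tau> ((complex_of_real c \<cdot>\<^sub>C X) o\<^sub>L A)) \<le> c * s * norm A"
        using mult_left_mono[OF 1(4)[OF A], of c] 1(3) by (simp add: norm_mult mult.assoc)
    qed (use 1 in simp)
  next
    fix t assume "(0, t) \<in> R"
    then show "t \<ge> 0" using RE by blast
  qed
  have ge: "e \<le> t" if zsR: "(vec_sum zs, t) \<in> R" for t
  proof (rule ccontr)
    assume "\<not> e \<le> t"
    then have te: "t \<le> e" by simp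
    obtain X where X: "X \<in> M" "\<And>A. A \<in> M \<Longrightarrow> cmod (blinfun_apply (vec_sum zs) A - \<tau> (X o\<^sub>L A)) \<le> t * norm A"
      using RE[OF zsR] by blast
    have "cmod (blinfun_apply (vec_sum zs) A - \<tau> (X o\<^sub>L A)) \<le> e * norm A" if "A \<in> M" for A
      using X(2)[OF that] mult_right_mono[OF te norm_ge_zero[of A]] by linarith
    then show False using neg X(1) by blast
  qed
  obtain B where B: "B \<in> M" "\<And>ws t. (vec_sum ws, t) \<in> R \<Longrightarrow> Re (blinfun_apply (vec_sum ws) B) \<le> t"
    "Re (blinfun_apply (vec_sum zs) B) \<ge> e"
    using separation_from_cone[OF R zero_le_one dom ge] by metis
  have "B = 0"
  proof (rule trace_form_nondegenerate[OF B(1)])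
    fix X assume X: "X \<in> M"
    have "Re (\<tau> (X o\<^sub>L B)) \<le> 0 + d" if d: "d > 0" for d
    proof -
      \<comment> \<open>The functional of \<open>X\<close> need not be a vector sum, so one within
        \<open>d'\<close> of it is used; \<open>X\<close> then witnesses that this sum lies at
        height \<open>d'\<close> in \<open>R\<close>. The two errors \<open>d'\<close> and
        \<open>d' * norm B\<close> add up to \<open>d\<close>.\<close>
      define d' where "d' = d / (1 + norm B)"
      have nB: "1 + norm B > 0" by (simp add: add_pos_nonneg)
      have d': "d' > 0" using d nB by (simp add: d'_def)
      obtain ws where ws: "\<And>A. A \<in> M \<Longrightarrow> cmod (Psi M \<tau> X A - blinfun_apply (vec_sum ws) A) \<le> d' * norm A"
        using predual_vec_approximable[OF Psi_predual[OF X]] d' unfolding vec_approximable_def by meson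
      have "(vec_sum ws, d') \<in> R"
        by (rule RI[OF _ X]) (use ws d' in \<open>simp_all add: Psi_apply norm_minus_commute\<close>)
      then have "Re (blinfun_apply (vec_sum ws) B) \<le> d'" by (rule B(2))
      moreover have "Re (\<tau> (X o\<^sub>L B) - blinfun_apply (vec_sum ws) B) \<le> d' * norm B"
        using ws[OF B(1)] complex_Re_le_cmod order_trans unfolding Psi_apply[OF B(1)] by blast
      moreover have "d' * (1 + norm B) = d" using nB by (simp add: d'_def)
      then have "d' + d' * norm B = d" by (simp add: distrib_left)
      ultimately show ?thesis by simp
    qed
    then show "Re (\<tau> (X o\<^sub>L B)) \<le> 0" by (rule field_le_epsilon)
  qed
  then show False using B(3) e by (simp add: blinfun.zero_right)
qed

lemma Psi_dense:
  assumes l: "l \<in> predual M" and e: "e > 0"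
  shows "\<exists>X\<in>M. \<forall>A\<in>M. cmod (l A - \<tau> (X o\<^sub>L A)) \<le> e * norm A"
proof -
  obtain zs where zs: "\<And>A. A \<in> M \<Longrightarrow> cmod (l A - blinfun_apply (vec_sum zs) A) \<le> e / 2 * norm A"
    using predual_vec_approximable[OF l] e unfolding vec_approximable_def by (meson half_gt_zero)
  obtain X where X: "X \<in> M" "\<And>A. A \<in> M \<Longrightarrow> cmod (blinfun_apply (vec_sum zs) A - \<tau> (X o\<^sub>L A)) \<le> e / 2 * norm A"
    using Psi_dense_vec_sum[OF half_gt_zero[OF e]] by blast
  have "cmod (l A - \<tau> (X o\<^sub>L A)) \<le> e * norm A" if "A \<in> M" for A
    using norm_triangle_ineq[of "l A - blinfun_apply (vec_sum zs) A" "blinfun_apply (vec_sum zs) A - \<tau> (X o\<^sub>L A)"]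
      zs[OF that] X(2)[OF that] by simp
  then show ?thesis using X(1) by blast
qed

section \<open>Operators with an adjoint for the trace form\<close>

lemma Bhat_BwM: "\<phi> \<in> Bhat M \<tau> \<Longrightarrow> \<phi> \<in> BwM M"
  and Bhat_BM: "\<phi> \<in> Bhat M \<tau> \<Longrightarrow> \<phi> \<in> BM M"
  by (simp_all add: Bhat_def BwM_def)

lemma hat_spec:
  assumes \<phi>: "\<phi> \<in> Bhat M \<tau>" and X: "X \<in> M"
  shows "hat M \<tau> \<phi> X \<in> M" "Y \<in> M \<Longrightarrow> \<tau> (hat M \<tau> \<phi> X o\<^sub>L Y) = \<tau> (X o\<^sub>L \<phi> Y)"
proof -
  have "preadjoint M \<phi> (Psi M \<tau> X) \<in> Psi M \<tau> ` M"
    using \<phi> X by (auto simp: Bhat_def Mhat_def)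
  then have *: "hat M \<tau> \<phi> X \<in> M" "Psi M \<tau> (hat M \<tau> \<phi> X) = preadjoint M \<phi> (Psi M \<tau> X)"
    using X by (simp_all add: hat_def inv_into_into f_inv_into_f)
  then show "hat M \<tau> \<phi> X \<in> M" by blast
  show "\<tau> (hat M \<tau> \<phi> X o\<^sub>L Y) = \<tau> (X o\<^sub>L \<phi> Y)" if Y: "Y \<in> M"
    using fun_cong[OF *(2), of Y] Y BM_mem[OF Bhat_BM[OF \<phi>] Y] by (simp add: preadjoint_def Psi_apply)
qed

text \<open>A trace adjoint makes a bounded operator weak*-continuous: its transpose maps the dense set
  \<open>Mhat M \<tau>\<close> into the predual, and the predual is norm closed.\<close>

lemma BhatI:
  assumes \<phi>: "\<phi> \<in> BM M" and \<psi>: "\<And>X. X \<in> M \<Longrightarrow> \<psi> X \<in> M"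
    and adj: "\<And>X Y. X \<in> M \<Longrightarrow> Y \<in> M \<Longrightarrow> \<tau> (X o\<^sub>L \<phi> Y) = \<tau> (\<psi> X o\<^sub>L Y)"
  shows "\<phi> \<in> Bhat M \<tau>" "\<psi> \<in> extensional M \<Longrightarrow> hat M \<tau> \<phi> = \<psi>"
proof -
  have pre: "preadjoint M \<phi> (Psi M \<tau> X) = Psi M \<tau> (\<psi> X)" if "X \<in> M" for X
    unfolding preadjoint_def Psi_def using that adj BM_mem[OF \<phi>] by (intro ext) (simp add: restrict_def)
  have "preadjoint M \<phi> l \<in> predual M" if l: "l \<in> predual M" for l
    unfolding predual_iff
  proof (intro conjI)
    show "preadjoint M \<phi> l \<in> extensional M" by (simp add: preadjoint_def)
    show "clinear_on M (preadjoint M \<phi> l)"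
      unfolding clinear_on_def preadjoint_def
      using l by (simp add: M_add M_scale BM_add[OF \<phi>] BM_scaleC[OF \<phi>] BM_mem[OF \<phi>] predual_add predual_scale)
    obtain K where K: "K > 0" "\<And>A. A \<in> M \<Longrightarrow> norm (\<phi> A) \<le> K * norm A" using BM_bounded[OF \<phi>] by blast
    show "vec_approximable M (preadjoint M \<phi> l)"
    proof (rule vec_approximable_limit)
      fix e :: real assume e: "e > 0"
      then obtain X where X: "X \<in> M" "\<And>A. A \<in> M \<Longrightarrow> cmod (l A - \<tau> (X o\<^sub>L A)) \<le> e / K * norm A"
        using Psi_dense[OF l, of "e / K"] K(1) by auto
      have "cmod (preadjoint M \<phi> l A - Psi M \<tau> (\<psi> X) A) \<le> e * norm A" if A: "A \<in> M" for A
      proof -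
        have "cmod (preadjoint M \<phi> l A - Psi M \<tau> (\<psi> X) A) = cmod (l (\<phi> A) - \<tau> (X o\<^sub>L \<phi> A))"
          using A adj[OF X(1) A] by (simp add: preadjoint_def Psi_apply)
        also have "\<dots> \<le> e / K * norm (\<phi> A)" by (rule X(2)[OF BM_mem[OF \<phi> A]])
        also have "\<dots> \<le> e / K * (K * norm A)" using e K by (intro mult_left_mono K(2)[OF A]) simp
        also have "\<dots> = e * norm A" using K(1) by simp
        finally show ?thesis .
      qed
      then show "\<exists>g. vec_approximable M g \<and> (\<forall>A\<in>M. cmod (preadjoint M \<phi> l A - g A) \<le> e * norm A)"
        using predual_vec_approximable[OF Psi_predual[OF \<psi>[OF X(1)]]] by blast
    qed
  qed
  then have "\<phi> \<in> BwM M" using \<phi> BwM_iff[OF predual_nonempty] by blast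
  then show "\<phi> \<in> Bhat M \<tau>" using pre \<psi> by (auto simp: Bhat_def Mhat_def)
  show "hat M \<tau> \<phi> = \<psi>" if "\<psi> \<in> extensional M"
  proof (rule extensionalityI[OF _ that])
    show "hat M \<tau> \<phi> \<in> extensional M" by (simp add: hat_def)
    show "hat M \<tau> \<phi> X = \<psi> X" if "X \<in> M" for X
      using that pre \<psi> inv_into_f_f[OF Psi_inj] by (simp add: hat_def)
  qed
qed

text \<open>The two sides of the adjoint relation are Banach limits of the same sequence.
  Commutation under the trace is what makes the second side a pairing too: the limit operator must
  stand in the argument of a fixed predual element, here \<open>Psi M \<tau> Y\<close>.\<close>

lemma Elim_Bhat:
  assumes p: "\<And>n. n \<ge> 1 \<Longrightarrow> p n > 0" and \<Phi>: "\<And>n. n \<ge> 1 \<Longrightarrow> \<Phi> n \<in> Bhat M \<tau>"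
    and dom: "dominated M p \<Phi>" and dom': "dominated M p (\<lambda>n. hat M \<tau> (\<Phi> n))" and L: "banach_limit L"
  shows "Elim M p \<Phi> L \<in> Bhat M \<tau>" "hat M \<tau> (Elim M p \<Phi> L) = Elim M p (\<lambda>n. hat M \<tau> (\<Phi> n)) L"
proof -
  let ?E = "Elim M p \<Phi> L" and ?E' = "Elim M p (\<lambda>n. hat M \<tau> (\<Phi> n)) L"
  have adj: "\<tau> (X o\<^sub>L ?E Y) = \<tau> (?E' X o\<^sub>L Y)" if X: "X \<in> M" and Y: "Y \<in> M" for X Y
  proof -
    have E: "?E Y \<in> M" "?E' X \<in> M"
      using Elim_mem[OF p dom L Y] Elim_mem[OF p dom' L X] by simp_all
    have "\<tau> (X o\<^sub>L ?E Y) = Psi M \<tau> X (?E Y)" using E by (simp add: Psi_apply)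
    also have "\<dots> = seq_limit L (\<lambda>n. Psi M \<tau> X (\<Phi> n Y) / complex_of_real (p n))"
      by (rule Elim_pairing[OF p dom L Y Psi_predual[OF X]])
    also have "\<dots> = seq_limit L (\<lambda>n. Psi M \<tau> Y (hat M \<tau> (\<Phi> n) X) / complex_of_real (p n))"
    proof (rule seq_limit_cong)
      fix n :: nat assume n: "n \<ge> 1"
      have "Psi M \<tau> X (\<Phi> n Y) = \<tau> (hat M \<tau> (\<Phi> n) X o\<^sub>L Y)"
        using hat_spec(2)[OF \<Phi>[OF n] X Y] BM_mem[OF Bhat_BM[OF \<Phi>[OF n]] Y] by (simp add: Psi_apply)
      also have "\<dots> = Psi M \<tau> Y (hat M \<tau> (\<Phi> n) X)"
        using hat_spec(1)[OF \<Phi>[OF n] X] Y trace_commute by (simp add: Psi_apply)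
      finally show "Psi M \<tau> X (\<Phi> n Y) / complex_of_real (p n) = Psi M \<tau> Y (hat M \<tau> (\<Phi> n) X) / complex_of_real (p n)"
        by simp
    qed
    also have "\<dots> = Psi M \<tau> Y (?E' X)"
      by (rule Elim_pairing[OF p dom' L X Psi_predual[OF Y], symmetric])
    also have "\<dots> = \<tau> (?E' X o\<^sub>L Y)" using E Y trace_commute by (simp add: Psi_apply)
    finally show ?thesis .
  qed
  note * = BhatI[OF Elim_BM[OF p dom L] Elim_mem[OF p dom' L] adj]
  show "?E \<in> Bhat M \<tau>" by (rule *(1))
  show "hat M \<tau> ?E = ?E'" by (rule *(2)) (simp_all add: Elim_def extensional_def)
qed

text \<open>The preadjoint of \<open>T\<close> keeps \<open>l\<close> in the predual, which is what
  lets \<open>T\<close> pass inside the Banach limit.\<close>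

lemma BwM_Elim:
  assumes p: "\<And>n. n \<ge> 1 \<Longrightarrow> p n > 0" and dom: "dominated M p \<Phi>" and L: "banach_limit L"
    and T: "T \<in> BwM M" and X: "X \<in> M" and l: "l \<in> predual M"
  shows "l (T (Elim M p \<Phi> L X)) = seq_limit L (\<lambda>n. l (T (\<Phi> n X)) / complex_of_real (p n))"
proof -
  have pre: "preadjoint M T l \<in> predual M" using T l BwM_iff[OF predual_nonempty] by blast
  have "l (T (Elim M p \<Phi> L X)) = preadjoint M T l (Elim M p \<Phi> L X)"
    using Elim_mem[OF p dom L X] by (simp add: preadjoint_def)
  also have "\<dots> = seq_limit L (\<lambda>n. preadjoint M T l (\<Phi> n X) / complex_of_real (p n))"
    by (rule Elim_pairing[OF p dom L X pre])
  also have "\<dots> = seq_limit L (\<lambda>n. l (T (\<Phi> n X)) / complex_of_real (p n))"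
    using BM_mem[OF dominated_BM[OF p dom] X] by (intro seq_limit_cong) (simp add: preadjoint_def)
  finally show ?thesis .
qed

lemma BwM_Elim_commute:
  assumes p: "\<And>n. n \<ge> 1 \<Longrightarrow> p n > 0" and dom: "dominated M p \<Phi>" and L: "banach_limit L"
    and T: "T \<in> BwM M" and comm: "\<And>n X. n \<ge> 1 \<Longrightarrow> X \<in> M \<Longrightarrow> T (\<Phi> n X) = \<Phi> n (T X)" and X: "X \<in> M"
  shows "T (Elim M p \<Phi> L X) = Elim M p \<Phi> L (T X)"
proof (rule predual_separates)
  have T': "T \<in> BM M" using T by (simp add: BwM_def)
  show "T (Elim M p \<Phi> L X) \<in> M" "Elim M p \<Phi> L (T X) \<in> M"
    using BM_mem[OF T'] Elim_mem[OF p dom L] X by blast+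
  fix l assume l: "l \<in> predual M"
  have "l (T (Elim M p \<Phi> L X)) = seq_limit L (\<lambda>n. l (T (\<Phi> n X)) / complex_of_real (p n))"
    by (rule BwM_Elim[OF p dom L T X l])
  also have "\<dots> = seq_limit L (\<lambda>n. l (\<Phi> n (T X)) / complex_of_real (p n))"
    using comm X by (intro seq_limit_cong) simp
  also have "\<dots> = l (Elim M p \<Phi> L (T X))"
    by (rule Elim_pairing[OF p dom L BM_mem[OF T' X] l, symmetric])
  finally show "l (T (Elim M p \<Phi> L X)) = l (Elim M p \<Phi> L (T X))" .
qed

text \<open>Each member of the sequence is weak*-continuous and so commutes with the operator of
  \<open>L1\<close>. That this operator may then itself act as the weak*-continuous one depends on
  the dominated trace adjoints.\<close>

lemma Elim_commute:
  assumes p: "\<And>n. n \<ge> 1 \<Longrightarrow> p n > 0" and \<Phi>: "\<And>n. n \<ge> 1 \<Longrightarrow> \<Phi> n \<in> Bhat M \<tau>"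
    and dom: "dominated M p \<Phi>" and dom': "dominated M p (\<lambda>n. hat M \<tau> (\<Phi> n))"
    and comm: "\<And>m n X. m \<ge> 1 \<Longrightarrow> n \<ge> 1 \<Longrightarrow> X \<in> M \<Longrightarrow> \<Phi> n (\<Phi> m X) = \<Phi> m (\<Phi> n X)"
    and L: "banach_limit L1" "banach_limit L2" and X: "X \<in> M"
  shows "Elim M p \<Phi> L1 (Elim M p \<Phi> L2 X) = Elim M p \<Phi> L2 (Elim M p \<Phi> L1 X)"
proof (rule BwM_Elim_commute[OF p dom L(2) _ _ X])
  show "Elim M p \<Phi> L1 \<in> BwM M" by (rule Bhat_BwM[OF Elim_Bhat(1)[OF p \<Phi> dom dom' L(1)]])
  fix n :: nat and X assume n: "n \<ge> 1" and X: "X \<in> M"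
  show "Elim M p \<Phi> L1 (\<Phi> n X) = \<Phi> n (Elim M p \<Phi> L1 X)"
  proof (rule sym, rule BwM_Elim_commute[OF p dom L(1) Bhat_BwM[OF \<Phi>[OF n]] _ X])
    fix m :: nat and X assume "m \<ge> 1" "X \<in> M"
    then show "\<Phi> n (\<Phi> m X) = \<Phi> m (\<Phi> n X)" using n by (intro comm)
  qed
qed

section \<open>Powers of a single operator\<close>

lemma power_mem: "\<psi> \<in> BM M \<Longrightarrow> X \<in> M \<Longrightarrow> (\<psi> ^^ n) X \<in> M"
  by (induction n) (simp_all add: BM_mem)

lemma BM_power_BM:
  assumes \<psi>: "\<psi> \<in> BM M"
  shows "BM_power M \<psi> n \<in> BM M"
proof -
  obtain K where K: "K > 0" "\<And>A. A \<in> M \<Longrightarrow> norm (\<psi> A) \<le> K * norm A" using BM_bounded[OF \<psi>] by blast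
  have "norm ((\<psi> ^^ n) A) \<le> K ^ n * norm A" if A: "A \<in> M" for A
  proof (induction n)
    case (Suc n)
    have "norm ((\<psi> ^^ Suc n) A) \<le> K * norm ((\<psi> ^^ n) A)" using K(2)[OF power_mem[OF \<psi> A]] by simp
    also have "\<dots> \<le> K * (K ^ n * norm A)" using Suc K(1) by (intro mult_left_mono) auto
    finally show ?case by (simp add: mult.assoc)
  qed simp
  moreover have "(\<psi> ^^ n) (A + B) = (\<psi> ^^ n) A + (\<psi> ^^ n) B" if "A \<in> M" "B \<in> M" for A B
    by (induction n) (simp_all add: BM_add[OF \<psi>] power_mem[OF \<psi>] that)
  moreover have "(\<psi> ^^ n) (c \<cdot>\<^sub>C A) = c \<cdot>\<^sub>C (\<psi> ^^ n) A" if "A \<in> M" for A c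
    by (induction n) (simp_all add: BM_scaleC[OF \<psi>] power_mem[OF \<psi>] that)
  ultimately show ?thesis
    unfolding BM_def BM_power_def by (auto simp: M_add M_scale power_mem[OF \<psi>])
qed

text \<open>One factor is peeled off next to \<open>Y\<close> and reappears as the outermost factor
  on the side of \<open>X\<close>, hence the induction with \<open>Y\<close> arbitrary.\<close>

lemma hat_power:
  assumes \<psi>: "\<psi> \<in> Bhat M \<tau>"
  shows "BM_power M \<psi> n \<in> Bhat M \<tau>" "hat M \<tau> (BM_power M \<psi> n) = BM_power M (hat M \<tau> \<psi>) n"
proof -
  have mem: "(hat M \<tau> \<psi> ^^ n) X \<in> M" if "X \<in> M" for X n
    by (induction n) (simp_all add: hat_spec[OF \<psi>] that)
  have "\<tau> (X o\<^sub>L (\<psi> ^^ n) Y) = \<tau> ((hat M \<tau> \<psi> ^^ n) X o\<^sub>L Y)" if "X \<in> M" "Y \<in> M" for X Y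
    using that
  proof (induction n arbitrary: Y)
    case (Suc n)
    have "\<tau> (X o\<^sub>L (\<psi> ^^ Suc n) Y) = \<tau> (X o\<^sub>L (\<psi> ^^ n) (\<psi> Y))" by (simp add: funpow_swap1)
    also have "\<dots> = \<tau> ((hat M \<tau> \<psi> ^^ n) X o\<^sub>L \<psi> Y)"
      by (rule Suc.IH) (use Suc.prems BM_mem[OF Bhat_BM[OF \<psi>]] in auto)
    also have "\<dots> = \<tau> ((hat M \<tau> \<psi> ^^ Suc n) X o\<^sub>L Y)"
      using hat_spec(2)[OF \<psi> mem[OF Suc.prems(1)] Suc.prems(2)] by simp
    finally show ?case .
  qed simp
  then have adj: "\<tau> (X o\<^sub>L BM_power M \<psi> n Y) = \<tau> (BM_power M (hat M \<tau> \<psi>) n X o\<^sub>L Y)" if "X \<in> M" "Y \<in> M" for X Y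
    using that by (simp add: BM_power_apply)
  have mem': "BM_power M (hat M \<tau> \<psi>) n X \<in> M" if "X \<in> M" for X
    using mem that by (simp add: BM_power_apply)
  note * = BhatI[OF BM_power_BM[OF Bhat_BM[OF \<psi>]] mem' adj]
  show "BM_power M \<psi> n \<in> Bhat M \<tau>" by (rule *(1))
  show "hat M \<tau> (BM_power M \<psi> n) = BM_power M (hat M \<tau> \<psi>) n"
    by (rule *(2)) (simp_all add: BM_power_def extensional_def)
qed

context
  fixes p :: "nat \<Rightarrow> real" and \<psi> :: "('h \<Rightarrow>\<^sub>L 'h) \<Rightarrow> ('h \<Rightarrow>\<^sub>L 'h)"
  assumes gauge: "growth_gauge p" and \<psi>: "\<psi> \<in> Bhat M \<tau>"
    and dom: "dominated M p (BM_power M \<psi>)" and dom': "dominated M p (\<lambda>n. BM_power M (hat M \<tau> \<psi>) n)"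
begin

lemma gauge_pos: "n \<ge> 1 \<Longrightarrow> p n > 0"
  using gauge by (simp add: growth_gauge_def)

abbreviation "Epow \<equiv> Elim M p (BM_power M \<psi>)"

lemma Epow_mem: "banach_limit L \<Longrightarrow> X \<in> M \<Longrightarrow> Epow L X \<in> M"
  using Elim_mem[OF gauge_pos dom] by blast

lemma Epow_Bhat: "banach_limit L \<Longrightarrow> Epow L \<in> Bhat M \<tau>"
  by (rule Elim_Bhat(1)[OF gauge_pos hat_power(1)[OF \<psi>] dom]) (simp_all add: hat_power(2)[OF \<psi>] dom')

text \<open>The gauge condition replaces \<open>p (n + 1)\<close> by \<open>gauge_const p * p n\<close> under a Banach limit, so that
  the range of \<open>Epow L\<close> consists of eigenvectors.\<close>

lemma Epow_eigenvector:
  assumes L: "banach_limit L" and X: "X \<in> M"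
  shows "\<psi> (Epow L X) = complex_of_real (gauge_const p) \<cdot>\<^sub>C Epow L X"
proof (rule predual_separates)
  have \<psi>M: "\<psi> \<in> BM M" using \<psi> by (rule Bhat_BM)
  show "\<psi> (Epow L X) \<in> M" "complex_of_real (gauge_const p) \<cdot>\<^sub>C Epow L X \<in> M"
    using BM_mem[OF \<psi>M] M_scale Epow_mem[OF L X] by blast+
  fix l assume l: "l \<in> predual M"
  define v where "v n = l (BM_power M \<psi> n X) / complex_of_real (p n)" for n
  have v: "Bseq (\<lambda>n. v (Suc n))" unfolding v_def by (rule dominated_Bseq[OF gauge_pos dom l X])
  have "l (\<psi> (Epow L X)) = seq_limit L (\<lambda>n. l (\<psi> (BM_power M \<psi> n X)) / complex_of_real (p n))"
    by (rule BwM_Elim[OF gauge_pos dom L Bhat_BwM[OF \<psi>] X l])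
  also have "\<dots> = seq_limit L (\<lambda>n. complex_of_real (p (n + 1) / p n) * v (Suc n))"
  proof (rule seq_limit_cong)
    fix n :: nat assume "n \<ge> 1"
    then show "l (\<psi> (BM_power M \<psi> n X)) / complex_of_real (p n) = complex_of_real (p (n + 1) / p n) * v (Suc n)"
      using gauge_pos[of n] gauge_pos[of "Suc n"] X by (simp add: v_def BM_power_apply)
  qed
  also have "\<dots> = complex_of_real (gauge_const p) * seq_limit L v"
    by (rule seq_limit_gauge_ratio[OF L gauge v])
  also have "seq_limit L v = l (Epow L X)"
    unfolding v_def by (rule Elim_pairing[OF gauge_pos dom L X l, symmetric])
  finally show "l (\<psi> (Epow L X)) = l (complex_of_real (gauge_const p) \<cdot>\<^sub>C Epow L X)"
    using predual_scale[OF l Epow_mem[OF L X]] by simp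
qed

text \<open>On the range of \<open>Epow L2\<close> the powers of \<psi> act as powers of the scalar
  \<open>gauge_const p\<close>, so only a scalar sequence remains under \<open>L1\<close>.\<close>

lemma Epow_comp_Epow:
  assumes L: "banach_limit L1" "banach_limit L2" and X: "X \<in> M"
  shows "Epow L1 (Epow L2 X) = gauge_gamma L1 p \<cdot>\<^sub>C Epow L2 X"
proof (rule predual_separates)
  let ?c = "gauge_const p"
  note EX = Epow_mem[OF L(2) X]
  show "Epow L1 (Epow L2 X) \<in> M" "gauge_gamma L1 p \<cdot>\<^sub>C Epow L2 X \<in> M"
    using Epow_mem[OF L(1) EX] M_scale[OF EX] by blast+
  fix l assume l: "l \<in> predual M"
  have pow: "(\<psi> ^^ n) (Epow L2 X) = complex_of_real (?c ^ n) \<cdot>\<^sub>C Epow L2 X" for n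
  proof (induction n)
    case (Suc n)
    then show ?case
      using BM_scaleC[OF Bhat_BM[OF \<psi>] EX] Epow_eigenvector[OF L(2) X] by (simp add: op_scale_simps(4) mult.commute)
  qed (simp add: op_scale_simps)
  have eq: "l (BM_power M \<psi> n (Epow L2 X)) / complex_of_real (p n) = l (Epow L2 X) * complex_of_real (?c ^ n / p n)" for n
    using EX by (simp add: BM_power_apply pow predual_scale[OF l] mult.commute)
  have "l (Epow L1 (Epow L2 X)) = seq_limit L1 (\<lambda>n. l (Epow L2 X) * complex_of_real (?c ^ n / p n))"
    using Elim_pairing[OF gauge_pos dom L(1) EX l] by (simp only: eq)
  also have "\<dots> = l (Epow L2 X) * gauge_gamma L1 p"
  proof (cases "l (Epow L2 X) = 0")
    case True
    then show ?thesis using banach_limit_const[OF L(1), of 0] by (simp add: seq_limit_def)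
  next
    case False
    \<comment> \<open>Boundedness of the scalar sequence is inherited from the dominated pairings
      after division by a nonzero one.\<close>
    have "Bseq (\<lambda>n. l (Epow L2 X) * complex_of_real (?c ^ Suc n / p (Suc n)))"
      using dominated_Bseq[OF gauge_pos dom l EX] unfolding eq .
    then have "Bseq (\<lambda>n. inverse (l (Epow L2 X)) * (l (Epow L2 X) * complex_of_real (?c ^ Suc n / p (Suc n))))"
      by (rule Bseq_mult[OF Bfun_const])
    moreover have "inverse (l (Epow L2 X)) * (l (Epow L2 X) * z) = z" for z using False by simp
    ultimately have B: "Bseq (\<lambda>n. complex_of_real (?c ^ Suc n / p (Suc n)))" by (simp only:)
    show ?thesis
      unfolding gauge_gamma_def seq_limit_def Suc_eq_plus1[symmetric] banach_limit_mult[OF L(1) B] by simp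
  qed
  finally show "l (Epow L1 (Epow L2 X)) = l (gauge_gamma L1 p \<cdot>\<^sub>C Epow L2 X)"
    using predual_scale[OF l EX] by (simp add: mult.commute)
qed

lemma Epow_commute:
  assumes L: "banach_limit L1" "banach_limit L2" and X: "X \<in> M"
  shows "Epow L1 (Epow L2 X) = Epow L2 (Epow L1 X)"
proof (rule Elim_commute[OF gauge_pos hat_power(1)[OF \<psi>] dom _ _ L X])
  show "dominated M p (\<lambda>n. hat M \<tau> (BM_power M \<psi> n))" using dom' by (simp add: hat_power(2)[OF \<psi>])
  fix m n :: nat and X assume X: "X \<in> M"
  have "(\<psi> ^^ n) ((\<psi> ^^ m) X) = (\<psi> ^^ (n + m)) X" for n m by (simp add: funpow_add)
  then have "(\<psi> ^^ n) ((\<psi> ^^ m) X) = (\<psi> ^^ m) ((\<psi> ^^ n) X)" by (simp only: add.commute)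
  then show "BM_power M \<psi> n (BM_power M \<psi> m X) = BM_power M \<psi> m (BM_power M \<psi> n X)"
    using power_mem[OF Bhat_BM[OF \<psi>]] X by (simp add: BM_power_apply)
qed

text \<open>All the factors gamma equal \<open>c\<close>, so computing a composite in both orders
  gives c times either operator, and \<open>c\<close> cancels.\<close>

lemma weakly_almost_convergent_powers:
  assumes c: "c \<noteq> 0" and ac: "almost_convergent_to (\<lambda>n. gauge_const p ^ n / p n) c"
  shows "\<exists>\<phi>\<in>Bhat M \<tau>. weakly_almost_convergent_to M
    (\<lambda>n. BM_scale M (complex_of_real (inverse (p n))) (BM_power M \<psi> n)) \<phi>"
proof -
  have gamma: "gauge_gamma L p = complex_of_real c" if "banach_limit L" for L
    unfolding gauge_gamma_def by (rule seq_limit_almost_convergent[OF that almost_convergent_to_of_real[OF ac]])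
  have same: "Epow L1 X = Epow L2 X" if L: "banach_limit L1" "banach_limit L2" and X: "X \<in> M" for L1 L2 X
  proof -
    have "complex_of_real c \<cdot>\<^sub>C Epow L2 X = complex_of_real c \<cdot>\<^sub>C Epow L1 X"
      using Epow_comp_Epow[OF L X] Epow_comp_Epow[OF L(2) L(1) X] Epow_commute[OF L X] gamma L by simp
    then have "complex_of_real (1 / c) \<cdot>\<^sub>C complex_of_real c \<cdot>\<^sub>C Epow L2 X = complex_of_real (1 / c) \<cdot>\<^sub>C complex_of_real c \<cdot>\<^sub>C Epow L1 X"
      by simp
    moreover have "complex_of_real (1 / c) * complex_of_real c = 1" using c by simp
    ultimately show ?thesis by (simp only: op_scale_simps(1,4))
  qed
  \<comment> \<open>Any one Banach limit may serve to define the limit operator.\<close>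
  obtain L0 where L0: "banach_limit L0" using exists_banach_limit by blast
  \<comment> \<open>The preadjoint of the scaled power is \<open>a\<close> times that of the power,
    and the predual is closed under scalar multiples.\<close>
  have sc: "BM_scale M a (BM_power M \<psi> n) \<in> BwM M" for a n
    unfolding BwM_iff[OF predual_nonempty]
  proof (intro conjI ballI)
    have Pn: "BM_power M \<psi> n \<in> BM M" by (rule BM_power_BM[OF Bhat_BM[OF \<psi>]])
    obtain K where K: "K > 0" "\<And>A. A \<in> M \<Longrightarrow> norm (BM_power M \<psi> n A) \<le> K * norm A" using BM_bounded[OF Pn] by blast
    have "norm (a \<cdot>\<^sub>C BM_power M \<psi> n A) \<le> (cmod a * K) * norm A" if "A \<in> M" for A
      using norm_op_scale[of a "BM_power M \<psi> n A"] mult_left_mono[OF K(2)[OF that], of "cmod a"]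
      by (simp add: mult.assoc)
    then have "\<exists>K. \<forall>A\<in>M. norm (a \<cdot>\<^sub>C BM_power M \<psi> n A) \<le> K * norm A" by blast
    then show "BM_scale M a (BM_power M \<psi> n) \<in> BM M"
      unfolding BM_def BM_scale_def
      by (simp add: Pi_iff M_add M_scale BM_mem[OF Pn] BM_add[OF Pn] BM_scaleC[OF Pn] op_scale_simps(3,4) mult.commute)
    fix l assume l: "l \<in> predual M"
    have pre: "preadjoint M (BM_power M \<psi> n) l \<in> predual M"
      using Bhat_BwM[OF hat_power(1)[OF \<psi>]] l BwM_iff[OF predual_nonempty] by blast
    have eq: "preadjoint M (BM_scale M a (BM_power M \<psi> n)) l A = 0 + a * preadjoint M (BM_power M \<psi> n) l A" if "A \<in> M" for A
      using that by (simp add: preadjoint_def BM_scale_def predual_scale[OF l BM_mem[OF Pn]])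
    have "vec_approximable M (\<lambda>A. 0)"
      using vec_approximable_vec_sum[of M "[]"] unfolding vec_approximable_def by simp
    then have "vec_approximable M (\<lambda>A. 0 + a * preadjoint M (BM_power M \<psi> n) l A)"
      by (rule vec_approximable_combination[OF _ predual_vec_approximable[OF pre]])
    then have "vec_approximable M (preadjoint M (BM_scale M a (BM_power M \<psi> n)) l)"
      unfolding vec_approximable_def using eq by simp
    moreover have "clinear_on M (preadjoint M (BM_scale M a (BM_power M \<psi> n)) l)"
      using predual_clinear[OF pre] unfolding clinear_on_def by (simp add: eq M_add M_scale algebra_simps)
    ultimately show "preadjoint M (BM_scale M a (BM_power M \<psi> n)) l \<in> predual M"
      unfolding predual_iff by (simp add: preadjoint_def)
  qed
  have "almost_convergent_to (\<lambda>n. l (BM_scale M (complex_of_real (inverse (p n))) (BM_power M \<psi> n) X - Epow L0 X)) 0"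
    if l: "l \<in> predual M" and X: "X \<in> M" for l X
  proof -
    have eq: "l (BM_scale M (complex_of_real (inverse (p n))) (BM_power M \<psi> n) X - Epow L0 X)
        = l (BM_power M \<psi> n X) / complex_of_real (p n) + (- l (Epow L0 X))" for n
    proof -
      have "BM_power M \<psi> n X \<in> M" by (rule BM_mem[OF BM_power_BM[OF Bhat_BM[OF \<psi>]] X])
      then show ?thesis
        using X by (simp add: BM_scale_def predual_diff[OF l] M_scale Epow_mem[OF L0] predual_scale[OF l] divide_inverse mult.commute)
    qed
    note B = dominated_Bseq[OF gauge_pos dom l X]
    show ?thesis
      unfolding eq
    proof (rule almost_convergent_if_seq_limits_eq_0)
      show "bounded ((\<lambda>n. l (BM_power M \<psi> n X) / complex_of_real (p n) + (- l (Epow L0 X))) ` {1..})"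
        unfolding Bseq_bounded_from_1 by (rule Bseq_add[OF B])
      fix L assume L: "banach_limit L"
      have "seq_limit L (\<lambda>n. l (BM_power M \<psi> n X) / complex_of_real (p n) + (- l (Epow L0 X)))
          = seq_limit L (\<lambda>n. l (BM_power M \<psi> n X) / complex_of_real (p n)) + (- l (Epow L0 X))"
        unfolding seq_limit_def
        using banach_limit_add[OF L B, of "\<lambda>n. - l (Epow L0 X)"] banach_limit_const[OF L, of "- l (Epow L0 X)"] by (simp add: Bfun_const)
      also have "\<dots> = l (Epow L X) - l (Epow L0 X)" using Elim_pairing[OF gauge_pos dom L X l] by simp
      also have "\<dots> = 0" using same[OF L L0 X] by simp
      finally show "seq_limit L (\<lambda>n. l (BM_power M \<psi> n X) / complex_of_real (p n) + (- l (Epow L0 X))) = 0" .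
    qed
  qed
  then have "weakly_almost_convergent_to M (\<lambda>n. BM_scale M (complex_of_real (inverse (p n))) (BM_power M \<psi> n)) (Epow L0)"
    unfolding weakly_almost_convergent_to_def using sc Bhat_BwM[OF Epow_Bhat[OF L0]] by blast
  then show ?thesis using Epow_Bhat[OF L0] by blast
qed

end

end

lemma compose_eq_iff: "compose M f g = compose M f' g' \<longleftrightarrow> (\<forall>X\<in>M. f (g X) = f' (g' X))"
  by (auto simp: compose_def fun_eq_iff restrict_def)

theorem theorem2p4:
  fixes M :: "('h::{complex_hilbert, second_countable_topology} \<Rightarrow>\<^sub>L 'h) set"
    and \<tau> :: "('h \<Rightarrow>\<^sub>L 'h) \<Rightarrow> complex"
    and p :: "nat \<Rightarrow> real"
  assumes "finite_von_neumann_algebra M"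
    and "faithful_normal_trace M \<tau>"
    and "growth_gauge p"
  shows
    "(\<forall>\<Phi>. (\<forall>n\<ge>1. \<Phi> n \<in> Bhat M \<tau>) \<and> dominated M p \<Phi> \<and>
           dominated M p (\<lambda>n. hat M \<tau> (\<Phi> n)) \<longrightarrow>
        (\<forall>L. banach_limit L \<longrightarrow>
           Elim M p \<Phi> L \<in> Bhat M \<tau> \<and>
           hat M \<tau> (Elim M p \<Phi> L) = Elim M p (\<lambda>n. hat M \<tau> (\<Phi> n)) L) \<and>
        ((\<forall>m\<ge>1. \<forall>n\<ge>1. compose M (\<Phi> n) (\<Phi> m) = compose M (\<Phi> m) (\<Phi> n)) \<longrightarrow>
           (\<forall>L1 L2. banach_limit L1 \<and> banach_limit L2 \<longrightarrow>
              compose M (Elim M p \<Phi> L1) (Elim M p \<Phi> L2) =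
              compose M (Elim M p \<Phi> L2) (Elim M p \<Phi> L1)))) \<and>
     (\<forall>\<psi> \<Phi>. \<psi> \<in> Bhat M \<tau> \<and> \<Phi> = BM_power M \<psi> \<and> dominated M p \<Phi> \<and>
           dominated M p (\<lambda>n. BM_power M (hat M \<tau> \<psi>) n) \<longrightarrow>
        (\<forall>n\<ge>1. hat M \<tau> (\<Phi> n) = BM_power M (hat M \<tau> \<psi>) n) \<and>
        (\<forall>L1 L2. banach_limit L1 \<and> banach_limit L2 \<longrightarrow>
           compose M (Elim M p \<Phi> L2) (Elim M p \<Phi> L1) =
             compose M (Elim M p \<Phi> L1) (Elim M p \<Phi> L2) \<and>
           compose M (Elim M p \<Phi> L1) (Elim M p \<Phi> L2) =
             BM_scale M (gauge_gamma L1 p) (Elim M p \<Phi> L2) \<and>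
           BM_scale M (gauge_gamma L1 p) (Elim M p \<Phi> L2) =
             BM_scale M (gauge_gamma L2 p) (Elim M p \<Phi> L1)) \<and>
        ((\<exists>c. c \<noteq> 0 \<and> almost_convergent_to (\<lambda>n. gauge_const p ^ n / p n) c) \<longrightarrow>
           (\<exists>\<phi>\<in>Bhat M \<tau>. weakly_almost_convergent_to M
              (\<lambda>n. BM_scale M (complex_of_real (inverse (p n))) (\<Phi> n)) \<phi>)))"
proof -
  interpret traced_von_neumann M \<tau>
    by unfold_locales (use assms in \<open>simp_all add: finite_von_neumann_algebra_def\<close>)
  have p: "\<And>n. n \<ge> 1 \<Longrightarrow> p n > 0" using assms(3) by (simp add: growth_gauge_def)
  show ?thesis
  proof (rule conjI; intro allI impI; elim conjE)
    fix \<Phi> assume \<Phi>: "\<forall>n\<ge>1. \<Phi> n \<in> Bhat M \<tau>" and dom: "dominated M p \<Phi>"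
      and dom': "dominated M p (\<lambda>n. hat M \<tau> (\<Phi> n))"
    have \<Phi>': "\<And>n. n \<ge> 1 \<Longrightarrow> \<Phi> n \<in> Bhat M \<tau>" using \<Phi> by blast
    note Elim = Elim_Bhat[where p = p and \<Phi> = \<Phi>, OF p \<Phi>' dom dom']
    show "(\<forall>L. banach_limit L \<longrightarrow>
           Elim M p \<Phi> L \<in> Bhat M \<tau> \<and>
           hat M \<tau> (Elim M p \<Phi> L) = Elim M p (\<lambda>n. hat M \<tau> (\<Phi> n)) L) \<and>
        ((\<forall>m\<ge>1. \<forall>n\<ge>1. compose M (\<Phi> n) (\<Phi> m) = compose M (\<Phi> m) (\<Phi> n)) \<longrightarrow>
           (\<forall>L1 L2. banach_limit L1 \<and> banach_limit L2 \<longrightarrow>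
              compose M (Elim M p \<Phi> L1) (Elim M p \<Phi> L2) =
              compose M (Elim M p \<Phi> L2) (Elim M p \<Phi> L1)))"
    proof (rule conjI; intro allI impI)
      show "Elim M p \<Phi> L \<in> Bhat M \<tau> \<and> hat M \<tau> (Elim M p \<Phi> L) = Elim M p (\<lambda>n. hat M \<tau> (\<Phi> n)) L"
        if "banach_limit L" for L
        by (rule conjI[OF Elim(1)[OF _ _ that] Elim(2)[OF _ _ that]])
    next
      fix L1 L2
      assume comm: "\<forall>m\<ge>1. \<forall>n\<ge>1. compose M (\<Phi> n) (\<Phi> m) = compose M (\<Phi> m) (\<Phi> n)"
        and "banach_limit L1 \<and> banach_limit L2"
      then have L: "banach_limit L1" "banach_limit L2" by auto
      have comm': "\<Phi> n (\<Phi> m X) = \<Phi> m (\<Phi> n X)" if "m \<ge> 1" "n \<ge> 1" "X \<in> M" for m n X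
        using comm that unfolding compose_eq_iff by blast
      show "compose M (Elim M p \<Phi> L1) (Elim M p \<Phi> L2) = compose M (Elim M p \<Phi> L2) (Elim M p \<Phi> L1)"
        unfolding compose_eq_iff by (intro ballI Elim_commute[OF p \<Phi>' dom dom' comm' L])
    qed
  next
    fix \<psi> \<Phi> assume \<psi>: "\<psi> \<in> Bhat M \<tau>" and \<Phi>: "\<Phi> = BM_power M \<psi>" and dom: "dominated M p \<Phi>"
      and dom': "dominated M p (\<lambda>n. BM_power M (hat M \<tau> \<psi>) n)"
    note pw = assms(3) \<psi> dom[unfolded \<Phi>] dom'
    show "(\<forall>n\<ge>1. hat M \<tau> (\<Phi> n) = BM_power M (hat M \<tau> \<psi>) n) \<and>
        (\<forall>L1 L2. banach_limit L1 \<and> banach_limit L2 \<longrightarrow>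
           compose M (Elim M p \<Phi> L2) (Elim M p \<Phi> L1) =
             compose M (Elim M p \<Phi> L1) (Elim M p \<Phi> L2) \<and>
           compose M (Elim M p \<Phi> L1) (Elim M p \<Phi> L2) =
             BM_scale M (gauge_gamma L1 p) (Elim M p \<Phi> L2) \<and>
           BM_scale M (gauge_gamma L1 p) (Elim M p \<Phi> L2) =
             BM_scale M (gauge_gamma L2 p) (Elim M p \<Phi> L1)) \<and>
        ((\<exists>c. c \<noteq> 0 \<and> almost_convergent_to (\<lambda>n. gauge_const p ^ n / p n) c) \<longrightarrow>
           (\<exists>\<phi>\<in>Bhat M \<tau>. weakly_almost_convergent_to M
              (\<lambda>n. BM_scale M (complex_of_real (inverse (p n))) (\<Phi> n)) \<phi>))"
    proof (rule conjI[OF _ conjI]; intro allI impI)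
      show "hat M \<tau> (\<Phi> n) = BM_power M (hat M \<tau> \<psi>) n" for n unfolding \<Phi> by (rule hat_power(2)[OF \<psi>])
    next
      fix L1 L2 assume "banach_limit L1 \<and> banach_limit L2"
      then have L: "banach_limit L1" "banach_limit L2" by auto
      have comp: "compose M (Elim M p \<Phi> L1) (Elim M p \<Phi> L2) = BM_scale M (gauge_gamma L1 p) (Elim M p \<Phi> L2)"
        if "banach_limit L1" "banach_limit L2" for L1 L2
        unfolding compose_def BM_scale_def \<Phi> using Epow_comp_Epow[OF pw that] by (auto simp: restrict_def)
      \<comment> \<open>Commutation links \<open>comp\<close> with its instance for exchanged
        limits, which closes the chain of equalities.\<close>
      have "compose M (Elim M p \<Phi> L2) (Elim M p \<Phi> L1) = compose M (Elim M p \<Phi> L1) (Elim M p \<Phi> L2)"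
        unfolding compose_eq_iff \<Phi> using Epow_commute[OF pw L] by auto
      then show "compose M (Elim M p \<Phi> L2) (Elim M p \<Phi> L1) = compose M (Elim M p \<Phi> L1) (Elim M p \<Phi> L2) \<and>
          compose M (Elim M p \<Phi> L1) (Elim M p \<Phi> L2) = BM_scale M (gauge_gamma L1 p) (Elim M p \<Phi> L2) \<and>
          BM_scale M (gauge_gamma L1 p) (Elim M p \<Phi> L2) = BM_scale M (gauge_gamma L2 p) (Elim M p \<Phi> L1)"
        using comp[OF L] comp[OF L(2) L(1)] by simp
    next
      assume "\<exists>c. c \<noteq> 0 \<and> almost_convergent_to (\<lambda>n. gauge_const p ^ n / p n) c"
      then show "\<exists>\<phi>\<in>Bhat M \<tau>. weakly_almost_convergent_to M
              (\<lambda>n. BM_scale M (complex_of_real (inverse (p n))) (\<Phi> n)) \<phi>"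
        unfolding \<Phi> using weakly_almost_convergent_powers[OF pw] by blast
    qed
  qed
qed

end
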